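(* Let $\mathsf{M}$ be any monoidal model category (cofibrantly generated or not). Then for every $n\geq 1$ the diagram category $\mathsf{M}^{I^{\times n}}$, equipped with its projective model structure (and the iterated pushout product monoidal structure), is a monoidal model category.
   Context: A monoidal model category is a bicomplete symmetric monoidal closed category $(\mathsf{M},\otimes,\mathbb{1},\operatorname{Hom})$, with initial object $\varnothing$, equipped with a model structure satisfying the pushout product axiom: for any cofibrations $f:X_0\to X_1$ and $g:Y_0\to Y_1$, the pushout product map $$f\,\square\, g:\ (X_0\otimes Y_1)\coprod_{X_0\otimes Y_0}(X_1\otimes Y_0)\to X_1\otimes Y_1$$ is a cofibration, and if in addition $f$ or $g$ is a weak equivalence then $f\,\square\, g$ is a trivial cofibration. For a category $\mathsf{C}$, the arrow category $\operatorname{Arr}(\mathsf{C})$ has the maps of $\mathsf{C}$ as objects and commutative squares as morphisms. If $\mathsf{C}$ is bicomplete symmetric monoidal closed with unit $\mathbb{1}$ and initial object $\varnothing$, then $\operatorname{Arr}(\mathsf{C})$ is symmetric monoidal closed under the pushout product monoidal structure: the product of $f$ and $g$ is $f\,\square\, g$ and the unit is $\varnothing\to\mathbb{1}$. Define $\mathsf{M}^{I}=\operatorname{Arr}(\mathsf{M})$ and $\mathsf{M}^{I^{\times n}}=\operatorname{Arr}(\mathsf{M}^{I^{\times (n-1)}})$ for $n\ge 2$. Thus objects of $\mathsf{M}^{I^{\times n}}$ are commutative $n$-cubes in $\mathsf{M}$, i.e. functors $\{0\to 1\}^{\times n}\to\mathsf{M}$, and morphisms are natural transformations (commutative $(n+1)$-cubes).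 The monoidal structure on $\mathsf{M}^{I^{\times n}}$ is the pushout product monoidal structure on $\operatorname{Arr}(\mathsf{M}^{I^{\times (n-1)}})$, iteratively. The projective model structure on $\mathsf{M}^{I^{\times n}}$ is the model structure in which weak equivalences and fibrations are defined pointwise in $\mathsf{M}$. *)

theory Defs
  imports Main
begin

unbundle cardinal_syntax

section \<open>Categories, limits and colimits\<close>

record ('o, 'm) cat =
  Obj :: "'o set"
  Mor :: "'m set"
  Dom :: "'m \<Rightarrow> 'o"
  Cod :: "'m \<Rightarrow> 'o"
  Ide :: "'o \<Rightarrow> 'm"
  Comp :: "'m \<Rightarrow> 'm \<Rightarrow> 'm" (infixl "\<cdot>\<index>" 70)

definition hom :: "('o, 'm, 'x) cat_scheme \<Rightarrow> 'o \<Rightarrow> 'o \<Rightarrow> 'm set" where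
  "hom C x y = {f \<in> Mor C. Dom C f = x \<and> Cod C f = y}"

locale category =
  fixes C :: "('o, 'm, 'x) cat_scheme" (structure)
  assumes Dom_Obj: "f \<in> Mor C \<Longrightarrow> Dom C f \<in> Obj C"
    and Cod_Obj: "f \<in> Mor C \<Longrightarrow> Cod C f \<in> Obj C"
    and Ide_hom: "x \<in> Obj C \<Longrightarrow> Ide C x \<in> hom C x x"
    and Comp_hom: "f \<in> hom C x y \<Longrightarrow> g \<in> hom C y z \<Longrightarrow> g \<cdot> f \<in> hom C x z"
    and Comp_Ide_left: "f \<in> hom C x y \<Longrightarrow> Ide C y \<cdot> f = f"
    and Comp_Ide_right: "f \<in> hom C x y \<Longrightarrow> f \<cdot> Ide C x = f"
    and Comp_assoc: "f \<in> hom C w x \<Longrightarrow> g \<in> hom C x y \<Longrightarrow> h \<in> hom C y z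
      \<Longrightarrow> h \<cdot> (g \<cdot> f) = (h \<cdot> g) \<cdot> f"

definition is_iso :: "('o, 'm, 'x) cat_scheme \<Rightarrow> 'm \<Rightarrow> bool" where
  "is_iso C f \<longleftrightarrow> f \<in> Mor C \<and> (\<exists>g \<in> hom C (Cod C f) (Dom C f).
     g \<cdot>\<^bsub>C\<^esub> f = Ide C (Dom C f) \<and> f \<cdot>\<^bsub>C\<^esub> g = Ide C (Cod C f))"

definition is_functor ::
  "('a, 'b, 'y) cat_scheme \<Rightarrow> ('o, 'm, 'x) cat_scheme \<Rightarrow> ('a \<Rightarrow> 'o) \<Rightarrow> ('b \<Rightarrow> 'm) \<Rightarrow> bool" where
  "is_functor J C Fo Fm \<longleftrightarrow>
     (\<forall>j \<in> Obj J. Fo j \<in> Obj C \<and> Fm (Ide J j) = Ide C (Fo j)) \<and>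
     (\<forall>u \<in> Mor J. Fm u \<in> hom C (Fo (Dom J u)) (Fo (Cod J u))) \<and>
     (\<forall>u \<in> Mor J. \<forall>v \<in> Mor J. Dom J v = Cod J u \<longrightarrow> Fm (v \<cdot>\<^bsub>J\<^esub> u) = Fm v \<cdot>\<^bsub>C\<^esub> Fm u)"

definition is_cone ::
  "('a, 'b, 'y) cat_scheme \<Rightarrow> ('o, 'm, 'x) cat_scheme \<Rightarrow> ('a \<Rightarrow> 'o) \<Rightarrow> ('b \<Rightarrow> 'm)
    \<Rightarrow> 'o \<Rightarrow> ('a \<Rightarrow> 'm) \<Rightarrow> bool" where
  "is_cone J C Fo Fm x p \<longleftrightarrow> x \<in> Obj C \<and> (\<forall>j \<in> Obj J. p j \<in> hom C x (Fo j)) \<and>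
     (\<forall>u \<in> Mor J. Fm u \<cdot>\<^bsub>C\<^esub> p (Dom J u) = p (Cod J u))"

definition is_limit ::
  "('a, 'b, 'y) cat_scheme \<Rightarrow> ('o, 'm, 'x) cat_scheme \<Rightarrow> ('a \<Rightarrow> 'o) \<Rightarrow> ('b \<Rightarrow> 'm)
    \<Rightarrow> 'o \<Rightarrow> ('a \<Rightarrow> 'm) \<Rightarrow> bool" where
  "is_limit J C Fo Fm x p \<longleftrightarrow> is_cone J C Fo Fm x p \<and>
     (\<forall>y q. is_cone J C Fo Fm y q \<longrightarrow> (\<exists>!h. h \<in> hom C y x \<and> (\<forall>j \<in> Obj J. p j \<cdot>\<^bsub>C\<^esub> h = q j)))"

definition is_cocone ::
  "('a, 'b, 'y) cat_scheme \<Rightarrow> ('o, 'm, 'x) cat_scheme \<Rightarrow> ('a \<Rightarrow> 'o) \<Rightarrow> ('b \<Rightarrow> 'm)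
    \<Rightarrow> 'o \<Rightarrow> ('a \<Rightarrow> 'm) \<Rightarrow> bool" where
  "is_cocone J C Fo Fm x p \<longleftrightarrow> x \<in> Obj C \<and> (\<forall>j \<in> Obj J. p j \<in> hom C (Fo j) x) \<and>
     (\<forall>u \<in> Mor J. p (Cod J u) \<cdot>\<^bsub>C\<^esub> Fm u = p (Dom J u))"

definition is_colimit ::
  "('a, 'b, 'y) cat_scheme \<Rightarrow> ('o, 'm, 'x) cat_scheme \<Rightarrow> ('a \<Rightarrow> 'o) \<Rightarrow> ('b \<Rightarrow> 'm)
    \<Rightarrow> 'o \<Rightarrow> ('a \<Rightarrow> 'm) \<Rightarrow> bool" where
  "is_colimit J C Fo Fm x p \<longleftrightarrow> is_cocone J C Fo Fm x p \<and>
     (\<forall>y q. is_cocone J C Fo Fm y q \<longrightarrow> (\<exists>!h. h \<in> hom C x y \<and> (\<forall>j \<in> Obj J. h \<cdot>\<^bsub>C\<^esub> p j = q j)))"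

text \<open>
  A cardinal \<open>\<kappa>\<close> fixes the size convention: a category is small if it has fewer than \<open>\<kappa>\<close>
  morphisms.  Since \<open>\<kappa>\<close> is a relation on the type \<open>'s\<close>, every category of that size is isomorphic
  to one whose objects and morphisms are elements of \<open>'s\<close>, so quantifying over the latter loses
  nothing.  An inaccessible \<open>\<kappa>\<close> gives smallness with respect to a Grothendieck universe.
\<close>

definition bicomplete :: "'s rel \<Rightarrow> ('o, 'm, 'x) cat_scheme \<Rightarrow> bool" where
  "bicomplete \<kappa> C \<longleftrightarrow>
     (\<forall>(J :: ('s, 's) cat) Fo Fm. category J \<and> |Mor J| <o \<kappa> \<and> is_functor J C Fo Fm \<longrightarrow>
        (\<exists>x p. is_limit J C Fo Fm x p) \<and> (\<exists>x p. is_colimit J C Fo Fm x p))"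

definition is_initial :: "('o, 'm, 'x) cat_scheme \<Rightarrow> 'o \<Rightarrow> bool" where
  "is_initial C z \<longleftrightarrow> z \<in> Obj C \<and> (\<forall>x \<in> Obj C. \<exists>!h. h \<in> hom C z x)"

definition initial :: "('o, 'm, 'x) cat_scheme \<Rightarrow> 'o" where
  "initial C = (SOME z. is_initial C z)"

definition is_pushout :: "('o, 'm, 'x) cat_scheme \<Rightarrow> 'm \<Rightarrow> 'm \<Rightarrow> 'm \<Rightarrow> 'm \<Rightarrow> bool" where
  "is_pushout C f g i j \<longleftrightarrow>
     f \<in> Mor C \<and> g \<in> Mor C \<and> Dom C f = Dom C g \<and>
     i \<in> Mor C \<and> j \<in> Mor C \<and> Dom C i = Cod C f \<and> Dom C j = Cod C g \<and> Cod C i = Cod C j \<and>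
     i \<cdot>\<^bsub>C\<^esub> f = j \<cdot>\<^bsub>C\<^esub> g \<and>
     (\<forall>y. \<forall>u \<in> hom C (Cod C f) y. \<forall>v \<in> hom C (Cod C g) y. u \<cdot>\<^bsub>C\<^esub> f = v \<cdot>\<^bsub>C\<^esub> g \<longrightarrow>
        (\<exists>!h. h \<in> hom C (Cod C i) y \<and> h \<cdot>\<^bsub>C\<^esub> i = u \<and> h \<cdot>\<^bsub>C\<^esub> j = v))"

definition pushout :: "('o, 'm, 'x) cat_scheme \<Rightarrow> 'm \<Rightarrow> 'm \<Rightarrow> 'm \<times> 'm" where
  "pushout C f g = (SOME (i, j). is_pushout C f g i j)"


section \<open>Symmetric monoidal closed categories\<close>

record ('o, 'm) smcat = "('o, 'm) cat" +
  TensorO :: "'o \<Rightarrow> 'o \<Rightarrow> 'o" (infixl "\<otimes>\<index>" 75)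
  TensorM :: "'m \<Rightarrow> 'm \<Rightarrow> 'm" (infixl "\<odot>\<index>" 75)
  Unit :: "'o"
  Assoc :: "'o \<Rightarrow> 'o \<Rightarrow> 'o \<Rightarrow> 'm"
  LUnit :: "'o \<Rightarrow> 'm"
  RUnit :: "'o \<Rightarrow> 'm"
  Braid :: "'o \<Rightarrow> 'o \<Rightarrow> 'm"

locale symmetric_monoidal_category = category C
  for C :: "('o, 'm, 'x) smcat_scheme" (structure) +
  assumes TensorO_Obj: "x \<in> Obj C \<Longrightarrow> y \<in> Obj C \<Longrightarrow> x \<otimes> y \<in> Obj C"
    and TensorM_hom: "f \<in> hom C x x' \<Longrightarrow> g \<in> hom C y y' \<Longrightarrow> f \<odot> g \<in> hom C (x \<otimes> y) (x' \<otimes> y')"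
    and TensorM_Ide: "x \<in> Obj C \<Longrightarrow> y \<in> Obj C \<Longrightarrow> Ide C x \<odot> Ide C y = Ide C (x \<otimes> y)"
    and TensorM_Comp: "f \<in> hom C x x' \<Longrightarrow> f' \<in> hom C x' x'' \<Longrightarrow> g \<in> hom C y y' \<Longrightarrow> g' \<in> hom C y' y''
      \<Longrightarrow> (f' \<cdot> f) \<odot> (g' \<cdot> g) = (f' \<odot> g') \<cdot> (f \<odot> g)"
    and Unit_Obj: "Unit C \<in> Obj C"
    and Assoc_hom: "x \<in> Obj C \<Longrightarrow> y \<in> Obj C \<Longrightarrow> z \<in> Obj C
      \<Longrightarrow> Assoc C x y z \<in> hom C ((x \<otimes> y) \<otimes> z) (x \<otimes> (y \<otimes> z))"
    and Assoc_iso: "x \<in> Obj C \<Longrightarrow> y \<in> Obj C \<Longrightarrow> z \<in> Obj C \<Longrightarrow> is_iso C (Assoc C x y z)"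
    and Assoc_natural: "f \<in> hom C x x' \<Longrightarrow> g \<in> hom C y y' \<Longrightarrow> h \<in> hom C z z'
      \<Longrightarrow> Assoc C x' y' z' \<cdot> ((f \<odot> g) \<odot> h) = (f \<odot> (g \<odot> h)) \<cdot> Assoc C x y z"
    and LUnit_hom: "x \<in> Obj C \<Longrightarrow> LUnit C x \<in> hom C (Unit C \<otimes> x) x"
    and LUnit_iso: "x \<in> Obj C \<Longrightarrow> is_iso C (LUnit C x)"
    and LUnit_natural: "f \<in> hom C x y \<Longrightarrow> LUnit C y \<cdot> (Ide C (Unit C) \<odot> f) = f \<cdot> LUnit C x"
    and RUnit_hom: "x \<in> Obj C \<Longrightarrow> RUnit C x \<in> hom C (x \<otimes> Unit C) x"
    and RUnit_iso: "x \<in> Obj C \<Longrightarrow> is_iso C (RUnit C x)"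
    and RUnit_natural: "f \<in> hom C x y \<Longrightarrow> RUnit C y \<cdot> (f \<odot> Ide C (Unit C)) = f \<cdot> RUnit C x"
    and Braid_hom: "x \<in> Obj C \<Longrightarrow> y \<in> Obj C \<Longrightarrow> Braid C x y \<in> hom C (x \<otimes> y) (y \<otimes> x)"
    and Braid_natural: "f \<in> hom C x x' \<Longrightarrow> g \<in> hom C y y'
      \<Longrightarrow> Braid C x' y' \<cdot> (f \<odot> g) = (g \<odot> f) \<cdot> Braid C x y"
    and Braid_symmetric: "x \<in> Obj C \<Longrightarrow> y \<in> Obj C \<Longrightarrow> Braid C y x \<cdot> Braid C x y = Ide C (x \<otimes> y)"
    and pentagon: "w \<in> Obj C \<Longrightarrow> x \<in> Obj C \<Longrightarrow> y \<in> Obj C \<Longrightarrow> z \<in> Obj C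
      \<Longrightarrow> (Ide C w \<odot> Assoc C x y z) \<cdot> Assoc C w (x \<otimes> y) z \<cdot> (Assoc C w x y \<odot> Ide C z)
        = Assoc C w x (y \<otimes> z) \<cdot> Assoc C (w \<otimes> x) y z"
    and triangle: "x \<in> Obj C \<Longrightarrow> y \<in> Obj C
      \<Longrightarrow> (Ide C x \<odot> LUnit C y) \<cdot> Assoc C x (Unit C) y = RUnit C x \<odot> Ide C y"
    and hexagon: "x \<in> Obj C \<Longrightarrow> y \<in> Obj C \<Longrightarrow> z \<in> Obj C
      \<Longrightarrow> Assoc C y z x \<cdot> Braid C x (y \<otimes> z) \<cdot> Assoc C x y z
        = (Ide C y \<odot> Braid C x z) \<cdot> Assoc C y x z \<cdot> (Braid C x y \<odot> Ide C z)"

text \<open>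
  Closedness: each functor \<open>- \<otimes> y\<close> has a right adjoint, given by the universal arrows
  \<open>e : Hom(y, z) \<otimes> y \<rightarrow> z\<close>.
\<close>

locale symmetric_monoidal_closed_category = symmetric_monoidal_category +
  assumes closed: "y \<in> Obj C \<Longrightarrow> z \<in> Obj C \<Longrightarrow>
    \<exists>h \<in> Obj C. \<exists>e \<in> hom C (h \<otimes> y) z. \<forall>x \<in> Obj C. \<forall>f \<in> hom C (x \<otimes> y) z.
      \<exists>!g. g \<in> hom C x h \<and> e \<cdot> (g \<odot> Ide C y) = f"


section \<open>The pushout product\<close>

text \<open>
  For \<open>f : X\<^sub>0 \<rightarrow> X\<^sub>1\<close> and \<open>g : Y\<^sub>0 \<rightarrow> Y\<^sub>1\<close>, the maps \<open>pp_in0 C f g\<close> and \<open>pp_in1 C f g\<close> are the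
  structure maps of the chosen pushout from \<open>X\<^sub>0 \<otimes> Y\<^sub>1\<close> and \<open>X\<^sub>1 \<otimes> Y\<^sub>0\<close> respectively.
\<close>

definition pp_pushout :: "('o, 'm, 'x) smcat_scheme \<Rightarrow> 'm \<Rightarrow> 'm \<Rightarrow> 'm \<times> 'm" where
  "pp_pushout C f g =
     pushout C (Ide C (Dom C f) \<odot>\<^bsub>C\<^esub> g) (f \<odot>\<^bsub>C\<^esub> Ide C (Dom C g))"

definition pp_in0 :: "('o, 'm, 'x) smcat_scheme \<Rightarrow> 'm \<Rightarrow> 'm \<Rightarrow> 'm" where
  "pp_in0 C f g = fst (pp_pushout C f g)"

definition pp_in1 :: "('o, 'm, 'x) smcat_scheme \<Rightarrow> 'm \<Rightarrow> 'm \<Rightarrow> 'm" where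
  "pp_in1 C f g = snd (pp_pushout C f g)"

definition pp_dom :: "('o, 'm, 'x) smcat_scheme \<Rightarrow> 'm \<Rightarrow> 'm \<Rightarrow> 'o" where
  "pp_dom C f g = Cod C (pp_in0 C f g)"

definition pushout_product :: "('o, 'm, 'x) smcat_scheme \<Rightarrow> 'm \<Rightarrow> 'm \<Rightarrow> 'm"
    (infixl "\<box>\<index>" 75) where
  "pushout_product C f g =
     (THE h. h \<in> hom C (pp_dom C f g) (Cod C f \<otimes>\<^bsub>C\<^esub> Cod C g) \<and>
        h \<cdot>\<^bsub>C\<^esub> pp_in0 C f g = f \<odot>\<^bsub>C\<^esub> Ide C (Cod C g) \<and>
        h \<cdot>\<^bsub>C\<^esub> pp_in1 C f g = Ide C (Cod C f) \<odot>\<^bsub>C\<^esub> g)"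


section \<open>Arrow categories and cubes\<close>

text \<open>
  The arrow construction changes the types of objects and morphisms.  So that it can be iterated,
  everything lives in one type of cells: the objects and morphisms of the given category, and
  squares \<open>Sq f g a b\<close>, which stand for the morphism \<open>f \<rightarrow> g\<close> with components \<open>a : Dom f \<rightarrow> Dom g\<close>
  and \<open>b : Cod f \<rightarrow> Cod g\<close>.
\<close>

datatype ('o, 'm) cell =
    Ob (un_Ob: 'o)
  | Mo (un_Mo: 'm)
  | Sq (sq_dom: "('o, 'm) cell") (sq_cod: "('o, 'm) cell")
       (sq0: "('o, 'm) cell") (sq1: "('o, 'm) cell")

type_synonym ('o, 'm) cell_smcat = "(('o, 'm) cell, ('o, 'm) cell) smcat"

definition cells :: "('o, 'm) smcat \<Rightarrow> ('o, 'm) cell_smcat" where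
  "cells M =
    \<lparr>Obj = Ob ` Obj M,
     Mor = Mo ` Mor M,
     Dom = (\<lambda>f. Ob (Dom M (un_Mo f))),
     Cod = (\<lambda>f. Ob (Cod M (un_Mo f))),
     Ide = (\<lambda>x. Mo (Ide M (un_Ob x))),
     Comp = (\<lambda>g f. Mo (un_Mo g \<cdot>\<^bsub>M\<^esub> un_Mo f)),
     TensorO = (\<lambda>x y. Ob (un_Ob x \<otimes>\<^bsub>M\<^esub> un_Ob y)),
     TensorM = (\<lambda>f g. Mo (un_Mo f \<odot>\<^bsub>M\<^esub> un_Mo g)),
     Unit = Ob (Unit M),
     Assoc = (\<lambda>x y z. Mo (Assoc M (un_Ob x) (un_Ob y) (un_Ob z))),
     LUnit = (\<lambda>x. Mo (LUnit M (un_Ob x))),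
     RUnit = (\<lambda>x. Mo (RUnit M (un_Ob x))),
     Braid = (\<lambda>x y. Mo (Braid M (un_Ob x) (un_Ob y)))\<rparr>"

definition arr_unit :: "('o, 'm) cell_smcat \<Rightarrow> ('o, 'm) cell" where
  "arr_unit C = (THE h. h \<in> hom C (initial C) (Unit C))"

text \<open>
  The structure maps of the pushout product monoidal structure are those of \<open>C\<close> on codomains; on
  domains they are induced by those of \<open>C\<close> through the universal property of the pushouts.  The
  three conditions in the associator correspond to \<open>(X\<^sub>0 \<otimes> Y\<^sub>1) \<otimes> Z\<^sub>1\<close>, \<open>(X\<^sub>1 \<otimes> Y\<^sub>0) \<otimes> Z\<^sub>1\<close> and
  \<open>(X\<^sub>1 \<otimes> Y\<^sub>1) \<otimes> Z\<^sub>0\<close>.  For the unitors one summand of the pushout is an initial object, so one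
  condition suffices.
\<close>

definition arr_tensor :: "('o, 'm) cell_smcat \<Rightarrow> ('o, 'm) cell \<Rightarrow> ('o, 'm) cell \<Rightarrow> ('o, 'm) cell" where
  "arr_tensor C s t =
     (let f = sq_dom s; f' = sq_cod s; g = sq_dom t; g' = sq_cod t in
      Sq (f \<box>\<^bsub>C\<^esub> g) (f' \<box>\<^bsub>C\<^esub> g')
         (THE h. h \<in> hom C (pp_dom C f g) (pp_dom C f' g') \<and>
            h \<cdot>\<^bsub>C\<^esub> pp_in0 C f g = pp_in0 C f' g' \<cdot>\<^bsub>C\<^esub> (sq0 s \<odot>\<^bsub>C\<^esub> sq1 t) \<and>
            h \<cdot>\<^bsub>C\<^esub> pp_in1 C f g = pp_in1 C f' g' \<cdot>\<^bsub>C\<^esub> (sq1 s \<odot>\<^bsub>C\<^esub> sq0 t))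
         (sq1 s \<odot>\<^bsub>C\<^esub> sq1 t))"

definition arr_assoc ::
  "('o, 'm) cell_smcat \<Rightarrow> ('o, 'm) cell \<Rightarrow> ('o, 'm) cell \<Rightarrow> ('o, 'm) cell \<Rightarrow> ('o, 'm) cell" where
  "arr_assoc C f g k =
     Sq ((f \<box>\<^bsub>C\<^esub> g) \<box>\<^bsub>C\<^esub> k) (f \<box>\<^bsub>C\<^esub> (g \<box>\<^bsub>C\<^esub> k))
        (THE h. h \<in> hom C (pp_dom C (f \<box>\<^bsub>C\<^esub> g) k) (pp_dom C f (g \<box>\<^bsub>C\<^esub> k)) \<and>
           h \<cdot>\<^bsub>C\<^esub> (pp_in0 C (f \<box>\<^bsub>C\<^esub> g) k \<cdot>\<^bsub>C\<^esub> (pp_in0 C f g \<odot>\<^bsub>C\<^esub> Ide C (Cod C k)))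
             = pp_in0 C f (g \<box>\<^bsub>C\<^esub> k) \<cdot>\<^bsub>C\<^esub> Assoc C (Dom C f) (Cod C g) (Cod C k) \<and>
           h \<cdot>\<^bsub>C\<^esub> (pp_in0 C (f \<box>\<^bsub>C\<^esub> g) k \<cdot>\<^bsub>C\<^esub> (pp_in1 C f g \<odot>\<^bsub>C\<^esub> Ide C (Cod C k)))
             = pp_in1 C f (g \<box>\<^bsub>C\<^esub> k) \<cdot>\<^bsub>C\<^esub> (Ide C (Cod C f) \<odot>\<^bsub>C\<^esub> pp_in0 C g k)
                 \<cdot>\<^bsub>C\<^esub> Assoc C (Cod C f) (Dom C g) (Cod C k) \<and>
           h \<cdot>\<^bsub>C\<^esub> pp_in1 C (f \<box>\<^bsub>C\<^esub> g) k
             = pp_in1 C f (g \<box>\<^bsub>C\<^esub> k) \<cdot>\<^bsub>C\<^esub> (Ide C (Cod C f) \<odot>\<^bsub>C\<^esub> pp_in1 C g k)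
                 \<cdot>\<^bsub>C\<^esub> Assoc C (Cod C f) (Cod C g) (Dom C k))
        (Assoc C (Cod C f) (Cod C g) (Cod C k))"

definition arr_lunit :: "('o, 'm) cell_smcat \<Rightarrow> ('o, 'm) cell \<Rightarrow> ('o, 'm) cell" where
  "arr_lunit C f =
     Sq (arr_unit C \<box>\<^bsub>C\<^esub> f) f
        (THE h. h \<in> hom C (pp_dom C (arr_unit C) f) (Dom C f) \<and>
           h \<cdot>\<^bsub>C\<^esub> pp_in1 C (arr_unit C) f = LUnit C (Dom C f))
        (LUnit C (Cod C f))"

definition arr_runit :: "('o, 'm) cell_smcat \<Rightarrow> ('o, 'm) cell \<Rightarrow> ('o, 'm) cell" where
  "arr_runit C f =
     Sq (f \<box>\<^bsub>C\<^esub> arr_unit C) f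
        (THE h. h \<in> hom C (pp_dom C f (arr_unit C)) (Dom C f) \<and>
           h \<cdot>\<^bsub>C\<^esub> pp_in0 C f (arr_unit C) = RUnit C (Dom C f))
        (RUnit C (Cod C f))"

definition arr_braid :: "('o, 'm) cell_smcat \<Rightarrow> ('o, 'm) cell \<Rightarrow> ('o, 'm) cell \<Rightarrow> ('o, 'm) cell" where
  "arr_braid C f g =
     Sq (f \<box>\<^bsub>C\<^esub> g) (g \<box>\<^bsub>C\<^esub> f)
        (THE h. h \<in> hom C (pp_dom C f g) (pp_dom C g f) \<and>
           h \<cdot>\<^bsub>C\<^esub> pp_in0 C f g = pp_in1 C g f \<cdot>\<^bsub>C\<^esub> Braid C (Dom C f) (Cod C g) \<and>
           h \<cdot>\<^bsub>C\<^esub> pp_in1 C f g = pp_in0 C g f \<cdot>\<^bsub>C\<^esub> Braid C (Cod C f) (Dom C g))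
        (Braid C (Cod C f) (Cod C g))"

definition Arr :: "('o, 'm) cell_smcat \<Rightarrow> ('o, 'm) cell_smcat" where
  "Arr C =
    \<lparr>Obj = Mor C,
     Mor = {Sq f g a b | f g a b. f \<in> Mor C \<and> g \<in> Mor C \<and>
              a \<in> hom C (Dom C f) (Dom C g) \<and> b \<in> hom C (Cod C f) (Cod C g) \<and>
              g \<cdot>\<^bsub>C\<^esub> a = b \<cdot>\<^bsub>C\<^esub> f},
     Dom = sq_dom,
     Cod = sq_cod,
     Ide = (\<lambda>f. Sq f f (Ide C (Dom C f)) (Ide C (Cod C f))),
     Comp = (\<lambda>t s. Sq (sq_dom s) (sq_cod t) (sq0 t \<cdot>\<^bsub>C\<^esub> sq0 s) (sq1 t \<cdot>\<^bsub>C\<^esub> sq1 s)),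
     TensorO = pushout_product C,
     TensorM = arr_tensor C,
     Unit = arr_unit C,
     Assoc = arr_assoc C,
     LUnit = arr_lunit C,
     RUnit = arr_runit C,
     Braid = arr_braid C\<rparr>"

primrec cubes :: "nat \<Rightarrow> ('o, 'm) smcat \<Rightarrow> ('o, 'm) cell_smcat" where
  "cubes 0 M = cells M"
| "cubes (Suc n) M = Arr (cubes n M)"


section \<open>Monoidal model categories\<close>

record 'm model_structure =
  Weq :: "'m set"
  Cofib :: "'m set"
  Fib :: "'m set"

definition lifts :: "('o, 'm, 'x) cat_scheme \<Rightarrow> 'm \<Rightarrow> 'm \<Rightarrow> bool" where
  "lifts C i p \<longleftrightarrow>
     (\<forall>u \<in> hom C (Dom C i) (Dom C p). \<forall>v \<in> hom C (Cod C i) (Cod C p).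
        p \<cdot>\<^bsub>C\<^esub> u = v \<cdot>\<^bsub>C\<^esub> i \<longrightarrow>
        (\<exists>l \<in> hom C (Cod C i) (Dom C p). l \<cdot>\<^bsub>C\<^esub> i = u \<and> p \<cdot>\<^bsub>C\<^esub> l = v))"

definition is_retract :: "('o, 'm, 'x) cat_scheme \<Rightarrow> 'm \<Rightarrow> 'm \<Rightarrow> bool" where
  "is_retract C f g \<longleftrightarrow>
     (\<exists>s \<in> hom C (Dom C f) (Dom C g). \<exists>r \<in> hom C (Dom C g) (Dom C f).
      \<exists>s' \<in> hom C (Cod C f) (Cod C g). \<exists>r' \<in> hom C (Cod C g) (Cod C f).
        r \<cdot>\<^bsub>C\<^esub> s = Ide C (Dom C f) \<and> r' \<cdot>\<^bsub>C\<^esub> s' = Ide C (Cod C f) \<and>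
        g \<cdot>\<^bsub>C\<^esub> s = s' \<cdot>\<^bsub>C\<^esub> f \<and> f \<cdot>\<^bsub>C\<^esub> r = r' \<cdot>\<^bsub>C\<^esub> g)"

definition retract_closed :: "('o, 'm, 'x) cat_scheme \<Rightarrow> 'm set \<Rightarrow> bool" where
  "retract_closed C A \<longleftrightarrow> (\<forall>g \<in> A. \<forall>f \<in> Mor C. is_retract C f g \<longrightarrow> f \<in> A)"

locale model_category = category C
  for \<kappa> :: "'s rel" and C :: "('o, 'm, 'x) cat_scheme" (structure)
    and S :: "'m model_structure" +
  assumes bicomplete: "bicomplete \<kappa> C"
    and Weq_Mor: "Weq S \<subseteq> Mor C"
    and Cofib_Mor: "Cofib S \<subseteq> Mor C"
    and Fib_Mor: "Fib S \<subseteq> Mor C"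
    and two_of_three: "f \<in> hom C x y \<Longrightarrow> g \<in> hom C y z \<Longrightarrow>
      (f \<in> Weq S \<and> g \<in> Weq S \<longrightarrow> g \<cdot> f \<in> Weq S) \<and>
      (f \<in> Weq S \<and> g \<cdot> f \<in> Weq S \<longrightarrow> g \<in> Weq S) \<and>
      (g \<in> Weq S \<and> g \<cdot> f \<in> Weq S \<longrightarrow> f \<in> Weq S)"
    and retracts: "retract_closed C (Weq S)" "retract_closed C (Cofib S)" "retract_closed C (Fib S)"
    and lift_cofib: "i \<in> Cofib S \<Longrightarrow> p \<in> Fib S \<inter> Weq S \<Longrightarrow> lifts C i p"
    and lift_fib: "i \<in> Cofib S \<inter> Weq S \<Longrightarrow> p \<in> Fib S \<Longrightarrow> lifts C i p"
    and factor_cofib: "f \<in> Mor C \<Longrightarrow>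
      \<exists>i \<in> Cofib S. \<exists>p \<in> Fib S \<inter> Weq S. Cod C i = Dom C p \<and> f = p \<cdot> i"
    and factor_fib: "f \<in> Mor C \<Longrightarrow>
      \<exists>i \<in> Cofib S \<inter> Weq S. \<exists>p \<in> Fib S. Cod C i = Dom C p \<and> f = p \<cdot> i"

locale monoidal_model_category =
  symmetric_monoidal_closed_category C + model_category \<kappa> C S
  for \<kappa> :: "'s rel" and C :: "('o, 'm, 'x) smcat_scheme" (structure)
    and S :: "'m model_structure" +
  assumes pushout_product_cofib: "f \<in> Cofib S \<Longrightarrow> g \<in> Cofib S \<Longrightarrow> f \<box> g \<in> Cofib S"
    and pushout_product_trivial: "f \<in> Cofib S \<Longrightarrow> g \<in> Cofib S \<Longrightarrow> f \<in> Weq S \<or> g \<in> Weq S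
      \<Longrightarrow> f \<box> g \<in> Cofib S \<inter> Weq S"

text \<open>
  The components in the original category of a morphism of cubes, one for each vertex.
\<close>

primrec components :: "('o, 'm) cell \<Rightarrow> 'm set" where
  "components (Ob x) = {}"
| "components (Mo m) = {m}"
| "components (Sq f g a b) = components a \<union> components b"

text \<open>
  In a model category the cofibrations are exactly the maps with the left lifting property against
  trivial fibrations, so the pointwise weak equivalences and fibrations leave no other choice.
\<close>

definition projective ::
  "nat \<Rightarrow> ('o, 'm) smcat \<Rightarrow> 'm model_structure \<Rightarrow> ('o, 'm) cell model_structure" where
  "projective n M S =
     (let C = cubes n M;
          W = {u \<in> Mor C. components u \<subseteq> Weq S};
          F = {u \<in> Mor C. components u \<subseteq> Fib S}
      in \<lparr>Weq = W, Cofib = {i \<in> Mor C. \<forall>p \<in> F \<inter> W. lifts C i p}, Fib = F\<rparr>)"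

end

theory Submission
  imports Defs
begin

text \<open>
  A cube of dimension \<open>n + 1\<close> is an arrow between cubes of dimension \<open>n\<close>, and the projective model
  structure is pointwise at every stage.  So it suffices to pass from a monoidal model category \<open>C\<close>
  to \<open>Arr C\<close>, with weak equivalences and fibrations tested on the two components of a square
  (\<open>monoidal_model_category_Arr\<close>), and to start the induction by replacing \<open>M\<close> by its copy among
  the cells (\<open>monoidal_model_category_cells\<close>).

  \<^emph>\<open>The monoidal structure.\<close>  An arrow \<open>f\<close> is a functor on the poset \<open>{False \<le> True}\<close>, and \<open>f \<box> g\<close> is
  the Day convolution of \<open>f\<close> and \<open>g\<close> along \<open>\<and>\<close>: a map \<open>f \<box> g \<rightarrow> z\<close> is a natural family of maps
  \<open>f\<^sub>i \<otimes> g\<^sub>j \<rightarrow> z\<^bsub>i \<and> j\<^esub>\<close> (\<open>pushout_product_universal\<close>, \<open>pushout_product_ext\<close>).  As \<open>C\<close> is closed, its tensor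
  product preserves pushouts, so iterated pushout products have the analogous description
  (\<open>triple_universal\<close>, \<open>quadruple_ext\<close>).  Each structure map of \<open>Arr C\<close> is the one whose family consists
  of the corresponding structure maps of \<open>C\<close>; each coherence diagram for \<open>Arr C\<close> therefore reduces to
  the same diagram in \<open>C\<close>, by one computation that treats all indices alike.  The internal hom from
  \<open>g\<close> to \<open>z\<close> has domain \<open>Hom(g\<^sub>1, z\<^sub>0)\<close> and codomain the object of squares from \<open>g\<close> to \<open>z\<close>.

  \<^emph>\<open>The model structure.\<close>  A square \<open>s\<close> from \<open>f\<close> to \<open>f'\<close> has the components \<open>s\<^sub>0\<close>, \<open>s\<^sub>1\<close> and a corner map from
  the pushout of \<open>f\<close> and \<open>s\<^sub>0\<close> to \<open>f'\<^sub>1\<close>.  Lifts and factorizations are constructed first for \<open>s\<^sub>0\<close> and then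
  for the corner map.  Conversely, lifting properties of \<open>s\<close> descend to \<open>s\<^sub>0\<close> and to the corner map,
  since both operations are left adjoints whose right adjoints preserve fibrations and trivial
  fibrations.  So \<open>s\<close> is a (trivial) cofibration if and only if \<open>s\<^sub>0\<close> and the corner map are
  (\<open>arr_cofib_iff\<close>, \<open>arr_trivial_cofib_iff\<close>).

  \<^emph>\<open>The pushout product axiom.\<close>  In a model category, being a (trivial) cofibration is a lifting property.
  Let \<open>s\<close> and \<open>t\<close> be cofibrations of arrows with corner maps \<open>c\<close> and \<open>d\<close>.  A lift of the pushout product
  of \<open>s\<close> and \<open>t\<close> against \<open>p\<close> is put together from three lifts in \<open>C\<close>: of \<open>s\<^sub>1 \<box> t\<^sub>0\<close> and \<open>s\<^sub>0 \<box> d\<close> against \<open>p\<^sub>0\<close>,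
  and of \<open>c \<box> d\<close> against \<open>p\<^sub>1\<close> (\<open>pp_lifts_Arr\<close>).  The axiom in \<open>C\<close> provides all three.
\<close>

section \<open>Composition, pushouts and lifting in a category\<close>

lemma hom_iff [simp]: "f \<in> hom C x y \<longleftrightarrow> f \<in> Mor C \<and> Dom C f = x \<and> Cod C f = y"
  by (auto simp: hom_def)

context category
begin

lemma Comp_simps [simp]:
  assumes "f \<in> Mor C" "g \<in> Mor C" "Dom C g = Cod C f"
  shows "g \<cdot> f \<in> Mor C" "Dom C (g \<cdot> f) = Dom C f" "Cod C (g \<cdot> f) = Cod C g"
  using Comp_hom[of f "Dom C f" "Cod C f" g "Cod C g"] assms by auto

lemma Ide_simps [simp]:
  assumes "x \<in> Obj C"
  shows "Ide C x \<in> Mor C" "Dom C (Ide C x) = x" "Cod C (Ide C x) = x"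
  using Ide_hom[OF assms] by auto

lemma Dom_Cod_Obj [simp]: "f \<in> Mor C \<Longrightarrow> Dom C f \<in> Obj C" "f \<in> Mor C \<Longrightarrow> Cod C f \<in> Obj C"
  by (rule Dom_Obj Cod_Obj, assumption)+

lemma Comp_Ide [simp]:
  "f \<in> Mor C \<Longrightarrow> Cod C f = y \<Longrightarrow> Ide C y \<cdot> f = f"
  "f \<in> Mor C \<Longrightarrow> Dom C f = x \<Longrightarrow> f \<cdot> Ide C x = f"
  by (auto intro: Comp_Ide_left Comp_Ide_right)

lemma Comp_assoc_simp [simp]:
  "f \<in> Mor C \<Longrightarrow> g \<in> Mor C \<Longrightarrow> h \<in> Mor C \<Longrightarrow> Dom C g = Cod C f \<Longrightarrow> Dom C h = Cod C g
    \<Longrightarrow> (h \<cdot> g) \<cdot> f = h \<cdot> (g \<cdot> f)"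
  using Comp_assoc[of f "Dom C f" "Cod C f" g "Cod C g" h "Cod C h"] by auto

text \<open>
  Composites are normalised to be nested to the right; this lemma lets an equation between
  composites be applied inside such a nest.
\<close>

lemma Comp_extend:
  "g \<cdot> f = k \<Longrightarrow> f \<in> Mor C \<Longrightarrow> g \<in> Mor C \<Longrightarrow> x \<in> Mor C \<Longrightarrow> Dom C g = Cod C f \<Longrightarrow> Dom C f = Cod C x
    \<Longrightarrow> g \<cdot> (f \<cdot> x) = k \<cdot> x"
  using Comp_assoc_simp[of x f g] by auto

lemma is_isoI:
  assumes "f \<in> Mor C" "g \<in> Mor C" "Dom C g = Cod C f" "Cod C g = Dom C f"
    and "g \<cdot> f = Ide C (Dom C f)" "f \<cdot> g = Ide C (Cod C f)"
  shows "is_iso C f"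
  unfolding is_iso_def using assms by auto

lemma is_pushout_typing:
  assumes "is_pushout C f g i j"
  shows "f \<in> Mor C" "g \<in> Mor C" "Dom C f = Dom C g" "i \<in> Mor C" "j \<in> Mor C"
    "Dom C i = Cod C f" "Dom C j = Cod C g" "Cod C i = Cod C j" "i \<cdot> f = j \<cdot> g"
  using assms unfolding is_pushout_def by auto

lemma is_pushout_exists:
  assumes "is_pushout C f g i j" "u \<in> hom C (Cod C f) y" "v \<in> hom C (Cod C g) y" "u \<cdot> f = v \<cdot> g"
  obtains h where "h \<in> hom C (Cod C j) y" "h \<cdot> i = u" "h \<cdot> j = v"
  using assms unfolding is_pushout_def by metis

lemma is_pushout_unique:
  assumes "is_pushout C f g i j" "h \<in> hom C (Cod C j) y" "h' \<in> hom C (Cod C j) y"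
    "h \<cdot> i = h' \<cdot> i" "h \<cdot> j = h' \<cdot> j"
  shows "h = h'"
proof -
  note t = is_pushout_typing[OF assms(1)]
  have "h \<cdot> i \<in> hom C (Cod C f) y" "h \<cdot> j \<in> hom C (Cod C g) y"
    using t assms by auto
  moreover have "h \<cdot> i \<cdot> f = h \<cdot> j \<cdot> g"
    using t assms(2) by auto
  ultimately have "\<exists>!k. k \<in> hom C (Cod C i) y \<and> k \<cdot> i = h \<cdot> i \<and> k \<cdot> j = h \<cdot> j"
    using assms(1) unfolding is_pushout_def by blast
  then show ?thesis
    using assms t by metis
qed

lemma is_pushoutI:
  assumes "f \<in> Mor C" "g \<in> Mor C" "Dom C f = Dom C g" "i \<in> Mor C" "j \<in> Mor C"
    "Dom C i = Cod C f" "Dom C j = Cod C g" "Cod C i = Cod C j" "i \<cdot> f = j \<cdot> g"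
    and ex: "\<And>y u v. u \<in> hom C (Cod C f) y \<Longrightarrow> v \<in> hom C (Cod C g) y \<Longrightarrow> u \<cdot> f = v \<cdot> g
      \<Longrightarrow> \<exists>h. h \<in> hom C (Cod C i) y \<and> h \<cdot> i = u \<and> h \<cdot> j = v"
    and un: "\<And>y h h'. h \<in> hom C (Cod C i) y \<Longrightarrow> h' \<in> hom C (Cod C i) y
      \<Longrightarrow> h \<cdot> i = h' \<cdot> i \<Longrightarrow> h \<cdot> j = h' \<cdot> j \<Longrightarrow> h = h'"
  shows "is_pushout C f g i j"
  unfolding is_pushout_def
proof (intro conjI allI ballI impI)
  fix y u v
  assume "u \<in> hom C (Cod C f) y" "v \<in> hom C (Cod C g) y" "u \<cdot> f = v \<cdot> g"
  from ex[OF this] obtain h where h: "h \<in> hom C (Cod C i) y \<and> h \<cdot> i = u \<and> h \<cdot> j = v"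
    by blast
  show "\<exists>!h. h \<in> hom C (Cod C i) y \<and> h \<cdot> i = u \<and> h \<cdot> j = v"
    by (rule ex1I[of _ h], rule h) (use h un[of _ y h] in auto)
qed (use assms(1-9) in auto)

lemma is_pushout_sym:
  assumes "is_pushout C f g i j"
  shows "is_pushout C g f j i"
proof (rule is_pushoutI)
  note t = is_pushout_typing[OF assms]
  show "j \<cdot> g = i \<cdot> f"
    using t by simp
  show "\<exists>h. h \<in> hom C (Cod C j) y \<and> h \<cdot> j = u \<and> h \<cdot> i = v"
    if "u \<in> hom C (Cod C g) y" "v \<in> hom C (Cod C f) y" "u \<cdot> g = v \<cdot> f" for y u v
    using is_pushout_exists[OF assms that(2,1) that(3)[symmetric]] by blast
  show "h = h'"
    if "h \<in> hom C (Cod C j) y" "h' \<in> hom C (Cod C j) y" "h \<cdot> j = h' \<cdot> j" "h \<cdot> i = h' \<cdot> i" for y h h'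
    using is_pushout_unique[OF assms] that by blast
qed (use is_pushout_typing[OF assms] in simp_all)

lemma initial_map: "is_initial C x \<Longrightarrow> y \<in> Obj C \<Longrightarrow> \<exists>h. h \<in> hom C x y"
  unfolding is_initial_def by blast

lemma initial_unique:
  assumes "is_initial C x" "h \<in> Mor C" "h' \<in> Mor C" "Dom C h = x" "Dom C h' = x" "Cod C h = Cod C h'"
  shows "h = h'"
  using assms unfolding is_initial_def by (metis hom_iff Dom_Cod_Obj(2))

subsection \<open>Left lifting properties\<close>

lemma liftsE:
  assumes "lifts C i p" "u \<in> hom C (Dom C i) (Dom C p)" "v \<in> hom C (Cod C i) (Cod C p)"
    "p \<cdot> u = v \<cdot> i"
  obtains l where "l \<in> hom C (Cod C i) (Dom C p)" "l \<cdot> i = u" "p \<cdot> l = v"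
  using assms unfolding lifts_def by blast

lemma lifts_pushout:
  assumes "is_pushout C f g i j" "lifts C f p" "p \<in> Mor C"
  shows "lifts C j p"
  unfolding lifts_def
proof (intro ballI impI)
  note t = is_pushout_typing[OF assms(1)]
  fix u v
  assume u: "u \<in> hom C (Dom C j) (Dom C p)" and v: "v \<in> hom C (Cod C j) (Cod C p)"
    and e: "p \<cdot> u = v \<cdot> j"
  have "p \<cdot> (u \<cdot> g) = (v \<cdot> i) \<cdot> f"
    using t u v assms(3) Comp_extend[OF e[symmetric], of g] by simp
  then obtain l where l: "l \<in> hom C (Cod C f) (Dom C p)" "l \<cdot> f = u \<cdot> g" "p \<cdot> l = v \<cdot> i"
    using liftsE[OF assms(2), of "u \<cdot> g" "v \<cdot> i"] u v t assms(3) by auto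
  obtain h where h: "h \<in> hom C (Cod C j) (Dom C p)" "h \<cdot> i = l" "h \<cdot> j = u"
    using is_pushout_exists[OF assms(1) l(1) _ l(2)] u t by auto
  have "p \<cdot> h = v"
    by (rule is_pushout_unique[OF assms(1), of _ "Cod C p"]) (use h l v e t assms(3) in auto)
  then show "\<exists>l\<in>hom C (Cod C j) (Dom C p). l \<cdot> j = u \<and> p \<cdot> l = v"
    using h by blast
qed

lemma lifts_Comp:
  assumes f: "f \<in> Mor C" and g: "g \<in> Mor C" and p: "p \<in> Mor C" and fg: "Dom C g = Cod C f"
    and lf: "lifts C f p" and lg: "lifts C g p"
  shows "lifts C (g \<cdot> f) p"
  unfolding lifts_def
proof (intro ballI impI)
  fix u v
  assume u: "u \<in> hom C (Dom C (g \<cdot> f)) (Dom C p)" and v: "v \<in> hom C (Cod C (g \<cdot> f)) (Cod C p)"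
    and e: "p \<cdot> u = v \<cdot> (g \<cdot> f)"
  obtain l where l: "l \<in> hom C (Cod C f) (Dom C p)" "l \<cdot> f = u" "p \<cdot> l = v \<cdot> g"
    using liftsE[OF lf, of u "v \<cdot> g"] assms u v e by auto
  obtain k where k: "k \<in> hom C (Cod C g) (Dom C p)" "k \<cdot> g = l" "p \<cdot> k = v"
    using liftsE[OF lg, of l v] assms l v by auto
  have "k \<cdot> (g \<cdot> f) = u"
    using l k assms Comp_extend[OF k(2), of f] by auto
  then show "\<exists>l\<in>hom C (Cod C (g \<cdot> f)) (Dom C p). l \<cdot> (g \<cdot> f) = u \<and> p \<cdot> l = v"
    using k assms by auto
qed

lemma lifts_retract:
  assumes f: "f \<in> Mor C" and g: "g \<in> Mor C" and p: "p \<in> Mor C"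
    and "is_retract C f g" and lg: "lifts C g p"
  shows "lifts C f p"
  unfolding lifts_def
proof (intro ballI impI)
  obtain s r s' r' where s: "s \<in> hom C (Dom C f) (Dom C g)" and r: "r \<in> hom C (Dom C g) (Dom C f)"
    and s': "s' \<in> hom C (Cod C f) (Cod C g)" and r': "r' \<in> hom C (Cod C g) (Cod C f)"
    and e: "r \<cdot> s = Ide C (Dom C f)" "r' \<cdot> s' = Ide C (Cod C f)" "g \<cdot> s = s' \<cdot> f" "f \<cdot> r = r' \<cdot> g"
    using assms(4) unfolding is_retract_def by blast
  fix u v
  assume u: "u \<in> hom C (Dom C f) (Dom C p)" and v: "v \<in> hom C (Cod C f) (Cod C p)"
    and uv: "p \<cdot> u = v \<cdot> f"
  have "p \<cdot> (u \<cdot> r) = (v \<cdot> r') \<cdot> g"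
    using u v r r' f g p e(4) uv Comp_extend[OF uv, of r] by simp
  then obtain l where l: "l \<in> hom C (Cod C g) (Dom C p)" "l \<cdot> g = u \<cdot> r" "p \<cdot> l = v \<cdot> r'"
    using liftsE[OF lg, of "u \<cdot> r" "v \<cdot> r'"] u v r r' by auto
  have "l \<cdot> s' \<cdot> f = u"
  proof -
    have "l \<cdot> s' \<cdot> f = l \<cdot> (g \<cdot> s)" using e(3) l s s' f g by simp
    also have "\<dots> = u \<cdot> (r \<cdot> s)" using l s g u r Comp_extend[OF l(2), of s] by simp
    finally show ?thesis using e u by simp
  qed
  moreover have "p \<cdot> (l \<cdot> s') = v"
    using Comp_extend[OF l(3), of s'] l s' p v r' e by simp
  ultimately show "\<exists>l\<in>hom C (Cod C f) (Dom C p). l \<cdot> f = u \<and> p \<cdot> l = v"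
    using l s' by (intro bexI[of _ "l \<cdot> s'"]) auto
qed

text \<open>The retract argument: a lift in the square from \<open>i\<close> to the identity exhibits the retraction.\<close>

lemma retract_argument:
  assumes i: "i \<in> Mor C" and p: "p \<in> Mor C" and ip: "Dom C p = Cod C i" and l: "lifts C (p \<cdot> i) p"
  shows "is_retract C (p \<cdot> i) i"
proof -
  obtain h where h: "h \<in> hom C (Cod C p) (Dom C p)" "h \<cdot> (p \<cdot> i) = i" "p \<cdot> h = Ide C (Cod C p)"
    using liftsE[OF l, of i "Ide C (Cod C p)"] i p ip by auto
  show ?thesis
    unfolding is_retract_def
    by (rule bexI[of _ "Ide C (Dom C i)"], rule bexI[of _ "Ide C (Dom C i)"], rule bexI[of _ h],
        rule bexI[of _ p]) (use h i p ip in simp_all)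
qed

lemma retract_closed_lifts:
  assumes "P \<subseteq> Mor C"
  shows "retract_closed C {i \<in> Mor C. \<forall>p \<in> P. lifts C i p}"
  unfolding retract_closed_def using lifts_retract assms by blast

end

context model_category
begin

lemma model_Mor [simp]:
  "f \<in> Weq S \<Longrightarrow> f \<in> Mor C" "f \<in> Cofib S \<Longrightarrow> f \<in> Mor C" "f \<in> Fib S \<Longrightarrow> f \<in> Mor C"
  using Weq_Mor Cofib_Mor Fib_Mor by auto

text \<open>By the retract argument, lifting properties alone determine both classes of cofibrations.\<close>

lemma Cofib_iff_lifts: "i \<in> Cofib S \<longleftrightarrow> i \<in> Mor C \<and> (\<forall>p \<in> Fib S \<inter> Weq S. lifts C i p)"
proof (intro iffI conjI ballI)
  assume a: "i \<in> Mor C \<and> (\<forall>p \<in> Fib S \<inter> Weq S. lifts C i p)"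
  then obtain j p where j: "j \<in> Cofib S" and p: "p \<in> Fib S \<inter> Weq S" and jp: "Cod C j = Dom C p"
    and i: "i = p \<cdot> j"
    using factor_cofib by blast
  have "is_retract C i j"
    unfolding i by (rule retract_argument) (use a j p jp i in auto)
  then show "i \<in> Cofib S"
    using a j retracts(2) unfolding retract_closed_def by blast
qed (use lift_cofib in auto)

lemma trivial_Cofib_iff_lifts: "i \<in> Cofib S \<inter> Weq S \<longleftrightarrow> i \<in> Mor C \<and> (\<forall>p \<in> Fib S. lifts C i p)"
proof (intro iffI conjI ballI)
  assume a: "i \<in> Mor C \<and> (\<forall>p \<in> Fib S. lifts C i p)"
  then obtain j p where j: "j \<in> Cofib S \<inter> Weq S" and p: "p \<in> Fib S" and jp: "Cod C j = Dom C p"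
    and i: "i = p \<cdot> j"
    using factor_fib by blast
  have "is_retract C i j"
    unfolding i by (rule retract_argument) (use a j p jp i in auto)
  then show "i \<in> Cofib S \<inter> Weq S"
    using a j retracts(1,2) unfolding retract_closed_def by blast
qed (use lift_fib in auto)

lemma Ide_lifts: "x \<in> Obj C \<Longrightarrow> p \<in> Mor C \<Longrightarrow> lifts C (Ide C x) p"
  unfolding lifts_def by auto

lemma Ide_Weq: "x \<in> Obj C \<Longrightarrow> Ide C x \<in> Weq S"
  using trivial_Cofib_iff_lifts[of "Ide C x"] Ide_lifts by auto

text \<open>An identity is a retract of the fibration in any of its factorizations.\<close>

lemma Ide_Fib:
  assumes "x \<in> Obj C"
  shows "Ide C x \<in> Fib S"
proof -
  obtain i p where i: "i \<in> Cofib S" "p \<in> Fib S" "Cod C i = Dom C p" "Ide C x = p \<cdot> i"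
    using factor_fib[of "Ide C x"] assms by auto
  then have d: "Dom C i = x" "Cod C p = x"
    using Comp_simps(2,3)[of i p] Ide_simps[OF assms] by (metis model_Mor(2,3))+
  have "is_retract C (Ide C x) p"
    unfolding is_retract_def
    by (rule bexI[of _ i], rule bexI[of _ p], rule bexI[of _ "Ide C x"], rule bexI[of _ "Ide C x"])
      (use i(1-3) i(4)[symmetric] d assms in simp_all)
  then show ?thesis
    using retracts(3) i(2) assms Ide_simps(1) unfolding retract_closed_def by blast
qed

end

subsection \<open>Finite limits and colimits\<close>

text \<open>
  Pushouts and an initial object define the pushout product and its unit, pullbacks give its
  internal hom, and a terminal object serves to recognise cofibrations of arrows.
\<close>

locale finitely_bicomplete_category = category +
  assumes initial_exists: "\<exists>z. is_initial C z"
    and terminal_exists: "\<exists>t \<in> Obj C. \<forall>x \<in> Obj C. \<exists>!h. h \<in> hom C x t"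
    and pushout_exists: "f \<in> Mor C \<Longrightarrow> g \<in> Mor C \<Longrightarrow> Dom C f = Dom C g
      \<Longrightarrow> \<exists>i j. is_pushout C f g i j"
    and pullback_exists: "f \<in> Mor C \<Longrightarrow> g \<in> Mor C \<Longrightarrow> Cod C f = Cod C g
      \<Longrightarrow> \<exists>p \<in> Mor C. \<exists>q \<in> Mor C. Dom C p = Dom C q \<and> Cod C p = Dom C f \<and> Cod C q = Dom C g \<and>
        f \<cdot> p = g \<cdot> q \<and> (\<forall>x. \<forall>u \<in> hom C x (Dom C f). \<forall>v \<in> hom C x (Dom C g). f \<cdot> u = g \<cdot> v \<longrightarrow>
          (\<exists>!h. h \<in> hom C x (Dom C p) \<and> p \<cdot> h = u \<and> q \<cdot> h = v))"

text \<open>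
  An infinite \<open>\<kappa>\<close> lives on an infinite type, which has room for the empty category, the span and the
  cospan, and all three are smaller than \<open>\<kappa>\<close>.
\<close>

lemma finitely_bicomplete_if_bicomplete:
  fixes \<kappa> :: "'s rel" and C :: "('o, 'm, 'x) cat_scheme" (structure)
  assumes \<kappa>: "Cinfinite \<kappa>" and C: "category C" and bi: "bicomplete \<kappa> C"
  shows "finitely_bicomplete_category C"
proof -
  interpret category C by (rule C)
  have inf: "infinite (UNIV :: 's set)"
    using \<kappa> unfolding cinfinite_def by (metis finite_subset subset_UNIV)
  have small: "|A| <o \<kappa>" if "finite A" for A :: "'s set"
    using \<kappa> that by (intro Cfinite_ordLess_Cinfinite) (auto simp: cfinite_def Field_card_of card_of_card_order_on)
  obtain e :: "nat \<Rightarrow> 's" where e: "inj e"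
    using inf infinite_countable_subset by blast
  define E :: "('s, 's) cat" where
    "E = \<lparr>Obj = {}, Mor = {}, Dom = id, Cod = id, Ide = id, Comp = (\<lambda>g f. f)\<rparr>"
  have E: "category E" "is_functor E C Fo Fm" "|Mor E| <o \<kappa>" for Fo Fm
    using small by (auto simp: E_def category_def is_functor_def)
  define a b c s t where "a = e 0" and "b = e 1" and "c = e 2" and "s = e 3" and "t = e 4"
  have d [simp]: "a \<noteq> b" "a \<noteq> c" "a \<noteq> s" "a \<noteq> t" "b \<noteq> c" "b \<noteq> s" "b \<noteq> t" "c \<noteq> s" "c \<noteq> t" "s \<noteq> t"
    "b \<noteq> a" "c \<noteq> a" "s \<noteq> a" "t \<noteq> a" "c \<noteq> b" "s \<noteq> b" "t \<noteq> b" "s \<noteq> c" "t \<noteq> c" "t \<noteq> s"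
    by (simp_all add: a_def b_def c_def s_def t_def inj_eq[OF e])
  \<comment> \<open>The span \<open>b \<leftarrow> a \<rightarrow> c\<close> with non-identity maps \<open>s\<close> and \<open>t\<close>, and its opposite.\<close>
  define P :: "('s, 's) cat" where
    "P = \<lparr>Obj = {a, b, c}, Mor = {a, b, c, s, t},
      Dom = (\<lambda>x. if x = b \<or> x = c then x else a),
      Cod = (\<lambda>x. if x = s then b else if x = t then c else x), Ide = id,
      Comp = (\<lambda>g f. if g \<in> {a, b, c} then f else g)\<rparr>"
  define Q :: "('s, 's) cat" where
    "Q = \<lparr>Obj = {a, b, c}, Mor = {a, b, c, s, t},
      Dom = (\<lambda>x. if x = s then b else if x = t then c else x),
      Cod = (\<lambda>x. if x = b \<or> x = c then x else a), Ide = id,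
      Comp = (\<lambda>g f. if g \<in> {a, b, c} then f else g)\<rparr>"
  have "category P"
    by unfold_locales ((simp add: P_def; fail)
        | (auto simp: P_def split: if_splits; use d in blast)[1])+
  moreover have "|Mor P| <o \<kappa>"
    by (simp add: P_def small)
  ultimately have P: "category P" "|Mor P| <o \<kappa>"
    by auto
  have "category Q"
    by unfold_locales ((simp add: Q_def; fail)
        | (auto simp: Q_def split: if_splits; use d in blast)[1])+
  moreover have "|Mor Q| <o \<kappa>"
    by (simp add: Q_def small)
  ultimately have Q: "category Q" "|Mor Q| <o \<kappa>"
    by auto
  show ?thesis
  proof
    have "\<exists>x p. is_colimit E C Fo Fm x p" for Fo Fm
      using E bi unfolding bicomplete_def by blast
    then obtain z p where "is_colimit E C undefined undefined z p"
      by blast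
    then have "is_initial C z"
      unfolding is_colimit_def is_cocone_def is_initial_def by (auto simp: E_def)
    then show "\<exists>z. is_initial C z" ..
    have "\<exists>x p. is_limit E C Fo Fm x p" for Fo Fm
      using E bi unfolding bicomplete_def by blast
    then obtain z p where "is_limit E C undefined undefined z p"
      by blast
    then show "\<exists>t \<in> Obj C. \<forall>x \<in> Obj C. \<exists>!h. h \<in> hom C x t"
      unfolding is_limit_def is_cone_def by (auto simp: E_def intro!: bexI[of _ z])
  next
    fix f g
    assume f: "f \<in> Mor C" and g: "g \<in> Mor C" and fg: "Dom C f = Dom C g"
    define Fo where "Fo = (\<lambda>x. if x = b then Cod C f else if x = c then Cod C g else Dom C f)"
    define Fm where "Fm = (\<lambda>x. if x = s then f else if x = t then g else Ide C (Fo x))"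
    have "is_functor P C Fo Fm"
      using f g fg by (auto simp: is_functor_def P_def Fm_def Fo_def)
    then obtain x p where xp: "is_colimit P C Fo Fm x p"
      using P bi unfolding bicomplete_def by blast
    have cocone: "is_cocone P C Fo Fm y q \<longleftrightarrow> q b \<in> hom C (Cod C f) y \<and> q c \<in> hom C (Cod C g) y
        \<and> q a = q b \<cdot> f \<and> q b \<cdot> f = q c \<cdot> g" for y q
      using f g fg by (auto simp: is_cocone_def P_def Fo_def Fm_def)
    have p: "p b \<in> hom C (Cod C f) x" "p c \<in> hom C (Cod C g) x" "p a = p b \<cdot> f" "p b \<cdot> f = p c \<cdot> g"
      using xp unfolding is_colimit_def cocone by blast+
    have "is_pushout C f g (p b) (p c)"
      unfolding is_pushout_def
    proof (intro conjI allI ballI impI)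
      fix y u v
      assume u: "u \<in> hom C (Cod C f) y" and v: "v \<in> hom C (Cod C g) y" and e: "u \<cdot> f = v \<cdot> g"
      define q where "q = (\<lambda>j. if j = b then u else if j = c then v else u \<cdot> f)"
      have "is_cocone P C Fo Fm y q"
        unfolding cocone using u v e by (auto simp: q_def)
      then have "\<exists>!h. h \<in> hom C x y \<and> (\<forall>j \<in> Obj P. h \<cdot> p j = q j)"
        using xp unfolding is_colimit_def by blast
      moreover have "h \<in> hom C x y \<and> (\<forall>j \<in> Obj P. h \<cdot> p j = q j) \<longleftrightarrow>
          h \<in> hom C (Cod C (p b)) y \<and> h \<cdot> p b = u \<and> h \<cdot> p c = v" for h
      proof -
        have "h \<cdot> p a = u \<cdot> f" if "h \<in> hom C x y" "h \<cdot> p b = u"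
          using p that f Comp_extend[of h "p b" u f] by simp
        moreover have "q a = u \<cdot> f" "q b = u" "q c = v" "Obj P = {a, b, c}"
          by (simp_all add: q_def P_def)
        ultimately show ?thesis
          using p by force
      qed
      ultimately show "\<exists>!h. h \<in> hom C (Cod C (p b)) y \<and> h \<cdot> p b = u \<and> h \<cdot> p c = v"
        by simp
    qed (use f g fg p in simp_all)
    then show "\<exists>i j. is_pushout C f g i j"
      by blast
  next
    fix f g
    assume f: "f \<in> Mor C" and g: "g \<in> Mor C" and fg: "Cod C f = Cod C g"
    define Fo where "Fo = (\<lambda>x. if x = b then Dom C f else if x = c then Dom C g else Cod C f)"
    define Fm where "Fm = (\<lambda>x. if x = s then f else if x = t then g else Ide C (Fo x))"
    have "is_functor Q C Fo Fm"
      using f g fg by (auto simp: is_functor_def Q_def Fm_def Fo_def)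
    then obtain x p where xp: "is_limit Q C Fo Fm x p"
      using Q bi unfolding bicomplete_def by blast
    have cone: "is_cone Q C Fo Fm y q \<longleftrightarrow> q b \<in> hom C y (Dom C f) \<and> q c \<in> hom C y (Dom C g)
        \<and> q a = f \<cdot> q b \<and> f \<cdot> q b = g \<cdot> q c" for y q
      using f g fg by (auto simp: is_cone_def Q_def Fo_def Fm_def)
    have p: "p b \<in> hom C x (Dom C f)" "p c \<in> hom C x (Dom C g)" "p a = f \<cdot> p b" "f \<cdot> p b = g \<cdot> p c"
      using xp unfolding is_limit_def cone by blast+
    have *: "\<exists>!h. h \<in> hom C y (Dom C (p b)) \<and> p b \<cdot> h = u \<and> p c \<cdot> h = v"
      if u: "u \<in> hom C y (Dom C f)" and v: "v \<in> hom C y (Dom C g)" and e: "f \<cdot> u = g \<cdot> v" for y u v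
    proof -
      define q where "q = (\<lambda>j. if j = b then u else if j = c then v else f \<cdot> u)"
      have "is_cone Q C Fo Fm y q"
        unfolding cone using u v e by (auto simp: q_def)
      then have "\<exists>!h. h \<in> hom C y x \<and> (\<forall>j \<in> Obj Q. p j \<cdot> h = q j)"
        using xp unfolding is_limit_def by blast
      moreover have "h \<in> hom C y x \<and> (\<forall>j \<in> Obj Q. p j \<cdot> h = q j) \<longleftrightarrow>
          h \<in> hom C y (Dom C (p b)) \<and> p b \<cdot> h = u \<and> p c \<cdot> h = v" for h
      proof -
        have "p a \<cdot> h = f \<cdot> u" if "h \<in> hom C y x" "p b \<cdot> h = u"
          unfolding p(3) using p(1) that f by simp
        moreover have "q a = f \<cdot> u" "q b = u" "q c = v" "Obj Q = {a, b, c}"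
          by (simp_all add: q_def Q_def)
        ultimately show ?thesis
          using p by force
      qed
      ultimately show ?thesis
        by simp
    qed
    show "\<exists>p \<in> Mor C. \<exists>q \<in> Mor C. Dom C p = Dom C q \<and> Cod C p = Dom C f \<and> Cod C q = Dom C g \<and>
        f \<cdot> p = g \<cdot> q \<and> (\<forall>x. \<forall>u \<in> hom C x (Dom C f). \<forall>v \<in> hom C x (Dom C g). f \<cdot> u = g \<cdot> v \<longrightarrow>
          (\<exists>!h. h \<in> hom C x (Dom C p) \<and> p \<cdot> h = u \<and> q \<cdot> h = v))"
      by (rule bexI[of _ "p b"], rule bexI[of _ "p c"], intro conjI allI ballI impI)
        (use p * in simp_all)
  qed
qed

section \<open>Tensor products and pushout products\<close>

context symmetric_monoidal_category
begin

lemma Tensor_simps [simp]: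
  "x \<in> Obj C \<Longrightarrow> y \<in> Obj C \<Longrightarrow> x \<otimes> y \<in> Obj C"
  "f \<in> Mor C \<Longrightarrow> g \<in> Mor C \<Longrightarrow> f \<odot> g \<in> Mor C"
  "f \<in> Mor C \<Longrightarrow> g \<in> Mor C \<Longrightarrow> Dom C (f \<odot> g) = Dom C f \<otimes> Dom C g"
  "f \<in> Mor C \<Longrightarrow> g \<in> Mor C \<Longrightarrow> Cod C (f \<odot> g) = Cod C f \<otimes> Cod C g"
  "x \<in> Obj C \<Longrightarrow> y \<in> Obj C \<Longrightarrow> Ide C x \<odot> Ide C y = Ide C (x \<otimes> y)"
  using TensorM_hom[of f "Dom C f" "Cod C f" g "Dom C g" "Cod C g"]
  by (auto simp: TensorO_Obj TensorM_Ide)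

lemma structure_simps [simp]:
  "Unit C \<in> Obj C"
  "x \<in> Obj C \<Longrightarrow> y \<in> Obj C \<Longrightarrow> z \<in> Obj C \<Longrightarrow> Assoc C x y z \<in> Mor C"
  "x \<in> Obj C \<Longrightarrow> y \<in> Obj C \<Longrightarrow> z \<in> Obj C \<Longrightarrow> Dom C (Assoc C x y z) = x \<otimes> y \<otimes> z"
  "x \<in> Obj C \<Longrightarrow> y \<in> Obj C \<Longrightarrow> z \<in> Obj C \<Longrightarrow> Cod C (Assoc C x y z) = x \<otimes> (y \<otimes> z)"
  "x \<in> Obj C \<Longrightarrow> y \<in> Obj C \<Longrightarrow> Braid C x y \<in> Mor C"
  "x \<in> Obj C \<Longrightarrow> y \<in> Obj C \<Longrightarrow> Dom C (Braid C x y) = x \<otimes> y"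
  "x \<in> Obj C \<Longrightarrow> y \<in> Obj C \<Longrightarrow> Cod C (Braid C x y) = y \<otimes> x"
  "x \<in> Obj C \<Longrightarrow> LUnit C x \<in> Mor C"
  "x \<in> Obj C \<Longrightarrow> Dom C (LUnit C x) = Unit C \<otimes> x"
  "x \<in> Obj C \<Longrightarrow> Cod C (LUnit C x) = x"
  "x \<in> Obj C \<Longrightarrow> RUnit C x \<in> Mor C"
  "x \<in> Obj C \<Longrightarrow> Dom C (RUnit C x) = x \<otimes> Unit C"
  "x \<in> Obj C \<Longrightarrow> Cod C (RUnit C x) = x"
  using Assoc_hom Braid_hom LUnit_hom RUnit_hom Unit_Obj by auto

lemma interchange:
  "f \<in> Mor C \<Longrightarrow> f' \<in> Mor C \<Longrightarrow> g \<in> Mor C \<Longrightarrow> g' \<in> Mor C \<Longrightarrow> Dom C f' = Cod C f \<Longrightarrow> Dom C g' = Cod C g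
    \<Longrightarrow> (f' \<odot> g') \<cdot> (f \<odot> g) = (f' \<cdot> f) \<odot> (g' \<cdot> g)"
  using TensorM_Comp[of f "Dom C f" "Cod C f" f' "Cod C f'" g "Dom C g" "Cod C g" g' "Cod C g'"]
  by auto

lemma interchange':
  "f \<in> Mor C \<Longrightarrow> f' \<in> Mor C \<Longrightarrow> g \<in> Mor C \<Longrightarrow> g' \<in> Mor C \<Longrightarrow> Dom C f' = Cod C f \<Longrightarrow> Dom C g' = Cod C g
    \<Longrightarrow> k \<in> Mor C \<Longrightarrow> Cod C k = Dom C f \<otimes> Dom C g
    \<Longrightarrow> (f' \<odot> g') \<cdot> ((f \<odot> g) \<cdot> k) = ((f' \<cdot> f) \<odot> (g' \<cdot> g)) \<cdot> k"
  by (rule Comp_extend[OF interchange]) auto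

lemmas merge = interchange interchange'

lemma Assoc_nat:
  "f \<in> Mor C \<Longrightarrow> g \<in> Mor C \<Longrightarrow> h \<in> Mor C \<Longrightarrow> x = Cod C f \<Longrightarrow> y = Cod C g \<Longrightarrow> z = Cod C h
    \<Longrightarrow> Assoc C x y z \<cdot> ((f \<odot> g) \<odot> h) = (f \<odot> (g \<odot> h)) \<cdot> Assoc C (Dom C f) (Dom C g) (Dom C h)"
  using Assoc_natural[of f "Dom C f" "Cod C f" g "Dom C g" "Cod C g" h "Dom C h" "Cod C h"] by auto

lemma Braid_nat:
  "f \<in> Mor C \<Longrightarrow> g \<in> Mor C \<Longrightarrow> x = Cod C f \<Longrightarrow> y = Cod C g
    \<Longrightarrow> Braid C x y \<cdot> (f \<odot> g) = (g \<odot> f) \<cdot> Braid C (Dom C f) (Dom C g)"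
  using Braid_natural[of f "Dom C f" "Cod C f" g "Dom C g" "Cod C g"] by auto

lemma Braid_nat':
  "f \<in> Mor C \<Longrightarrow> g \<in> Mor C \<Longrightarrow> x = Cod C f \<Longrightarrow> y = Cod C g \<Longrightarrow> k \<in> Mor C \<Longrightarrow> Cod C k = Dom C f \<otimes> Dom C g
    \<Longrightarrow> Braid C x y \<cdot> ((f \<odot> g) \<cdot> k) = (g \<odot> f) \<cdot> (Braid C (Dom C f) (Dom C g) \<cdot> k)"
  using Comp_extend[OF Braid_nat[of f g x y], of k] by simp

lemma Braid_inverse [simp]:
  "x \<in> Obj C \<Longrightarrow> y \<in> Obj C \<Longrightarrow> Braid C y x \<cdot> Braid C x y = Ide C (x \<otimes> y)"
  by (rule Braid_symmetric)

lemma Braid_inverse' [simp]: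
  "x \<in> Obj C \<Longrightarrow> y \<in> Obj C \<Longrightarrow> k \<in> Mor C \<Longrightarrow> Cod C k = x \<otimes> y
    \<Longrightarrow> Braid C y x \<cdot> (Braid C x y \<cdot> k) = k"
  using Comp_extend[OF Braid_symmetric[of x y], of k] by simp

text \<open>
  Merging tensor products by the interchange law hides the patterns \<open>(f \<odot> g) \<odot> h\<close> to which naturality
  of the associator applies.  The next lemmas restate it for the forms that arise.
\<close>

lemma Assoc_nat_Comp:
  assumes "f \<in> Mor C" "g \<in> Mor C" "h \<in> Mor C" "u \<in> Mor C" "x = Cod C f" "y = Cod C g" "z = Cod C h"
    "Cod C u = Dom C f \<otimes> Dom C g"
  shows "Assoc C x y z \<cdot> (((f \<odot> g) \<cdot> u) \<odot> h)
    = (f \<odot> (g \<odot> h)) \<cdot> (Assoc C (Dom C f) (Dom C g) (Dom C h) \<cdot> (u \<odot> Ide C (Dom C h)))"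
proof -
  have "((f \<odot> g) \<cdot> u) \<odot> h = (f \<odot> g \<odot> h) \<cdot> (u \<odot> Ide C (Dom C h))"
    using assms by (simp add: interchange)
  then show ?thesis
    using Comp_extend[OF Assoc_nat[of f g h x y z], of "u \<odot> Ide C (Dom C h)"] assms by simp
qed

lemma Assoc_nat_Ide:
  assumes "h \<in> Mor C" "x \<in> Obj C" "y \<in> Obj C" "z = Cod C h"
  shows "Assoc C x y z \<cdot> (Ide C (x \<otimes> y) \<odot> h)
    = (Ide C x \<odot> (Ide C y \<odot> h)) \<cdot> Assoc C x y (Dom C h)"
  using Assoc_nat[of "Ide C x" "Ide C y" h x y z] assms by simp

lemma Assoc_nat_Ide':
  assumes "h \<in> Mor C" "x \<in> Obj C" "y \<in> Obj C" "z = Cod C h" "k \<in> Mor C"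
    "Cod C k = x \<otimes> y \<otimes> Dom C h"
  shows "Assoc C x y z \<cdot> ((Ide C (x \<otimes> y) \<odot> h) \<cdot> k)
    = (Ide C x \<odot> (Ide C y \<odot> h)) \<cdot> (Assoc C x y (Dom C h) \<cdot> k)"
  using Comp_extend[OF Assoc_nat_Ide[OF assms(1-4)], of k] assms by simp

lemmas Assoc_nats = Assoc_nat Assoc_nat_Comp Assoc_nat_Ide Assoc_nat_Ide'

lemma Assoc_inverse_exists:
  assumes "x \<in> Obj C" "y \<in> Obj C" "z \<in> Obj C"
  shows "\<exists>a. a \<in> hom C (x \<otimes> (y \<otimes> z)) (x \<otimes> y \<otimes> z) \<and> a \<cdot> Assoc C x y z = Ide C (x \<otimes> y \<otimes> z) \<and>
    Assoc C x y z \<cdot> a = Ide C (x \<otimes> (y \<otimes> z))"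
  using Assoc_iso[OF assms] assms unfolding is_iso_def by auto

definition Assoc_inv :: "'o \<Rightarrow> 'o \<Rightarrow> 'o \<Rightarrow> 'm" where
  "Assoc_inv x y z = (SOME a. a \<in> hom C (x \<otimes> (y \<otimes> z)) (x \<otimes> y \<otimes> z) \<and>
     a \<cdot> Assoc C x y z = Ide C (x \<otimes> y \<otimes> z) \<and> Assoc C x y z \<cdot> a = Ide C (x \<otimes> (y \<otimes> z)))"

lemma Assoc_inv_simps [simp]:
  assumes "x \<in> Obj C" "y \<in> Obj C" "z \<in> Obj C"
  shows "Assoc_inv x y z \<in> Mor C" "Dom C (Assoc_inv x y z) = x \<otimes> (y \<otimes> z)"
    "Cod C (Assoc_inv x y z) = x \<otimes> y \<otimes> z" "Assoc_inv x y z \<cdot> Assoc C x y z = Ide C (x \<otimes> y \<otimes> z)"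
    "Assoc C x y z \<cdot> Assoc_inv x y z = Ide C (x \<otimes> (y \<otimes> z))"
  using someI_ex[OF Assoc_inverse_exists[OF assms]] unfolding Assoc_inv_def[symmetric] by auto

lemma Assoc_inv_nat:
  assumes "f \<in> Mor C" "g \<in> Mor C" "h \<in> Mor C" "x = Cod C f" "y = Cod C g" "z = Cod C h"
  shows "Assoc_inv x y z \<cdot> (f \<odot> (g \<odot> h)) = (f \<odot> g \<odot> h) \<cdot> Assoc_inv (Dom C f) (Dom C g) (Dom C h)"
proof -
  let ?b = "Assoc_inv (Dom C f) (Dom C g) (Dom C h)"
  have e: "Assoc C x y z \<cdot> ((f \<odot> g \<odot> h) \<cdot> ?b) = f \<odot> (g \<odot> h)"
    using Comp_extend[OF Assoc_nat[of f g h x y z], of ?b] assms by simp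
  have "Assoc_inv x y z \<cdot> (Assoc C x y z \<cdot> ((f \<odot> g \<odot> h) \<cdot> ?b)) = (f \<odot> g \<odot> h) \<cdot> ?b"
    using Comp_extend[OF Assoc_inv_simps(4)[of x y z], of "(f \<odot> g \<odot> h) \<cdot> ?b"] assms by simp
  then show ?thesis
    unfolding e .
qed

lemma LUnit_nat:
  "f \<in> Mor C \<Longrightarrow> y = Cod C f \<Longrightarrow> LUnit C y \<cdot> (Ide C (Unit C) \<odot> f) = f \<cdot> LUnit C (Dom C f)"
  using LUnit_natural[of f "Dom C f" "Cod C f"] by auto

lemma RUnit_nat:
  "f \<in> Mor C \<Longrightarrow> y = Cod C f \<Longrightarrow> RUnit C y \<cdot> (f \<odot> Ide C (Unit C)) = f \<cdot> RUnit C (Dom C f)"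
  using RUnit_natural[of f "Dom C f" "Cod C f"] by auto

lemma pentagon_nested:
  "w \<in> Obj C \<Longrightarrow> x \<in> Obj C \<Longrightarrow> y \<in> Obj C \<Longrightarrow> z \<in> Obj C
    \<Longrightarrow> (Ide C w \<odot> Assoc C x y z) \<cdot> (Assoc C w (x \<otimes> y) z \<cdot> (Assoc C w x y \<odot> Ide C z))
      = Assoc C w x (y \<otimes> z) \<cdot> Assoc C (w \<otimes> x) y z"
  using pentagon[of w x y z] by simp

lemma hexagon_nested:
  "x \<in> Obj C \<Longrightarrow> y \<in> Obj C \<Longrightarrow> z \<in> Obj C
    \<Longrightarrow> Assoc C y z x \<cdot> (Braid C x (y \<otimes> z) \<cdot> Assoc C x y z)
      = (Ide C y \<odot> Braid C x z) \<cdot> (Assoc C y x z \<cdot> (Braid C x y \<odot> Ide C z))"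
  using hexagon[of x y z] by simp

end

context symmetric_monoidal_closed_category
begin

text \<open>
  Currying turns maps out of \<open>x \<otimes> w\<close> into maps out of \<open>x\<close>, so \<open>- \<otimes> w\<close> preserves every colimit
  that is described by maps out of it.
\<close>

lemma currying:
  assumes "w \<in> Obj C" "y \<in> Obj C"
  obtains h e where "h \<in> Obj C" "e \<in> Mor C" "Dom C e = h \<otimes> w" "Cod C e = y"
    and "\<And>x f. x \<in> Obj C \<Longrightarrow> f \<in> hom C (x \<otimes> w) y
      \<Longrightarrow> \<exists>g. g \<in> hom C x h \<and> e \<cdot> (g \<odot> Ide C w) = f"
    and "\<And>x g g'. g \<in> hom C x h \<Longrightarrow> g' \<in> hom C x h
      \<Longrightarrow> e \<cdot> (g \<odot> Ide C w) = e \<cdot> (g' \<odot> Ide C w) \<Longrightarrow> g = g'"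
proof -
  obtain h e where h: "h \<in> Obj C" and e: "e \<in> hom C (h \<otimes> w) y"
    and u: "\<forall>x \<in> Obj C. \<forall>f \<in> hom C (x \<otimes> w) y. \<exists>!g. g \<in> hom C x h \<and> e \<cdot> (g \<odot> Ide C w) = f"
    using closed[OF assms] by blast
  have "g = g'" if "g \<in> hom C x h" "g' \<in> hom C x h" "e \<cdot> (g \<odot> Ide C w) = e \<cdot> (g' \<odot> Ide C w)" for x g g'
  proof -
    have "x \<in> Obj C" "e \<cdot> (g \<odot> Ide C w) \<in> hom C (x \<otimes> w) y"
      using that(1) e assms by auto
    then have "\<exists>!k. k \<in> hom C x h \<and> e \<cdot> (k \<odot> Ide C w) = e \<cdot> (g \<odot> Ide C w)"
      by (rule u[rule_format])
    then show ?thesis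
      by (rule ex1E) (use that in metis)
  qed
  moreover have "\<exists>g. g \<in> hom C x h \<and> e \<cdot> (g \<odot> Ide C w) = f"
    if "x \<in> Obj C" "f \<in> hom C (x \<otimes> w) y" for x f
    using that u by blast
  ultimately show thesis
    using that h e by auto
qed

lemma pushout_tensor_right:
  assumes po: "is_pushout C f g i j" and w: "w \<in> Obj C"
  shows "is_pushout C (f \<odot> Ide C w) (g \<odot> Ide C w) (i \<odot> Ide C w) (j \<odot> Ide C w)"
proof (rule is_pushoutI)
  note t = is_pushout_typing[OF po]
  show "(i \<odot> Ide C w) \<cdot> (f \<odot> Ide C w) = (j \<odot> Ide C w) \<cdot> (g \<odot> Ide C w)"
    using t w by (simp add: interchange)
  fix y
  {
    fix u v
    assume u: "u \<in> hom C (Cod C (f \<odot> Ide C w)) y" and v: "v \<in> hom C (Cod C (g \<odot> Ide C w)) y"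
      and uv: "u \<cdot> (f \<odot> Ide C w) = v \<cdot> (g \<odot> Ide C w)"
    have "y \<in> Obj C"
      using u by auto
    from currying[OF w this] obtain h e where h: "h \<in> Obj C" "e \<in> Mor C" "Dom C e = h \<otimes> w" "Cod C e = y"
      and ex: "\<And>x f. x \<in> Obj C \<Longrightarrow> f \<in> hom C (x \<otimes> w) y
        \<Longrightarrow> \<exists>g. g \<in> hom C x h \<and> e \<cdot> (g \<odot> Ide C w) = f"
      and un: "\<And>x g g'. g \<in> hom C x h \<Longrightarrow> g' \<in> hom C x h
        \<Longrightarrow> e \<cdot> (g \<odot> Ide C w) = e \<cdot> (g' \<odot> Ide C w) \<Longrightarrow> g = g'"
      by blast
    obtain u' where u': "u' \<in> hom C (Cod C f) h" "e \<cdot> (u' \<odot> Ide C w) = u"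
      using ex[of "Cod C f" u] u t w by auto
    obtain v' where v': "v' \<in> hom C (Cod C g) h" "e \<cdot> (v' \<odot> Ide C w) = v"
      using ex[of "Cod C g" v] v t w by auto
    have "e \<cdot> ((u' \<cdot> f) \<odot> Ide C w) = (e \<cdot> (u' \<odot> Ide C w)) \<cdot> (f \<odot> Ide C w)"
      using u'(1) h t w by (simp add: interchange)
    also have "\<dots> = (e \<cdot> (v' \<odot> Ide C w)) \<cdot> (g \<odot> Ide C w)"
      unfolding u' v' by (rule uv)
    also have "\<dots> = e \<cdot> ((v' \<cdot> g) \<odot> Ide C w)"
      using v'(1) h t w by (simp add: interchange)
    finally have "u' \<cdot> f = v' \<cdot> g"
      by (rule un[of _ "Dom C f", rotated 2]) (use u' v' t in auto)
    then obtain k where k: "k \<in> hom C (Cod C j) h" "k \<cdot> i = u'" "k \<cdot> j = v'"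
      using is_pushout_exists[OF po u'(1) v'(1)] by blast
    have "(e \<cdot> (k \<odot> Ide C w)) \<cdot> (i \<odot> Ide C w) = u" "(e \<cdot> (k \<odot> Ide C w)) \<cdot> (j \<odot> Ide C w) = v"
      using k h t w u' v' by (simp_all add: interchange)
    then show "\<exists>k. k \<in> hom C (Cod C (i \<odot> Ide C w)) y \<and> k \<cdot> (i \<odot> Ide C w) = u \<and> k \<cdot> (j \<odot> Ide C w) = v"
      using k h t w by (intro exI[of _ "e \<cdot> (k \<odot> Ide C w)"]) auto
  }
  fix u v
  assume u: "u \<in> hom C (Cod C (i \<odot> Ide C w)) y" and v: "v \<in> hom C (Cod C (i \<odot> Ide C w)) y"
    and ui: "u \<cdot> (i \<odot> Ide C w) = v \<cdot> (i \<odot> Ide C w)" and uj: "u \<cdot> (j \<odot> Ide C w) = v \<cdot> (j \<odot> Ide C w)"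
  have "y \<in> Obj C"
    using u by auto
  from currying[OF w this] obtain h e where h: "h \<in> Obj C" "e \<in> Mor C" "Dom C e = h \<otimes> w" "Cod C e = y"
    and ex: "\<And>x f. x \<in> Obj C \<Longrightarrow> f \<in> hom C (x \<otimes> w) y
      \<Longrightarrow> \<exists>g. g \<in> hom C x h \<and> e \<cdot> (g \<odot> Ide C w) = f"
    and un: "\<And>x g g'. g \<in> hom C x h \<Longrightarrow> g' \<in> hom C x h
      \<Longrightarrow> e \<cdot> (g \<odot> Ide C w) = e \<cdot> (g' \<odot> Ide C w) \<Longrightarrow> g = g'"
    by blast
  obtain u' where u': "u' \<in> hom C (Cod C i) h" "e \<cdot> (u' \<odot> Ide C w) = u"
    using ex[of "Cod C i" u] u t w by auto
  obtain v' where v': "v' \<in> hom C (Cod C i) h" "e \<cdot> (v' \<odot> Ide C w) = v"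
    using ex[of "Cod C i" v] v t w by auto
  have "u' \<cdot> k = v' \<cdot> k"
    if k: "k \<in> Mor C" "Cod C k = Cod C i" and eq: "u \<cdot> (k \<odot> Ide C w) = v \<cdot> (k \<odot> Ide C w)" for k
  proof -
    have "e \<cdot> ((u' \<cdot> k) \<odot> Ide C w) = u \<cdot> (k \<odot> Ide C w)"
      unfolding u'(2)[symmetric] using u'(1) h k w by (simp add: interchange)
    also have "\<dots> = e \<cdot> ((v' \<cdot> k) \<odot> Ide C w)"
      unfolding eq v'(2)[symmetric] using v'(1) h k w by (simp add: interchange)
    finally show ?thesis
      by (rule un[of _ "Dom C k", rotated 2]) (use u' v' k in auto)
  qed
  from this[OF _ _ ui] this[OF _ _ uj] have "u' = v'"
    using is_pushout_unique[OF po, of u' h v'] u' v' t by auto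
  then show "u = v"
    using u' v' by simp
qed (use is_pushout_typing[OF po] w in simp_all)

text \<open>The braiding carries over the result for \<open>- \<otimes> w\<close>.\<close>

lemma pushout_tensor_left:
  assumes po: "is_pushout C f g i j" and w: "w \<in> Obj C"
  shows "is_pushout C (Ide C w \<odot> f) (Ide C w \<odot> g) (Ide C w \<odot> i) (Ide C w \<odot> j)"
proof (rule is_pushoutI)
  note t = is_pushout_typing[OF po]
  note po' = pushout_tensor_right[OF po w]
  have flip: "(u \<cdot> Braid C (Cod C k) w) \<cdot> (k \<odot> Ide C w) = (u \<cdot> (Ide C w \<odot> k)) \<cdot> Braid C (Dom C k) w"
    if "k \<in> Mor C" "u \<in> Mor C" "Dom C u = w \<otimes> Cod C k" for u k
    using that w by (simp add: Braid_nat)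
  show "(Ide C w \<odot> i) \<cdot> (Ide C w \<odot> f) = (Ide C w \<odot> j) \<cdot> (Ide C w \<odot> g)"
    using t w by (simp add: interchange)
  fix y
  {
    fix u v
    assume u: "u \<in> hom C (Cod C (Ide C w \<odot> f)) y" and v: "v \<in> hom C (Cod C (Ide C w \<odot> g)) y"
      and uv: "u \<cdot> (Ide C w \<odot> f) = v \<cdot> (Ide C w \<odot> g)"
    have uv': "(u \<cdot> Braid C (Cod C f) w) \<cdot> (f \<odot> Ide C w) = (v \<cdot> Braid C (Cod C g) w) \<cdot> (g \<odot> Ide C w)"
      using flip[of f u] flip[of g v] uv u v t w by simp
    obtain h where h: "h \<in> hom C (Cod C j \<otimes> w) y"
      "h \<cdot> (i \<odot> Ide C w) = u \<cdot> Braid C (Cod C f) w" "h \<cdot> (j \<odot> Ide C w) = v \<cdot> Braid C (Cod C g) w"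
      using is_pushout_exists[OF po' _ _ uv', of y] u v t w by auto
    have unflip: "(h \<cdot> Braid C w (Cod C k)) \<cdot> (Ide C w \<odot> k) = x"
      if "k \<in> Mor C" "Cod C k = Cod C j" "x \<in> Mor C" "Dom C x = w \<otimes> Dom C k"
        "h \<cdot> (k \<odot> Ide C w) = x \<cdot> Braid C (Dom C k) w" for k x
      using that h(1) w t Comp_extend[OF that(5), of "Braid C w (Dom C k)"] by (simp add: Braid_nat)
    then show "\<exists>h. h \<in> hom C (Cod C (Ide C w \<odot> i)) y \<and> h \<cdot> (Ide C w \<odot> i) = u \<and> h \<cdot> (Ide C w \<odot> j) = v"
      using h t w u v unflip[of i u] unflip[of j v]
      by (intro exI[of _ "h \<cdot> Braid C w (Cod C j)"]) auto
  }
  fix u v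
  assume u: "u \<in> hom C (Cod C (Ide C w \<odot> i)) y" and v: "v \<in> hom C (Cod C (Ide C w \<odot> i)) y"
    and ui: "u \<cdot> (Ide C w \<odot> i) = v \<cdot> (Ide C w \<odot> i)" and uj: "u \<cdot> (Ide C w \<odot> j) = v \<cdot> (Ide C w \<odot> j)"
  have eq: "u \<cdot> Braid C (Cod C i) w = v \<cdot> Braid C (Cod C i) w"
    by (rule is_pushout_unique[OF po', of _ y])
      (use u v t w ui uj flip[of i u] flip[of i v] flip[of j u] flip[of j v] in auto)
  show "u = v"
    using Comp_extend[OF eq, of "Braid C w (Cod C i)"] u v t w by simp
qed (use is_pushout_typing[OF po] w in simp_all)

lemma initial_tensor:
  assumes z: "is_initial C z" and w: "w \<in> Obj C"
  shows "is_initial C (z \<otimes> w)" "is_initial C (w \<otimes> z)"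
proof -
  have zO: "z \<in> Obj C"
    using z unfolding is_initial_def by auto
  have r: "\<exists>!h. h \<in> hom C (z \<otimes> w) y" if y: "y \<in> Obj C" for y
  proof -
    obtain h e where h: "h \<in> Obj C" "e \<in> Mor C" "Dom C e = h \<otimes> w" "Cod C e = y"
      and ex: "\<And>x f. x \<in> Obj C \<Longrightarrow> f \<in> hom C (x \<otimes> w) y
        \<Longrightarrow> \<exists>g. g \<in> hom C x h \<and> e \<cdot> (g \<odot> Ide C w) = f"
      using currying[OF w y] by metis
    have u: "\<exists>!k. k \<in> hom C z h"
      using z h unfolding is_initial_def by blast
    then obtain k where k: "k \<in> hom C z h"
      by blast
    show ?thesis
    proof (rule ex1I)
      show "e \<cdot> (k \<odot> Ide C w) \<in> hom C (z \<otimes> w) y"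
        using h k w by auto
      show "f = e \<cdot> (k \<odot> Ide C w)" if "f \<in> hom C (z \<otimes> w) y" for f
        using ex[OF zO that] u k by blast
    qed
  qed
  then show "is_initial C (z \<otimes> w)"
    using zO w unfolding is_initial_def by auto
  have "\<exists>!h. h \<in> hom C (w \<otimes> z) y" if y: "y \<in> Obj C" for y
  proof -
    obtain h where h: "h \<in> hom C (z \<otimes> w) y"
      using r[OF y] by blast
    show ?thesis
    proof (rule ex1I)
      show "h \<cdot> Braid C w z \<in> hom C (w \<otimes> z) y"
        using h w zO by auto
      fix f
      assume f: "f \<in> hom C (w \<otimes> z) y"
      then have "f \<cdot> Braid C z w \<in> hom C (z \<otimes> w) y"
        using w zO by auto
      then have e: "f \<cdot> Braid C z w = h"
        using r[OF y] h by blast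
      then show "f = h \<cdot> Braid C w z"
        using Comp_extend[OF e, of "Braid C w z"] f w zO by simp
    qed
  qed
  then show "is_initial C (w \<otimes> z)"
    using zO w unfolding is_initial_def by auto
qed

end

text \<open>
  The vertices of an arrow, seen as a functor on the poset \<open>{False \<le> True}\<close>, and its value on
  \<open>i \<le> j\<close>.
\<close>

definition vertex :: "('o, 'm, 'x) cat_scheme \<Rightarrow> 'm \<Rightarrow> bool \<Rightarrow> 'o" where
  "vertex C f i = (if i then Cod C f else Dom C f)"

definition edge :: "('o, 'm, 'x) cat_scheme \<Rightarrow> 'm \<Rightarrow> bool \<Rightarrow> bool \<Rightarrow> 'm" where
  "edge C f i j = (if i = j then Ide C (vertex C f i) else f)"

text \<open>
  The maps \<open>pair C f g i j : f\<^sub>i \<otimes> g\<^sub>j \<rightarrow> (f \<box> g)\<^bsub>i \<and> j\<^esub>\<close>.  They exhibit \<open>f \<box> g\<close> as the Day convolution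
  of \<open>f\<close> and \<open>g\<close> along \<open>\<and>\<close>; treating the four index pairs uniformly turns every diagram for
  the pushout product into one diagram chase in \<open>C\<close>.
\<close>

definition pair :: "('o, 'm, 'x) smcat_scheme \<Rightarrow> 'm \<Rightarrow> 'm \<Rightarrow> bool \<Rightarrow> bool \<Rightarrow> 'm" where
  "pair C f g i j =
     (if i then (if j then Ide C (Cod C f \<otimes>\<^bsub>C\<^esub> Cod C g) else pp_in1 C f g)
      else if j then pp_in0 C f g else pp_in0 C f g \<cdot>\<^bsub>C\<^esub> (Ide C (Dom C f) \<odot>\<^bsub>C\<^esub> g))"

lemma vertex_simps [simp]: "vertex C f True = Cod C f" "vertex C f False = Dom C f"
  by (simp_all add: vertex_def)

context category
begin

lemma vertex_Obj [simp]: "f \<in> Mor C \<Longrightarrow> vertex C f i \<in> Obj C"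
  by (cases i) auto

lemma edge_typing [simp]:
  assumes "f \<in> Mor C" "i \<longrightarrow> j"
  shows "edge C f i j \<in> Mor C" "Dom C (edge C f i j) = vertex C f i" "Cod C (edge C f i j) = vertex C f j"
  using assms by (auto simp: edge_def vertex_def)

lemma edge_simps [simp]:
  "edge C f i i = Ide C (vertex C f i)"
  "edge C f False True = f"
  by (simp_all add: edge_def)

end

locale finitely_bicomplete_smcc = symmetric_monoidal_closed_category C + finitely_bicomplete_category C
  for C :: "('o, 'm, 'x) smcat_scheme" (structure)
begin

lemma pp_is_pushout:
  assumes "f \<in> Mor C" "g \<in> Mor C"
  shows "is_pushout C (Ide C (Dom C f) \<odot> g) (f \<odot> Ide C (Dom C g)) (pp_in0 C f g) (pp_in1 C f g)"
proof -
  have "\<exists>i j. is_pushout C (Ide C (Dom C f) \<odot> g) (f \<odot> Ide C (Dom C g)) i j"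
    by (rule pushout_exists) (use assms in auto)
  then have "\<exists>x. case x of (i, j) \<Rightarrow> is_pushout C (Ide C (Dom C f) \<odot> g) (f \<odot> Ide C (Dom C g)) i j"
    by auto
  from someI_ex[OF this] show ?thesis
    unfolding pp_in0_def pp_in1_def pp_pushout_def pushout_def by (auto split: prod.splits)
qed

lemma pp_typing [simp]:
  assumes "f \<in> Mor C" "g \<in> Mor C"
  shows "pp_in0 C f g \<in> Mor C" "Dom C (pp_in0 C f g) = Dom C f \<otimes> Cod C g"
    "Cod C (pp_in0 C f g) = pp_dom C f g"
    "pp_in1 C f g \<in> Mor C" "Dom C (pp_in1 C f g) = Cod C f \<otimes> Dom C g"
    "Cod C (pp_in1 C f g) = pp_dom C f g"
    "pp_dom C f g \<in> Obj C"
  using is_pushout_typing[OF pp_is_pushout[OF assms]] assms by (auto simp: pp_dom_def)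

lemma pp_square:
  "f \<in> Mor C \<Longrightarrow> g \<in> Mor C
    \<Longrightarrow> pp_in1 C f g \<cdot> (f \<odot> Ide C (Dom C g)) = pp_in0 C f g \<cdot> (Ide C (Dom C f) \<odot> g)"
  using is_pushout_typing(9)[OF pp_is_pushout] by simp

lemma pp_exists:
  assumes "f \<in> Mor C" "g \<in> Mor C" "u \<in> hom C (Dom C f \<otimes> Cod C g) y" "v \<in> hom C (Cod C f \<otimes> Dom C g) y"
    and "u \<cdot> (Ide C (Dom C f) \<odot> g) = v \<cdot> (f \<odot> Ide C (Dom C g))"
  shows "\<exists>!h. h \<in> hom C (pp_dom C f g) y \<and> h \<cdot> pp_in0 C f g = u \<and> h \<cdot> pp_in1 C f g = v"
proof -
  note p = pp_is_pushout[OF assms(1,2)]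
  have "\<exists>h. h \<in> hom C (pp_dom C f g) y \<and> h \<cdot> pp_in0 C f g = u \<and> h \<cdot> pp_in1 C f g = v"
    by (rule is_pushout_exists[OF p, of u y v]) (use assms in auto)
  moreover have "h = h'" if "h \<in> hom C (pp_dom C f g) y" "h' \<in> hom C (pp_dom C f g) y"
    "h \<cdot> pp_in0 C f g = h' \<cdot> pp_in0 C f g" "h \<cdot> pp_in1 C f g = h' \<cdot> pp_in1 C f g" for h h'
    by (rule is_pushout_unique[OF p, of _ y]) (use that assms in auto)
  ultimately show ?thesis
    by metis
qed

lemma pushout_product_char:
  assumes "f \<in> Mor C" "g \<in> Mor C"
  shows "f \<box> g \<in> hom C (pp_dom C f g) (Cod C f \<otimes> Cod C g) \<and>
    f \<box> g \<cdot> pp_in0 C f g = f \<odot> Ide C (Cod C g) \<and> f \<box> g \<cdot> pp_in1 C f g = Ide C (Cod C f) \<odot> g"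
  unfolding pushout_product_def
  by (rule theI', rule pp_exists) (use assms in \<open>auto simp: interchange\<close>)

lemma pushout_product_simps [simp]:
  assumes "f \<in> Mor C" "g \<in> Mor C"
  shows "f \<box> g \<in> Mor C" "Dom C (f \<box> g) = pp_dom C f g" "Cod C (f \<box> g) = Cod C f \<otimes> Cod C g"
    "f \<box> g \<cdot> pp_in0 C f g = f \<odot> Ide C (Cod C g)" "f \<box> g \<cdot> pp_in1 C f g = Ide C (Cod C f) \<odot> g"
  using pushout_product_char[OF assms] by auto

lemma pair_typing [simp]:
  assumes "f \<in> Mor C" "g \<in> Mor C"
  shows "pair C f g i j \<in> Mor C" "Dom C (pair C f g i j) = vertex C f i \<otimes> vertex C g j"
    "Cod C (pair C f g i j) = vertex C (f \<box> g) (i \<and> j)"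
  using assms by (auto simp: pair_def)

lemma pair_True [simp]: "pair C f g True True = Ide C (Cod C f \<otimes> Cod C g)"
  by (simp add: pair_def)

lemma pair_edge:
  assumes "f \<in> Mor C" "g \<in> Mor C" "i \<longrightarrow> i'" "j \<longrightarrow> j'"
  shows "edge C (f \<box> g) (i \<and> j) (i' \<and> j') \<cdot> pair C f g i j
    = pair C f g i' j' \<cdot> (edge C f i i' \<odot> edge C g j j')"
  using assms Comp_extend[OF pushout_product_simps(4)[OF assms(1,2)], of "Ide C (Dom C f) \<odot> g"]
  by (cases i; cases i'; cases j; cases j') (auto simp: pair_def merge pp_square)

text \<open>
  The maps \<open>pair C f g i j\<close> with \<open>i \<and> j = m\<close> include an identity or both coprojections of the
  pushout, so they are jointly epic, and remain so after tensoring, which preserves the pushout.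
\<close>

lemma pair_ext:
  assumes "f \<in> Mor C" "g \<in> Mor C" "h \<in> hom C (vertex C (f \<box> g) m) y" "h' \<in> hom C (vertex C (f \<box> g) m) y"
    and "\<And>i j. (i \<and> j) = m \<Longrightarrow> h \<cdot> pair C f g i j = h' \<cdot> pair C f g i j"
  shows "h = h'"
proof (cases m)
  case True
  then show ?thesis
    using assms(1-4) assms(5)[of True True] by simp
next
  case False
  show ?thesis
    by (rule is_pushout_unique[OF pp_is_pushout[OF assms(1,2)], of _ y])
      (use False assms(1-4) assms(5)[of False True] assms(5)[of True False] in \<open>auto simp: pair_def\<close>)
qed

lemma pair_tensor_right_ext:
  assumes "f \<in> Mor C" "g \<in> Mor C" "w \<in> Obj C" "h \<in> hom C (vertex C (f \<box> g) m \<otimes> w) y"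
    "h' \<in> hom C (vertex C (f \<box> g) m \<otimes> w) y"
    and "\<And>i j. (i \<and> j) = m \<Longrightarrow> h \<cdot> (pair C f g i j \<odot> Ide C w) = h' \<cdot> (pair C f g i j \<odot> Ide C w)"
  shows "h = h'"
proof (cases m)
  case True
  then show ?thesis
    using assms(1-5) assms(6)[of True True] by simp
next
  case False
  show ?thesis
    by (rule is_pushout_unique[OF pushout_tensor_right[OF pp_is_pushout[OF assms(1,2)] assms(3)], of _ y])
      (use False assms(1-5) assms(6)[of False True] assms(6)[of True False] in \<open>auto simp: pair_def\<close>)
qed

lemma pair_tensor_left_ext:
  assumes "f \<in> Mor C" "g \<in> Mor C" "w \<in> Obj C" "h \<in> hom C (w \<otimes> vertex C (f \<box> g) m) y"
    "h' \<in> hom C (w \<otimes> vertex C (f \<box> g) m) y"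
    and "\<And>i j. (i \<and> j) = m \<Longrightarrow> h \<cdot> (Ide C w \<odot> pair C f g i j) = h' \<cdot> (Ide C w \<odot> pair C f g i j)"
  shows "h = h'"
proof (cases m)
  case True
  then show ?thesis
    using assms(1-5) assms(6)[of True True] by simp
next
  case False
  show ?thesis
    by (rule is_pushout_unique[OF pushout_tensor_left[OF pp_is_pushout[OF assms(1,2)] assms(3)], of _ y])
      (use False assms(1-5) assms(6)[of False True] assms(6)[of True False] in \<open>auto simp: pair_def\<close>)
qed

text \<open>
  Conversely, a compatible family of maps on these pieces extends to the vertex \<open>m\<close>; for \<open>m = True\<close>
  there is a single piece, and for \<open>m = False\<close> this is the universal property of the pushout.  The
  tensored version follows by currying the family.
\<close>

lemma pair_exists:
  assumes "f \<in> Mor C" "g \<in> Mor C" "y \<in> Obj C"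
    and \<phi>: "\<And>i j. (i \<and> j) = m \<Longrightarrow> \<phi> i j \<in> hom C (vertex C f i \<otimes> vertex C g j) y"
    and comp: "\<And>i j i' j'. (i \<and> j) = m \<Longrightarrow> (i' \<and> j') = m \<Longrightarrow> i \<longrightarrow> i' \<Longrightarrow> j \<longrightarrow> j'
      \<Longrightarrow> \<phi> i j = \<phi> i' j' \<cdot> (edge C f i i' \<odot> edge C g j j')"
  shows "\<exists>h. h \<in> hom C (vertex C (f \<box> g) m) y \<and> (\<forall>i j. (i \<and> j) = m \<longrightarrow> h \<cdot> pair C f g i j = \<phi> i j)"
proof (cases m)
  case True
  then show ?thesis
    using assms(1-3) \<phi>[of True True] by (intro exI[of _ "\<phi> True True"]) auto
next
  case False
  have a: "\<phi> False False = \<phi> False True \<cdot> (Ide C (Dom C f) \<odot> g)"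
    "\<phi> False False = \<phi> True False \<cdot> (f \<odot> Ide C (Dom C g))"
    using comp[of False False False True] comp[of False False True False] False assms(1,2) by auto
  have "\<phi> False True \<in> hom C (Dom C f \<otimes> Cod C g) y" "\<phi> True False \<in> hom C (Cod C f \<otimes> Dom C g) y"
    using \<phi>[of False True] \<phi>[of True False] False by simp_all
  moreover have "\<phi> False True \<cdot> (Ide C (Dom C f) \<odot> g) = \<phi> True False \<cdot> (f \<odot> Ide C (Dom C g))"
    using a by simp
  ultimately obtain h where h: "h \<in> hom C (pp_dom C f g) y" "h \<cdot> pp_in0 C f g = \<phi> False True"
    "h \<cdot> pp_in1 C f g = \<phi> True False"
    using ex1_implies_ex[OF pp_exists[OF assms(1,2)]] by blast
  have "h \<cdot> pair C f g False False = \<phi> False False"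
    using h(1) a(1) assms(1,2) Comp_extend[OF h(2), of "Ide C (Dom C f) \<odot> g"] by (simp add: pair_def)
  moreover have "h \<cdot> pair C f g False True = \<phi> False True" "h \<cdot> pair C f g True False = \<phi> True False"
    using h by (simp_all add: pair_def)
  ultimately have "h \<cdot> pair C f g i j = \<phi> i j" if "(i \<and> j) = m" for i j
    using that False by (cases i; cases j) simp_all
  then show ?thesis
    using h(1) False assms(1,2) by (intro exI[of _ h]) simp
qed

lemma pair_tensor_exists:
  assumes "f \<in> Mor C" "g \<in> Mor C" "w \<in> Obj C" "y \<in> Obj C"
    and \<phi>: "\<And>i j. (i \<and> j) = m \<Longrightarrow> \<phi> i j \<in> hom C (vertex C f i \<otimes> vertex C g j \<otimes> w) y"
    and comp: "\<And>i j i' j'. (i \<and> j) = m \<Longrightarrow> (i' \<and> j') = m \<Longrightarrow> i \<longrightarrow> i' \<Longrightarrow> j \<longrightarrow> j'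
      \<Longrightarrow> \<phi> i j = \<phi> i' j' \<cdot> (edge C f i i' \<odot> edge C g j j' \<odot> Ide C w)"
  shows "\<exists>h. h \<in> hom C (vertex C (f \<box> g) m \<otimes> w) y \<and>
    (\<forall>i j. (i \<and> j) = m \<longrightarrow> h \<cdot> (pair C f g i j \<odot> Ide C w) = \<phi> i j)"
proof -
  obtain k e where k: "k \<in> Obj C" "e \<in> Mor C" "Dom C e = k \<otimes> w" "Cod C e = y"
    and ex: "\<And>x f. x \<in> Obj C \<Longrightarrow> f \<in> hom C (x \<otimes> w) y
      \<Longrightarrow> \<exists>g. g \<in> hom C x k \<and> e \<cdot> (g \<odot> Ide C w) = f"
    and un: "\<And>x g g'. g \<in> hom C x k \<Longrightarrow> g' \<in> hom C x k
      \<Longrightarrow> e \<cdot> (g \<odot> Ide C w) = e \<cdot> (g' \<odot> Ide C w) \<Longrightarrow> g = g'"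
    using currying[OF assms(3,4)] by blast
  have "\<exists>\<psi>. (i \<and> j) = m \<longrightarrow> \<psi> \<in> hom C (vertex C f i \<otimes> vertex C g j) k \<and> e \<cdot> (\<psi> \<odot> Ide C w) = \<phi> i j" for i j
    using ex[of "vertex C f i \<otimes> vertex C g j" "\<phi> i j"] \<phi>[of i j] assms(1,2) by auto
  then obtain \<psi> where \<psi>: "\<And>i j. (i \<and> j) = m \<Longrightarrow> \<psi> i j \<in> hom C (vertex C f i \<otimes> vertex C g j) k"
    and e\<psi>: "\<And>i j. (i \<and> j) = m \<Longrightarrow> e \<cdot> (\<psi> i j \<odot> Ide C w) = \<phi> i j"
    by metis
  have "\<psi> i j = \<psi> i' j' \<cdot> (edge C f i i' \<odot> edge C g j j')"
    if i: "(i \<and> j) = m" "(i' \<and> j') = m" "i \<longrightarrow> i'" "j \<longrightarrow> j'" for i j i' j'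
  proof (rule un)
    note \<psi>' = \<psi>[OF i(1)] \<psi>[OF i(2)]
    show "\<psi> i j \<in> hom C (vertex C f i \<otimes> vertex C g j) k"
      by (rule \<psi>'(1))
    show "\<psi> i' j' \<cdot> (edge C f i i' \<odot> edge C g j j') \<in> hom C (vertex C f i \<otimes> vertex C g j) k"
      using \<psi>'(2) i(3,4) assms(1,2) by simp
    have "e \<cdot> ((\<psi> i' j' \<cdot> (edge C f i i' \<odot> edge C g j j')) \<odot> Ide C w)
      = (e \<cdot> (\<psi> i' j' \<odot> Ide C w)) \<cdot> (edge C f i i' \<odot> edge C g j j' \<odot> Ide C w)"
      using \<psi>'(2) i(3,4) assms(1-3) k by (simp add: merge)
    then show "e \<cdot> (\<psi> i j \<odot> Ide C w) = e \<cdot> ((\<psi> i' j' \<cdot> (edge C f i i' \<odot> edge C g j j')) \<odot> Ide C w)"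
      unfolding e\<psi>[OF i(1)] e\<psi>[OF i(2)] comp[OF i] by simp
  qed
  then obtain h where h: "h \<in> hom C (vertex C (f \<box> g) m) k"
    "\<And>i j. (i \<and> j) = m \<Longrightarrow> h \<cdot> pair C f g i j = \<psi> i j"
    using pair_exists[OF assms(1,2) k(1), of m \<psi>] \<psi> by blast
  have "(e \<cdot> (h \<odot> Ide C w)) \<cdot> (pair C f g i j \<odot> Ide C w) = \<phi> i j" if "(i \<and> j) = m" for i j
    using h(1) h(2)[OF that] e\<psi>[OF that] k assms(1-3) that by (simp add: merge)
  then show ?thesis
    using h k assms(1-3) by (intro exI[of _ "e \<cdot> (h \<odot> Ide C w)"]) auto
qed

text \<open>
  The object \<open>k\<close> of natural transformations from \<open>g\<close> to \<open>z\<close>: the pullback of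
  \<open>Hom(g\<^sub>0, z\<^sub>0) \<rightarrow> Hom(g\<^sub>0, z\<^sub>1) \<leftarrow> Hom(g\<^sub>1, z\<^sub>1)\<close>.  It is the codomain of the internal hom of arrows.
\<close>

lemma currying_arrow:
  assumes g: "g \<in> Mor C" and z: "z \<in> Mor C"
  obtains k e0 e1 where "k \<in> Obj C" "e0 \<in> hom C (k \<otimes> Dom C g) (Dom C z)" "e1 \<in> hom C (k \<otimes> Cod C g) (Cod C z)"
    "z \<cdot> e0 = e1 \<cdot> (Ide C k \<odot> g)"
    and "\<And>x u v. x \<in> Obj C \<Longrightarrow> u \<in> hom C (x \<otimes> Dom C g) (Dom C z) \<Longrightarrow> v \<in> hom C (x \<otimes> Cod C g) (Cod C z)
      \<Longrightarrow> z \<cdot> u = v \<cdot> (Ide C x \<odot> g)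
      \<Longrightarrow> \<exists>s. s \<in> hom C x k \<and> e0 \<cdot> (s \<odot> Ide C (Dom C g)) = u \<and> e1 \<cdot> (s \<odot> Ide C (Cod C g)) = v"
    and "\<And>x s s'. s \<in> hom C x k \<Longrightarrow> s' \<in> hom C x k
      \<Longrightarrow> e0 \<cdot> (s \<odot> Ide C (Dom C g)) = e0 \<cdot> (s' \<odot> Ide C (Dom C g))
      \<Longrightarrow> e1 \<cdot> (s \<odot> Ide C (Cod C g)) = e1 \<cdot> (s' \<odot> Ide C (Cod C g)) \<Longrightarrow> s = s'"
proof -
  have O: "Dom C g \<in> Obj C" "Cod C g \<in> Obj C" "Dom C z \<in> Obj C" "Cod C z \<in> Obj C"
    using g z by auto
  obtain ha ea where ha: "ha \<in> Obj C" "ea \<in> Mor C" "Dom C ea = ha \<otimes> Dom C g" "Cod C ea = Dom C z"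
    and exa: "\<And>x f. x \<in> Obj C \<Longrightarrow> f \<in> hom C (x \<otimes> Dom C g) (Dom C z)
      \<Longrightarrow> \<exists>s. s \<in> hom C x ha \<and> ea \<cdot> (s \<odot> Ide C (Dom C g)) = f"
    and una: "\<And>x s s'. s \<in> hom C x ha \<Longrightarrow> s' \<in> hom C x ha
      \<Longrightarrow> ea \<cdot> (s \<odot> Ide C (Dom C g)) = ea \<cdot> (s' \<odot> Ide C (Dom C g)) \<Longrightarrow> s = s'"
    using currying[OF O(1,3)] by blast
  obtain hb eb where hb: "hb \<in> Obj C" "eb \<in> Mor C" "Dom C eb = hb \<otimes> Dom C g" "Cod C eb = Cod C z"
    and exb: "\<And>x f. x \<in> Obj C \<Longrightarrow> f \<in> hom C (x \<otimes> Dom C g) (Cod C z)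
      \<Longrightarrow> \<exists>s. s \<in> hom C x hb \<and> eb \<cdot> (s \<odot> Ide C (Dom C g)) = f"
    and unb: "\<And>x s s'. s \<in> hom C x hb \<Longrightarrow> s' \<in> hom C x hb
      \<Longrightarrow> eb \<cdot> (s \<odot> Ide C (Dom C g)) = eb \<cdot> (s' \<odot> Ide C (Dom C g)) \<Longrightarrow> s = s'"
    using currying[OF O(1,4)] by blast
  obtain hc ec where hc: "hc \<in> Obj C" "ec \<in> Mor C" "Dom C ec = hc \<otimes> Cod C g" "Cod C ec = Cod C z"
    and exc: "\<And>x f. x \<in> Obj C \<Longrightarrow> f \<in> hom C (x \<otimes> Cod C g) (Cod C z)
      \<Longrightarrow> \<exists>s. s \<in> hom C x hc \<and> ec \<cdot> (s \<odot> Ide C (Cod C g)) = f"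
    and unc: "\<And>x s s'. s \<in> hom C x hc \<Longrightarrow> s' \<in> hom C x hc
      \<Longrightarrow> ec \<cdot> (s \<odot> Ide C (Cod C g)) = ec \<cdot> (s' \<odot> Ide C (Cod C g)) \<Longrightarrow> s = s'"
    using currying[OF O(2,4)] by blast
  obtain p where p: "p \<in> hom C ha hb" "eb \<cdot> (p \<odot> Ide C (Dom C g)) = z \<cdot> ea"
    using exb[of ha "z \<cdot> ea"] ha z by auto
  obtain q where q: "q \<in> hom C hc hb" "eb \<cdot> (q \<odot> Ide C (Dom C g)) = ec \<cdot> (Ide C hc \<odot> g)"
    using exb[of hc "ec \<cdot> (Ide C hc \<odot> g)"] hc g by auto
  have "\<exists>a \<in> Mor C. \<exists>b \<in> Mor C. Dom C a = Dom C b \<and> Cod C a = Dom C p \<and> Cod C b = Dom C q \<and>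
        p \<cdot> a = q \<cdot> b \<and> (\<forall>x. \<forall>u \<in> hom C x (Dom C p). \<forall>v \<in> hom C x (Dom C q). p \<cdot> u = q \<cdot> v \<longrightarrow>
          (\<exists>!h. h \<in> hom C x (Dom C a) \<and> a \<cdot> h = u \<and> b \<cdot> h = v))"
    by (rule pullback_exists) (use p q in auto)
  then obtain a b where ab: "a \<in> Mor C" "b \<in> Mor C" "Dom C a = Dom C b" "Cod C a = Dom C p" "Cod C b = Dom C q"
      "p \<cdot> a = q \<cdot> b"
    and pb: "\<forall>x. \<forall>u \<in> hom C x (Dom C p). \<forall>v \<in> hom C x (Dom C q). p \<cdot> u = q \<cdot> v \<longrightarrow>
          (\<exists>!h. h \<in> hom C x (Dom C a) \<and> a \<cdot> h = u \<and> b \<cdot> h = v)"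
    by blast
  have pz: "eb \<cdot> ((p \<cdot> s) \<odot> Ide C (Dom C g)) = z \<cdot> (ea \<cdot> (s \<odot> Ide C (Dom C g)))"
    if "s \<in> Mor C" "Cod C s = ha" for s
    using Comp_extend[OF p(2), of "s \<odot> Ide C (Dom C g)"] that p(1) hb ha z g by (simp add: merge)
  have qg: "eb \<cdot> ((q \<cdot> s) \<odot> Ide C (Dom C g)) = (ec \<cdot> (s \<odot> Ide C (Cod C g))) \<cdot> (Ide C (Dom C s) \<odot> g)"
    if "s \<in> Mor C" "Cod C s = hc" for s
    using Comp_extend[OF q(2), of "s \<odot> Ide C (Dom C g)"] that q(1) hb hc g by (simp add: merge)
  let ?k = "Dom C a" and ?e0 = "ea \<cdot> (a \<odot> Ide C (Dom C g))" and ?e1 = "ec \<cdot> (b \<odot> Ide C (Cod C g))"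
  show thesis
  proof (rule that[of ?k ?e0 ?e1])
    show "?k \<in> Obj C" "?e0 \<in> hom C (?k \<otimes> Dom C g) (Dom C z)" "?e1 \<in> hom C (?k \<otimes> Cod C g) (Cod C z)"
      using ab ha hc p q g by simp_all
    show "z \<cdot> ?e0 = ?e1 \<cdot> (Ide C ?k \<odot> g)"
      using pz[of a] qg[of b] ab p q by simp
  next
    fix x u v
    assume x: "x \<in> Obj C" and u: "u \<in> hom C (x \<otimes> Dom C g) (Dom C z)" and v: "v \<in> hom C (x \<otimes> Cod C g) (Cod C z)"
      and uv: "z \<cdot> u = v \<cdot> (Ide C x \<odot> g)"
    obtain u' where u': "u' \<in> hom C x ha" "ea \<cdot> (u' \<odot> Ide C (Dom C g)) = u"
      using exa[OF x u] by blast
    obtain v' where v': "v' \<in> hom C x hc" "ec \<cdot> (v' \<odot> Ide C (Cod C g)) = v"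
      using exc[OF x v] by blast
    have "p \<cdot> u' = q \<cdot> v'"
      by (rule unb[of _ x]) (use pz[of u'] qg[of v'] u' v' uv p q in simp_all)
    moreover have "u' \<in> hom C x (Dom C p)" "v' \<in> hom C x (Dom C q)"
      using u' v' p q by simp_all
    ultimately obtain s where s: "s \<in> hom C x ?k" "a \<cdot> s = u'" "b \<cdot> s = v'"
      using pb by blast
    have "?e0 \<cdot> (s \<odot> Ide C (Dom C g)) = u" "?e1 \<cdot> (s \<odot> Ide C (Cod C g)) = v"
      using s u' v' ab p q ha hc g by (simp_all add: merge)
    then show "\<exists>s. s \<in> hom C x ?k \<and> ?e0 \<cdot> (s \<odot> Ide C (Dom C g)) = u \<and> ?e1 \<cdot> (s \<odot> Ide C (Cod C g)) = v"
      using s(1) by blast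
  next
    fix x s s'
    assume s: "s \<in> hom C x ?k" "s' \<in> hom C x ?k"
      and e0: "?e0 \<cdot> (s \<odot> Ide C (Dom C g)) = ?e0 \<cdot> (s' \<odot> Ide C (Dom C g))"
      and e1: "?e1 \<cdot> (s \<odot> Ide C (Cod C g)) = ?e1 \<cdot> (s' \<odot> Ide C (Cod C g))"
    have a: "a \<cdot> s = a \<cdot> s'"
      by (rule una[of _ x]) (use e0 s ab p ha g in \<open>simp_all add: merge\<close>)
    have b: "b \<cdot> s = b \<cdot> s'"
      by (rule unc[of _ x]) (use e1 s ab q hc g in \<open>simp_all add: merge\<close>)
    have "p \<cdot> (a \<cdot> s) = q \<cdot> (b \<cdot> s)"
      using Comp_extend[OF ab(6), of s] s ab p q by simp
    moreover have "a \<cdot> s \<in> hom C x (Dom C p)" "b \<cdot> s \<in> hom C x (Dom C q)"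
      using s ab by simp_all
    ultimately have "\<exists>!h. h \<in> hom C x ?k \<and> a \<cdot> h = a \<cdot> s \<and> b \<cdot> h = b \<cdot> s"
      using pb by blast
    then show "s = s'"
      by (rule ex1E) (use s a b in metis)
  qed
qed

end

subsection \<open>Lifting a pushout product\<close>

text \<open>
  By the universal property of the pushout, a lifting problem for \<open>f \<box> g\<close> amounts to maps on
  \<open>f\<^sub>0 \<otimes> g\<^sub>1\<close>, \<open>f\<^sub>1 \<otimes> g\<^sub>0\<close> and \<open>f\<^sub>1 \<otimes> g\<^sub>1\<close>, without mention of the chosen pushout.
\<close>

definition pp_lifts :: "('o, 'm, 'x) smcat_scheme \<Rightarrow> 'm \<Rightarrow> 'm \<Rightarrow> 'm \<Rightarrow> bool" where
  "pp_lifts C f g p \<longleftrightarrow>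
     (\<forall>u \<in> hom C (Dom C f \<otimes>\<^bsub>C\<^esub> Cod C g) (Dom C p). \<forall>v \<in> hom C (Cod C f \<otimes>\<^bsub>C\<^esub> Dom C g) (Dom C p).
      \<forall>w \<in> hom C (Cod C f \<otimes>\<^bsub>C\<^esub> Cod C g) (Cod C p).
        u \<cdot>\<^bsub>C\<^esub> (Ide C (Dom C f) \<odot>\<^bsub>C\<^esub> g) = v \<cdot>\<^bsub>C\<^esub> (f \<odot>\<^bsub>C\<^esub> Ide C (Dom C g)) \<longrightarrow>
        p \<cdot>\<^bsub>C\<^esub> u = w \<cdot>\<^bsub>C\<^esub> (f \<odot>\<^bsub>C\<^esub> Ide C (Cod C g)) \<longrightarrow>
        p \<cdot>\<^bsub>C\<^esub> v = w \<cdot>\<^bsub>C\<^esub> (Ide C (Cod C f) \<odot>\<^bsub>C\<^esub> g) \<longrightarrow>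
        (\<exists>l \<in> hom C (Cod C f \<otimes>\<^bsub>C\<^esub> Cod C g) (Dom C p). l \<cdot>\<^bsub>C\<^esub> (f \<odot>\<^bsub>C\<^esub> Ide C (Cod C g)) = u \<and>
           l \<cdot>\<^bsub>C\<^esub> (Ide C (Cod C f) \<odot>\<^bsub>C\<^esub> g) = v \<and> p \<cdot>\<^bsub>C\<^esub> l = w))"

lemma (in finitely_bicomplete_smcc) lifts_pushout_product_iff:
  assumes f: "f \<in> Mor C" and g: "g \<in> Mor C" and p: "p \<in> Mor C"
  shows "lifts C (f \<box> g) p \<longleftrightarrow> pp_lifts C f g p"
proof
  assume l: "lifts C (f \<box> g) p"
  show "pp_lifts C f g p"
    unfolding pp_lifts_def
  proof (intro ballI impI)
    fix u v w
    assume u: "u \<in> hom C (Dom C f \<otimes> Cod C g) (Dom C p)" and v: "v \<in> hom C (Cod C f \<otimes> Dom C g) (Dom C p)"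
      and w: "w \<in> hom C (Cod C f \<otimes> Cod C g) (Cod C p)"
      and uv: "u \<cdot> (Ide C (Dom C f) \<odot> g) = v \<cdot> (f \<odot> Ide C (Dom C g))"
      and pu: "p \<cdot> u = w \<cdot> (f \<odot> Ide C (Cod C g))" and pv: "p \<cdot> v = w \<cdot> (Ide C (Cod C f) \<odot> g)"
    obtain h where h: "h \<in> hom C (pp_dom C f g) (Dom C p)" "h \<cdot> pp_in0 C f g = u" "h \<cdot> pp_in1 C f g = v"
      using ex1_implies_ex[OF pp_exists[OF f g u v uv]] by blast
    have "p \<cdot> h = w \<cdot> f \<box> g"
      by (rule is_pushout_unique[OF pp_is_pushout[OF f g], of _ "Cod C p"])
        (use h w f g p pu pv in auto)
    then obtain k where k: "k \<in> hom C (Cod C f \<otimes> Cod C g) (Dom C p)" "k \<cdot> f \<box> g = h" "p \<cdot> k = w"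
      using liftsE[OF l, of h w] h w f g by auto
    have "k \<cdot> (f \<odot> Ide C (Cod C g)) = u" "k \<cdot> (Ide C (Cod C f) \<odot> g) = v"
      using Comp_extend[OF k(2), of "pp_in0 C f g"] Comp_extend[OF k(2), of "pp_in1 C f g"] k f g h
      by simp_all
    then show "\<exists>l \<in> hom C (Cod C f \<otimes> Cod C g) (Dom C p). l \<cdot> (f \<odot> Ide C (Cod C g)) = u \<and>
      l \<cdot> (Ide C (Cod C f) \<odot> g) = v \<and> p \<cdot> l = w"
      using k by blast
  qed
next
  assume l: "pp_lifts C f g p"
  show "lifts C (f \<box> g) p"
    unfolding lifts_def
  proof (intro ballI impI)
    fix h w
    assume h: "h \<in> hom C (Dom C (f \<box> g)) (Dom C p)" and w: "w \<in> hom C (Cod C (f \<box> g)) (Cod C p)"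
      and e: "p \<cdot> h = w \<cdot> f \<box> g"
    define u v where "u = h \<cdot> pp_in0 C f g" and "v = h \<cdot> pp_in1 C f g"
    have "u \<in> hom C (Dom C f \<otimes> Cod C g) (Dom C p)" "v \<in> hom C (Cod C f \<otimes> Dom C g) (Dom C p)"
      "w \<in> hom C (Cod C f \<otimes> Cod C g) (Cod C p)"
      using h w f g by (auto simp: u_def v_def)
    moreover have "u \<cdot> (Ide C (Dom C f) \<odot> g) = v \<cdot> (f \<odot> Ide C (Dom C g))"
      using h f g by (simp add: u_def v_def pp_square)
    moreover have "p \<cdot> u = w \<cdot> (f \<odot> Ide C (Cod C g))" "p \<cdot> v = w \<cdot> (Ide C (Cod C f) \<odot> g)"
      using h f g p w Comp_extend[OF e, of "pp_in0 C f g"] Comp_extend[OF e, of "pp_in1 C f g"]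
      by (simp_all add: u_def v_def)
    ultimately obtain k where k: "k \<in> hom C (Cod C f \<otimes> Cod C g) (Dom C p)"
      "k \<cdot> (f \<odot> Ide C (Cod C g)) = u" "k \<cdot> (Ide C (Cod C f) \<odot> g) = v" "p \<cdot> k = w"
      using l unfolding pp_lifts_def by blast
    have "k \<cdot> f \<box> g = h"
      by (rule is_pushout_unique[OF pp_is_pushout[OF f g], of _ "Dom C p"])
        (use k h f g u_def v_def in auto)
    then show "\<exists>l \<in> hom C (Cod C (f \<box> g)) (Dom C p). l \<cdot> f \<box> g = h \<and> p \<cdot> l = w"
      using k f g by auto
  qed
qed

section \<open>The arrow category\<close>

definition side :: "('o, 'm) cell \<Rightarrow> bool \<Rightarrow> ('o, 'm) cell" where
  "side s i = (if i then sq1 s else sq0 s)"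

definition square :: "('o, 'm) cell \<Rightarrow> ('o, 'm) cell \<Rightarrow> (bool \<Rightarrow> ('o, 'm) cell) \<Rightarrow> ('o, 'm) cell" where
  "square f g \<sigma> = Sq f g (\<sigma> False) (\<sigma> True)"

lemma side_square [simp]: "side (square f g \<sigma>) i = \<sigma> i"
  by (simp add: side_def square_def)

lemma Arr_Obj [simp]: "Obj (Arr C) = Mor C"
  by (simp add: Arr_def)

lemma Arr_Mor:
  "s \<in> Mor (Arr C) \<longleftrightarrow> s = square (Dom (Arr C) s) (Cod (Arr C) s) (side s) \<and>
     Dom (Arr C) s \<in> Mor C \<and> Cod (Arr C) s \<in> Mor C \<and>
     (\<forall>i. side s i \<in> hom C (vertex C (Dom (Arr C) s) i) (vertex C (Cod (Arr C) s) i)) \<and>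
     Cod (Arr C) s \<cdot>\<^bsub>C\<^esub> side s False = side s True \<cdot>\<^bsub>C\<^esub> Dom (Arr C) s"
proof -
  have "(\<forall>i. Q i) \<longleftrightarrow> Q False \<and> Q True" for Q
    by (metis (full_types))
  then show ?thesis
    by (cases s) (auto simp: Arr_def side_def square_def)
qed

lemma Arr_typing [simp]:
  assumes "s \<in> Mor (Arr C)"
  shows "Dom (Arr C) s \<in> Mor C" "Cod (Arr C) s \<in> Mor C" "side s i \<in> Mor C"
    "Dom C (side s i) = vertex C (Dom (Arr C) s) i" "Cod C (side s i) = vertex C (Cod (Arr C) s) i"
  using assms unfolding Arr_Mor[of s] by simp_all

lemma Arr_square: "s \<in> Mor (Arr C) \<Longrightarrow>
    Cod (Arr C) s \<cdot>\<^bsub>C\<^esub> side s False = side s True \<cdot>\<^bsub>C\<^esub> Dom (Arr C) s"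
  unfolding Arr_Mor[of s] by blast

lemma square_hom:
  assumes "f \<in> Mor C" "g \<in> Mor C" "\<And>i. \<sigma> i \<in> hom C (vertex C f i) (vertex C g i)"
    and "g \<cdot>\<^bsub>C\<^esub> \<sigma> False = \<sigma> True \<cdot>\<^bsub>C\<^esub> f"
  shows "square f g \<sigma> \<in> hom (Arr C) f g"
  using assms(1,2,4) assms(3)[of True] assms(3)[of False] by (auto simp: square_def Arr_def)

lemma Arr_ext:
  assumes "s \<in> hom (Arr C) f g" "t \<in> hom (Arr C) f g" "\<And>i. side s i = side t i"
  shows "s = t"
proof -
  have "side s = side t"
    using assms(3) by auto
  moreover have "s = square f g (side s)" "t = square f g (side t)"
    using assms(1,2) Arr_Mor[of s C] Arr_Mor[of t C] unfolding hom_iff by metis+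
  ultimately show ?thesis
    by metis
qed

lemma side_Comp [simp]: "side (t \<cdot>\<^bsub>Arr C\<^esub> s) i = side t i \<cdot>\<^bsub>C\<^esub> side s i"
  by (simp add: side_def Arr_def)

lemma side_Ide [simp]: "side (Ide (Arr C) f) i = Ide C (vertex C f i)"
  by (simp add: side_def Arr_def vertex_def)

text \<open>The setting for a single step of the iteration: the objects and morphisms of \<open>C\<close> are cells.\<close>

locale cell_smcc = finitely_bicomplete_smcc C for C :: "('o, 'm) cell_smcat" (structure)
begin

lemma side_edge:
  "s \<in> Mor (Arr C) \<Longrightarrow> i \<longrightarrow> j \<Longrightarrow>
    edge C (Cod (Arr C) s) i j \<cdot> side s i = side s j \<cdot> edge C (Dom (Arr C) s) i j"
  using Arr_square[of s C] by (cases i; cases j) auto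

lemma category_Arr: "category (Arr C)"
proof -
  have paste: "k \<cdot> (a' \<cdot> a) = b' \<cdot> (b \<cdot> f)"
    if "f \<in> Mor C" "g \<in> Mor C" "k \<in> Mor C" "a \<in> hom C (Dom C f) (Dom C g)" "b \<in> hom C (Cod C f) (Cod C g)"
      "a' \<in> hom C (Dom C g) (Dom C k)" "b' \<in> hom C (Cod C g) (Cod C k)"
      "g \<cdot> a = b \<cdot> f" "k \<cdot> a' = b' \<cdot> g" for f g k a b a' b'
    using that(1-8) Comp_extend[OF that(9), of a] by simp
  show ?thesis
    by unfold_locales (auto simp: Arr_def intro!: paste)
qed

interpretation A: category "Arr C"
  by (rule category_Arr)

subsection \<open>The universal property of the pushout product\<close>

lemma pushout_product_universal:
  assumes f: "f \<in> Mor C" and g: "g \<in> Mor C" and z: "z \<in> Mor C"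
    and \<phi>: "\<And>i j. \<phi> i j \<in> hom C (vertex C f i \<otimes> vertex C g j) (vertex C z (i \<and> j))"
    and nat: "\<And>i j i' j'. i \<longrightarrow> i' \<Longrightarrow> j \<longrightarrow> j' \<Longrightarrow>
      edge C z (i \<and> j) (i' \<and> j') \<cdot> \<phi> i j = \<phi> i' j' \<cdot> (edge C f i i' \<odot> edge C g j j')"
  shows "\<exists>s. s \<in> hom (Arr C) (f \<box> g) z \<and> (\<forall>i j. side s (i \<and> j) \<cdot> pair C f g i j = \<phi> i j)"
proof -
  have "\<exists>h. h \<in> hom C (vertex C (f \<box> g) m) (vertex C z m) \<and>
      (\<forall>i j. (i \<and> j) = m \<longrightarrow> h \<cdot> pair C f g i j = \<phi> i j)" for m
  proof (rule pair_exists[OF f g])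
    show "vertex C z m \<in> Obj C"
      using z by simp
    show "\<phi> i j \<in> hom C (vertex C f i \<otimes> vertex C g j) (vertex C z m)" if "(i \<and> j) = m" for i j
      using \<phi>[of i j] that by simp
    show "\<phi> i j = \<phi> i' j' \<cdot> (edge C f i i' \<odot> edge C g j j')"
      if "(i \<and> j) = m" "(i' \<and> j') = m" "i \<longrightarrow> i'" "j \<longrightarrow> j'" for i j i' j'
      using nat[OF that(3,4)] \<phi>[of i j] unfolding that(1,2) by simp
  qed
  then obtain \<sigma> where \<sigma>: "\<And>m. \<sigma> m \<in> hom C (vertex C (f \<box> g) m) (vertex C z m)"
    and \<sigma>\<phi>': "\<forall>m i j. (i \<and> j) = m \<longrightarrow> \<sigma> m \<cdot> pair C f g i j = \<phi> i j"
    by metis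
  have \<sigma>\<phi>: "\<sigma> m \<cdot> pair C f g i j = \<phi> i j" if "m = (i \<and> j)" for m i j
    using \<sigma>\<phi>' that by blast
  have "edge C z m True \<cdot> \<sigma> m = \<sigma> True \<cdot> edge C (f \<box> g) m True" for m
  proof (rule pair_ext[OF f g, where m = m and y = "Cod C z"])
    fix i j
    assume ij: "(i \<and> j) = m"
    note T = \<sigma>[of True] \<sigma>[of "i \<and> j"]
    have "(edge C z (i \<and> j) True \<cdot> \<sigma> (i \<and> j)) \<cdot> pair C f g i j = edge C z (i \<and> j) True \<cdot> \<phi> i j"
      using T \<sigma>\<phi>[of "i \<and> j" i j] f g z by simp
    also have "\<dots> = \<phi> True True \<cdot> (edge C f i True \<odot> edge C g j True)"
      using nat[of i True j True] by simp
    also have "\<dots> = \<sigma> True \<cdot> (edge C (f \<box> g) (i \<and> j) True \<cdot> pair C f g i j)"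
      using pair_edge[OF f g, of i True j True] \<sigma>\<phi>[of True True True] T f g by simp
    also have "\<dots> = (\<sigma> True \<cdot> edge C (f \<box> g) (i \<and> j) True) \<cdot> pair C f g i j"
      using T f g by simp
    finally show "(edge C z m True \<cdot> \<sigma> m) \<cdot> pair C f g i j = (\<sigma> True \<cdot> edge C (f \<box> g) m True) \<cdot> pair C f g i j"
      unfolding ij .
  qed (use \<sigma>[of True] \<sigma>[of m] f g z in simp_all)
  from this[of False] have "z \<cdot> \<sigma> False = \<sigma> True \<cdot> f \<box> g"
    by simp
  then have "square (f \<box> g) z \<sigma> \<in> hom (Arr C) (f \<box> g) z"
    by (intro square_hom) (use \<sigma> f g z in auto)
  then show ?thesis
    using \<sigma>\<phi> by (intro exI[of _ "square (f \<box> g) z \<sigma>"] conjI) simp_all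
qed

lemma pushout_product_ext:
  assumes "f \<in> Mor C" "g \<in> Mor C" "s \<in> hom (Arr C) (f \<box> g) z" "t \<in> hom (Arr C) (f \<box> g) z"
    and "\<And>i j. side s (i \<and> j) \<cdot> pair C f g i j = side t (i \<and> j) \<cdot> pair C f g i j"
  shows "s = t"
proof (rule Arr_ext[OF assms(3,4)])
  fix m
  show "side s m = side t m"
  proof (rule pair_ext[OF assms(1,2), of _ m])
    show "side s m \<cdot> pair C f g i j = side t m \<cdot> pair C f g i j" if "(i \<and> j) = m" for i j
      using assms(5)[of i j] unfolding that .
  qed (use assms(3,4) in auto)
qed

text \<open>The family of maps that a map out of \<open>f \<box> g\<close> amounts to, with the generating cases of its naturality.\<close>

lemma pair_family:
  assumes M: "f \<in> Mor C" "g \<in> Mor C" and t: "t \<in> hom (Arr C) (f \<box> g) z"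
    and \<tau>_def: "\<tau> = (\<lambda>i j. side t (i \<and> j) \<cdot> pair C f g i j)"
  shows "\<tau> i j \<in> hom C (vertex C f i \<otimes> vertex C g j) (vertex C z (i \<and> j))"
    and "\<tau> False False = \<tau> False True \<cdot> (Ide C (Dom C f) \<odot> g)"
    and "\<tau> False False = \<tau> True False \<cdot> (f \<odot> Ide C (Dom C g))"
    and "z \<cdot> \<tau> False True = \<tau> True True \<cdot> (f \<odot> Ide C (Cod C g))"
    and "z \<cdot> \<tau> True False = \<tau> True True \<cdot> (Ide C (Cod C f) \<odot> g)"
proof -
  have z: "z \<in> Mor C"
    using t by auto
  have \<tau>: "\<tau> i j \<in> hom C (vertex C f i \<otimes> vertex C g j) (vertex C z (i \<and> j))" for i j
    using M t by (simp add: \<tau>_def)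
  then show "\<tau> i j \<in> hom C (vertex C f i \<otimes> vertex C g j) (vertex C z (i \<and> j))" .
  have \<tau>nat: "edge C z (i \<and> j) (i' \<and> j') \<cdot> \<tau> i j = \<tau> i' j' \<cdot> (edge C f i i' \<odot> edge C g j j')"
    if i: "i \<longrightarrow> i'" "j \<longrightarrow> j'" for i j i' j'
  proof -
    have ij: "i \<and> j \<longrightarrow> i' \<and> j'"
      using i by blast
    show ?thesis
      unfolding \<tau>_def
      using i ij M z t pair_edge[OF M i] Comp_extend[OF side_edge[of t "i \<and> j" "i' \<and> j'"], of "pair C f g i j"]
      by simp
  qed
  show "\<tau> False False = \<tau> False True \<cdot> (Ide C (Dom C f) \<odot> g)" "\<tau> False False = \<tau> True False \<cdot> (f \<odot> Ide C (Dom C g))"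
    "z \<cdot> \<tau> False True = \<tau> True True \<cdot> (f \<odot> Ide C (Cod C g))"
    "z \<cdot> \<tau> True False = \<tau> True True \<cdot> (Ide C (Cod C f) \<odot> g)"
    using \<tau>nat[of False False False True] \<tau>nat[of False True False False] \<tau>nat[of False True True True]
      \<tau>nat[of True True False True] \<tau>[of False False] \<tau>[of False True] \<tau>[of True False] z
    by simp_all
qed

text \<open>
  For each index \<open>l\<close>, the functor \<open>- \<otimes> k\<^sub>l\<close> preserves the pushout that defines \<open>f \<box> g\<close>, so the family
  \<open>\<phi> - - l\<close> extends to maps \<open>\<theta> m l\<close> on \<open>(f \<box> g)\<^sub>m \<otimes> k\<^sub>l\<close>.  These form in turn a natural family for
  \<open>f \<box> g\<close> and \<open>k\<close>.
\<close>

lemma triple_universal: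
  assumes f: "f \<in> Mor C" and g: "g \<in> Mor C" and k: "k \<in> Mor C" and z: "z \<in> Mor C"
    and \<phi>: "\<And>i j l. \<phi> i j l \<in> hom C (vertex C f i \<otimes> vertex C g j \<otimes> vertex C k l) (vertex C z (i \<and> j \<and> l))"
    and nat: "\<And>i j l i' j' l'. i \<longrightarrow> i' \<Longrightarrow> j \<longrightarrow> j' \<Longrightarrow> l \<longrightarrow> l' \<Longrightarrow>
      edge C z (i \<and> j \<and> l) (i' \<and> j' \<and> l') \<cdot> \<phi> i j l
        = \<phi> i' j' l' \<cdot> (edge C f i i' \<odot> edge C g j j' \<odot> edge C k l l')"
  shows "\<exists>s. s \<in> hom (Arr C) (f \<box> g \<box> k) z \<and> (\<forall>i j l. side s (i \<and> j \<and> l) \<cdot>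
      (pair C (f \<box> g) k (i \<and> j) l \<cdot> (pair C f g i j \<odot> Ide C (vertex C k l))) = \<phi> i j l)"
proof -
  have "\<exists>h. h \<in> hom C (vertex C (f \<box> g) m \<otimes> vertex C k l) (vertex C z (m \<and> l)) \<and>
      (\<forall>i j. (i \<and> j) = m \<longrightarrow> h \<cdot> (pair C f g i j \<odot> Ide C (vertex C k l)) = \<phi> i j l)" for m l
  proof (rule pair_tensor_exists[OF f g])
    show "vertex C z (m \<and> l) \<in> Obj C" "vertex C k l \<in> Obj C"
      using z k by simp_all
    show "\<phi> i j l \<in> hom C (vertex C f i \<otimes> vertex C g j \<otimes> vertex C k l) (vertex C z (m \<and> l))"
      if "(i \<and> j) = m" for i j
      using \<phi>[of i j l] that by auto
    show "\<phi> i j l = \<phi> i' j' l \<cdot> (edge C f i i' \<odot> edge C g j j' \<odot> Ide C (vertex C k l))"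
      if "(i \<and> j) = m" "(i' \<and> j') = m" "i \<longrightarrow> i'" "j \<longrightarrow> j'" for i j i' j'
      using nat[OF that(3,4), of l l] \<phi>[of i j l] that(1,2) by (auto simp flip: conj_assoc)
  qed
  then obtain \<theta> where \<theta>: "\<And>m l. \<theta> m l \<in> hom C (vertex C (f \<box> g) m \<otimes> vertex C k l) (vertex C z (m \<and> l))"
    and \<theta>\<phi>: "\<forall>m l i j. (i \<and> j) = m \<longrightarrow> \<theta> m l \<cdot> (pair C f g i j \<odot> Ide C (vertex C k l)) = \<phi> i j l"
    by metis
  have "edge C z (m \<and> l) (m' \<and> l') \<cdot> \<theta> m l = \<theta> m' l' \<cdot> (edge C (f \<box> g) m m' \<odot> edge C k l l')"
    if m: "m \<longrightarrow> m'" and l: "l \<longrightarrow> l'" for m l m' l'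
  proof (rule pair_tensor_right_ext[OF f g, where m = m and w = "vertex C k l" and y = "vertex C z (m' \<and> l')"])
    fix i j
    assume ij: "(i \<and> j) = m"
    \<comment> \<open>If \<open>m\<close> moves up to \<open>m'\<close>, then \<open>m'\<close> is \<open>True\<close> and both indices move up; otherwise neither moves.\<close>
    define i' j' where "i' = (m = m' \<longrightarrow> i)" and "j' = (m = m' \<longrightarrow> j)"
    have i': "i \<longrightarrow> i'" "j \<longrightarrow> j'" "m' = (i' \<and> j')"
      using ij m by (auto simp: i'_def j'_def)
    note T = \<theta>[of m l] \<theta>[of m' l'] f g k z m l i'
    have "(edge C z (m \<and> l) (m' \<and> l') \<cdot> \<theta> m l) \<cdot> (pair C f g i j \<odot> Ide C (vertex C k l))
      = edge C z (m \<and> l) (m' \<and> l') \<cdot> \<phi> i j l"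
      using T(1,2) f g k z m l ij \<theta>\<phi>[rule_format, of i j m l] by (simp del: edge_simps)
    also have "\<dots> = \<phi> i' j' l' \<cdot> (edge C f i i' \<odot> edge C g j j' \<odot> edge C k l l')"
      using nat[OF i'(1,2) l] unfolding ij[symmetric] i'(3) by (simp only: conj_assoc)
    also have "\<dots> = \<theta> m' l' \<cdot> ((pair C f g i' j' \<cdot> (edge C f i i' \<odot> edge C g j j')) \<odot> edge C k l l')"
      using T(1,2) f g k l i' \<theta>\<phi>[rule_format, of i' j' m' l', symmetric] by (simp add: merge)
    also have "pair C f g i' j' \<cdot> (edge C f i i' \<odot> edge C g j j') = edge C (f \<box> g) m m' \<cdot> pair C f g i j"
      using pair_edge[OF f g i'(1,2)] unfolding ij[symmetric] i'(3) by simp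
    also have "\<theta> m' l' \<cdot> ((edge C (f \<box> g) m m' \<cdot> pair C f g i j) \<odot> edge C k l l')
      = (\<theta> m' l' \<cdot> (edge C (f \<box> g) m m' \<odot> edge C k l l')) \<cdot> (pair C f g i j \<odot> Ide C (vertex C k l))"
      using T(1,2) f g k m l ij by (simp add: merge)
    finally show "(edge C z (m \<and> l) (m' \<and> l') \<cdot> \<theta> m l) \<cdot> (pair C f g i j \<odot> Ide C (vertex C k l))
      = (\<theta> m' l' \<cdot> (edge C (f \<box> g) m m' \<odot> edge C k l l')) \<cdot> (pair C f g i j \<odot> Ide C (vertex C k l))" .
  qed (use \<theta>[of m l] \<theta>[of m' l'] f g k z m l in auto)
  note nat\<theta> = this
  have fg: "f \<box> g \<in> Mor C"
    using f g by simp
  obtain s where s: "s \<in> hom (Arr C) (f \<box> g \<box> k) z"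
    "\<forall>m l. side s (m \<and> l) \<cdot> pair C (f \<box> g) k m l = \<theta> m l"
    using pushout_product_universal[OF fg k z \<theta> nat\<theta>] by blast
  have "side s (i \<and> j \<and> l) \<cdot> (pair C (f \<box> g) k (i \<and> j) l \<cdot> (pair C f g i j \<odot> Ide C (vertex C k l))) = \<phi> i j l"
    for i j l
    using Comp_extend[OF s(2)[rule_format, of "i \<and> j" l], of "pair C f g i j \<odot> Ide C (vertex C k l)"]
      \<theta>\<phi>[rule_format, of i j "i \<and> j" l] s(1) f g k by simp
  with s(1) show ?thesis
    by blast
qed

lemma triple_ext:
  assumes "f \<in> Mor C" "g \<in> Mor C" "k \<in> Mor C" "s \<in> hom (Arr C) (f \<box> g \<box> k) z" "t \<in> hom (Arr C) (f \<box> g \<box> k) z"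
    and "\<And>i j l. side s (i \<and> j \<and> l) \<cdot> (pair C (f \<box> g) k (i \<and> j) l \<cdot> (pair C f g i j \<odot> Ide C (vertex C k l)))
      = side t (i \<and> j \<and> l) \<cdot> (pair C (f \<box> g) k (i \<and> j) l \<cdot> (pair C f g i j \<odot> Ide C (vertex C k l)))"
  shows "s = t"
proof (rule pushout_product_ext[OF _ _ assms(4,5)])
  fix m l
  show "side s (m \<and> l) \<cdot> pair C (f \<box> g) k m l = side t (m \<and> l) \<cdot> pair C (f \<box> g) k m l"
  proof (rule pair_tensor_right_ext[OF assms(1,2), where m = m and w = "vertex C k l"])
    fix i j
    assume ij: "(i \<and> j) = m"
    show "(side s (m \<and> l) \<cdot> pair C (f \<box> g) k m l) \<cdot> (pair C f g i j \<odot> Ide C (vertex C k l))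
      = (side t (m \<and> l) \<cdot> pair C (f \<box> g) k m l) \<cdot> (pair C f g i j \<odot> Ide C (vertex C k l))"
      using assms(1-5) assms(6)[of i j l] unfolding ij[symmetric] by simp
  qed (use assms(1-5) in auto)
qed (use assms(1-3) in auto)

lemma triple_ext_right:
  assumes "f \<in> Mor C" "g \<in> Mor C" "k \<in> Mor C" "s \<in> hom (Arr C) (f \<box> (g \<box> k)) z"
    "t \<in> hom (Arr C) (f \<box> (g \<box> k)) z"
    and "\<And>i j l. side s (i \<and> j \<and> l) \<cdot> (pair C f (g \<box> k) i (j \<and> l) \<cdot> (Ide C (vertex C f i) \<odot> pair C g k j l))
      = side t (i \<and> j \<and> l) \<cdot> (pair C f (g \<box> k) i (j \<and> l) \<cdot> (Ide C (vertex C f i) \<odot> pair C g k j l))"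
  shows "s = t"
proof (rule pushout_product_ext[OF _ _ assms(4,5)])
  fix i m
  show "side s (i \<and> m) \<cdot> pair C f (g \<box> k) i m = side t (i \<and> m) \<cdot> pair C f (g \<box> k) i m"
  proof (rule pair_tensor_left_ext[OF assms(2,3), where m = m and w = "vertex C f i"])
    fix j l
    assume jl: "(j \<and> l) = m"
    show "(side s (i \<and> m) \<cdot> pair C f (g \<box> k) i m) \<cdot> (Ide C (vertex C f i) \<odot> pair C g k j l)
      = (side t (i \<and> m) \<cdot> pair C f (g \<box> k) i m) \<cdot> (Ide C (vertex C f i) \<odot> pair C g k j l)"
      using assms(1-5) assms(6)[of i j l] unfolding jl[symmetric] by simp
  qed (use assms(1-5) in auto)
qed (use assms(1-3) in auto)

lemma quadruple_ext:
  assumes "f \<in> Mor C" "g \<in> Mor C" "k \<in> Mor C" "e \<in> Mor C"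
    "s \<in> hom (Arr C) (f \<box> g \<box> k \<box> e) z" "t \<in> hom (Arr C) (f \<box> g \<box> k \<box> e) z"
    and "\<And>i j l n. side s (i \<and> j \<and> l \<and> n) \<cdot> (pair C (f \<box> g \<box> k) e (i \<and> j \<and> l) n \<cdot>
          ((pair C (f \<box> g) k (i \<and> j) l \<cdot> (pair C f g i j \<odot> Ide C (vertex C k l))) \<odot> Ide C (vertex C e n)))
      = side t (i \<and> j \<and> l \<and> n) \<cdot> (pair C (f \<box> g \<box> k) e (i \<and> j \<and> l) n \<cdot>
          ((pair C (f \<box> g) k (i \<and> j) l \<cdot> (pair C f g i j \<odot> Ide C (vertex C k l))) \<odot> Ide C (vertex C e n)))"
  shows "s = t"
proof (rule triple_ext[OF _ _ _ assms(5,6)])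
  fix m l n
  let ?h = "\<lambda>s. side s (m \<and> l \<and> n) \<cdot> (pair C (f \<box> g \<box> k) e (m \<and> l) n \<cdot>
    (pair C (f \<box> g) k m l \<odot> Ide C (vertex C e n)))"
  have h: "?h s \<in> hom C (vertex C (f \<box> g) m \<otimes> vertex C k l \<otimes> vertex C e n) (vertex C z (m \<and> l \<and> n))"
    "?h t \<in> hom C (vertex C (f \<box> g) m \<otimes> vertex C k l \<otimes> vertex C e n) (vertex C z (m \<and> l \<and> n))"
    using assms(1-6) by auto
  have eq: "?h s \<cdot> (pair C f g i j \<odot> Ide C (vertex C k l) \<odot> Ide C (vertex C e n))
    = ?h t \<cdot> (pair C f g i j \<odot> Ide C (vertex C k l) \<odot> Ide C (vertex C e n))" if "(i \<and> j) = m" for i j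
    using assms(1-6) assms(7)[of i j l n] unfolding that[symmetric] by (simp add: merge)
  show "?h s = ?h t"
  proof (cases m)
    case True
    then show ?thesis
      using eq[of True True] h assms(1-4) by simp
  next
    case False
    have "is_pushout C (Ide C (Dom C f) \<odot> g) (f \<odot> Ide C (Dom C g)) (pp_in0 C f g) (pp_in1 C f g)"
      using assms(1,2) by (rule pp_is_pushout)
    from pushout_tensor_right[OF pushout_tensor_right[OF this, of "vertex C k l"], of "vertex C e n"]
    show ?thesis
      by (rule is_pushout_unique)
        (use False h eq[of False True] eq[of True False] assms(1-4) in \<open>auto simp: pair_def\<close>)
  qed
qed (use assms(1-4) in auto)

subsection \<open>The structure maps of the pushout product\<close>

lemma Arr_fields [simp]:
  "TensorO (Arr C) = pushout_product C" "TensorM (Arr C) = arr_tensor C" "Unit (Arr C) = arr_unit C"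
  "Assoc (Arr C) = arr_assoc C" "LUnit (Arr C) = arr_lunit C" "RUnit (Arr C) = arr_runit C"
  "Braid (Arr C) = arr_braid C"
  by (simp_all add: Arr_def)

text \<open>
  Each structure map is specified on domains by a description of the form below; the universal
  property of the pushout product supplies the map, and the description determines it.
\<close>

lemma Sq_the_eq:
  assumes s: "s \<in> hom (Arr C) f g" and "side s True = b" "P (side s False)"
    and "\<And>h. P h \<Longrightarrow> h = side s False"
  shows "Sq f g (THE h. P h) b = s"
proof -
  have "(THE h. P h) = side s False"
    using assms(3,4) by (rule the_equality)
  moreover have "s = square f g (side s)"
    using s Arr_Mor[of s C] unfolding hom_iff by metis
  ultimately show ?thesis
    using assms(2) by (simp add: square_def)
qed

lemma arr_tensor_char:
  assumes s: "s \<in> hom (Arr C) f f'" and t: "t \<in> hom (Arr C) g g'"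
  shows "arr_tensor C s t \<in> hom (Arr C) (f \<box> g) (f' \<box> g') \<and>
    (\<forall>i j. side (arr_tensor C s t) (i \<and> j) \<cdot> pair C f g i j = pair C f' g' i j \<cdot> (side s i \<odot> side t j))"
proof -
  have M: "f \<in> Mor C" "g \<in> Mor C" "f' \<in> Mor C" "g' \<in> Mor C"
    using s t by auto
  define \<phi> where "\<phi> i j = pair C f' g' i j \<cdot> (side s i \<odot> side t j)" for i j
  have "edge C (f' \<box> g') (i \<and> j) (i' \<and> j') \<cdot> \<phi> i j = \<phi> i' j' \<cdot> (edge C f i i' \<odot> edge C g j j')"
    if i: "i \<longrightarrow> i'" "j \<longrightarrow> j'" for i j i' j'
  proof -
    have "edge C f' i i' \<cdot> side s i = side s i' \<cdot> edge C f i i'" "edge C g' j j' \<cdot> side t j = side t j' \<cdot> edge C g j j'"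
      using side_edge[of s i i'] side_edge[of t j j'] s t i by auto
    then show ?thesis
      using M s t i Comp_extend[OF pair_edge[OF M(3,4) i], of "side s i \<odot> side t j"]
      by (simp add: \<phi>_def merge)
  qed
  moreover have "\<phi> i j \<in> hom C (vertex C f i \<otimes> vertex C g j) (vertex C (f' \<box> g') (i \<and> j))" for i j
    using M s t by (simp add: \<phi>_def)
  ultimately obtain r where r: "r \<in> hom (Arr C) (f \<box> g) (f' \<box> g')"
    and r\<phi>: "\<forall>i j. side r (i \<and> j) \<cdot> pair C f g i j = \<phi> i j"
    using pushout_product_universal[OF M(1,2), of "f' \<box> g'" \<phi>] M by auto
  have d: "sq_dom s = f" "sq_cod s = f'" "sq_dom t = g" "sq_cod t = g'"
    using s t by (auto simp: Arr_def)
  have "arr_tensor C s t = r"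
    unfolding arr_tensor_def Let_def d
  proof (rule Sq_the_eq[OF r])
    show "side r True = sq1 s \<odot> sq1 t"
      using r\<phi>[rule_format, of True True] M r s t by (simp add: \<phi>_def) (simp add: side_def)
    show *: "side r False \<in> hom C (pp_dom C f g) (pp_dom C f' g') \<and>
      side r False \<cdot> pp_in0 C f g = pp_in0 C f' g' \<cdot> (sq0 s \<odot> sq1 t) \<and>
      side r False \<cdot> pp_in1 C f g = pp_in1 C f' g' \<cdot> (sq1 s \<odot> sq0 t)"
      using r\<phi>[rule_format, of False True] r\<phi>[rule_format, of True False] M r
      by (simp add: \<phi>_def pair_def side_def[of s] side_def[of t])
    show "h = side r False" if "h \<in> hom C (pp_dom C f g) (pp_dom C f' g') \<and>
      h \<cdot> pp_in0 C f g = pp_in0 C f' g' \<cdot> (sq0 s \<odot> sq1 t) \<and>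
      h \<cdot> pp_in1 C f g = pp_in1 C f' g' \<cdot> (sq1 s \<odot> sq0 t)" for h
      by (rule is_pushout_unique[OF pp_is_pushout[OF M(1,2)]]) (use that * M in auto)
  qed
  then show ?thesis
    using r r\<phi> by (simp add: \<phi>_def)
qed

lemma arr_tensor_typing [simp]:
  assumes "s \<in> Mor (Arr C)" "t \<in> Mor (Arr C)"
  shows "arr_tensor C s t \<in> Mor (Arr C)"
    "Dom (Arr C) (arr_tensor C s t) = Dom (Arr C) s \<box> Dom (Arr C) t"
    "Cod (Arr C) (arr_tensor C s t) = Cod (Arr C) s \<box> Cod (Arr C) t"
  using arr_tensor_char[of s "Dom (Arr C) s" "Cod (Arr C) s" t "Dom (Arr C) t" "Cod (Arr C) t"] assms
  by auto

lemma arr_tensor_pair: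
  assumes "s \<in> Mor (Arr C)" "t \<in> Mor (Arr C)" "f = Dom (Arr C) s" "g = Dom (Arr C) t" "m = (i \<and> j)"
  shows "side (arr_tensor C s t) m \<cdot> pair C f g i j
    = pair C (Cod (Arr C) s) (Cod (Arr C) t) i j \<cdot> (side s i \<odot> side t j)"
  using arr_tensor_char[of s "Dom (Arr C) s" "Cod (Arr C) s" t "Dom (Arr C) t" "Cod (Arr C) t"] assms
  by auto

lemma arr_tensor_pair':
  assumes "s \<in> Mor (Arr C)" "t \<in> Mor (Arr C)" "f = Dom (Arr C) s" "g = Dom (Arr C) t" "m = (i \<and> j)"
    "x \<in> Mor C" "Cod C x = vertex C f i \<otimes> vertex C g j"
  shows "side (arr_tensor C s t) m \<cdot> (pair C f g i j \<cdot> x)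
    = pair C (Cod (Arr C) s) (Cod (Arr C) t) i j \<cdot> ((side s i \<odot> side t j) \<cdot> x)"
  using Comp_extend[OF arr_tensor_pair[OF assms(1-5)], of x] assms by auto

lemma arr_assoc_char:
  assumes M: "f \<in> Mor C" "g \<in> Mor C" "k \<in> Mor C"
  shows "arr_assoc C f g k \<in> hom (Arr C) (f \<box> g \<box> k) (f \<box> (g \<box> k)) \<and>
    (\<forall>i j l. side (arr_assoc C f g k) (i \<and> j \<and> l) \<cdot>
        (pair C (f \<box> g) k (i \<and> j) l \<cdot> (pair C f g i j \<odot> Ide C (vertex C k l)))
      = pair C f (g \<box> k) i (j \<and> l) \<cdot> ((Ide C (vertex C f i) \<odot> pair C g k j l) \<cdot>
          Assoc C (vertex C f i) (vertex C g j) (vertex C k l)))"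
proof -
  define \<phi> where "\<phi> i j l = pair C f (g \<box> k) i (j \<and> l) \<cdot> ((Ide C (vertex C f i) \<odot> pair C g k j l) \<cdot>
    Assoc C (vertex C f i) (vertex C g j) (vertex C k l))" for i j l
  have gk: "g \<box> k \<in> Mor C" and fg: "f \<box> g \<in> Mor C"
    using M by auto
  have nat: "edge C (f \<box> (g \<box> k)) (i \<and> j \<and> l) (i' \<and> j' \<and> l') \<cdot> \<phi> i j l
      = \<phi> i' j' l' \<cdot> (edge C f i i' \<odot> edge C g j j' \<odot> edge C k l l')"
    if i: "i \<longrightarrow> i'" "j \<longrightarrow> j'" "l \<longrightarrow> l'" for i j l i' j' l'
  proof -
    have jl: "j \<and> l \<longrightarrow> j' \<and> l'"
      using i by blast
    have 1: "edge C (f \<box> (g \<box> k)) (i \<and> j \<and> l) (i' \<and> j' \<and> l') \<cdot> (pair C f (g \<box> k) i (j \<and> l) \<cdot> x)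
        = pair C f (g \<box> k) i' (j' \<and> l') \<cdot> ((edge C f i i' \<odot> edge C (g \<box> k) (j \<and> l) (j' \<and> l')) \<cdot> x)"
      if "x \<in> Mor C" "Cod C x = vertex C f i \<otimes> vertex C (g \<box> k) (j \<and> l)" for x
      using Comp_extend[OF pair_edge[OF M(1) gk i(1) jl], of x] that i jl M gk by simp
    show ?thesis
      using i jl M by (simp add: \<phi>_def 1 merge pair_edge Assoc_nat)
  qed
  have "\<phi> i j l \<in> hom C (vertex C f i \<otimes> vertex C g j \<otimes> vertex C k l) (vertex C (f \<box> (g \<box> k)) (i \<and> j \<and> l))"
    for i j l
    using M by (simp add: \<phi>_def)
  from triple_universal[OF M _ this nat] obtain r where r: "r \<in> hom (Arr C) (f \<box> g \<box> k) (f \<box> (g \<box> k))"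
    and r\<phi>: "\<forall>i j l. side r (i \<and> j \<and> l) \<cdot>
      (pair C (f \<box> g) k (i \<and> j) l \<cdot> (pair C f g i j \<odot> Ide C (vertex C k l))) = \<phi> i j l"
    using M by auto
  have "arr_assoc C f g k = r"
    unfolding arr_assoc_def
  proof (rule Sq_the_eq[OF r])
    show "side r True = Assoc C (Cod C f) (Cod C g) (Cod C k)"
      using r\<phi>[rule_format, of True True True] M r by (simp add: \<phi>_def)
    show *: "side r False \<in> hom C (pp_dom C (f \<box> g) k) (pp_dom C f (g \<box> k)) \<and>
       side r False \<cdot> (pp_in0 C (f \<box> g) k \<cdot> (pp_in0 C f g \<odot> Ide C (Cod C k)))
         = pp_in0 C f (g \<box> k) \<cdot> Assoc C (Dom C f) (Cod C g) (Cod C k) \<and>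
       side r False \<cdot> (pp_in0 C (f \<box> g) k \<cdot> (pp_in1 C f g \<odot> Ide C (Cod C k)))
         = pp_in1 C f (g \<box> k) \<cdot> (Ide C (Cod C f) \<odot> pp_in0 C g k) \<cdot> Assoc C (Cod C f) (Dom C g) (Cod C k) \<and>
       side r False \<cdot> pp_in1 C (f \<box> g) k
         = pp_in1 C f (g \<box> k) \<cdot> (Ide C (Cod C f) \<odot> pp_in1 C g k) \<cdot> Assoc C (Cod C f) (Cod C g) (Dom C k)"
      using r\<phi>[rule_format, of False True True] r\<phi>[rule_format, of True False True]
        r\<phi>[rule_format, of True True False] M r
      by (simp add: \<phi>_def pair_def)
    show "h = side r False" if h: "h \<in> hom C (pp_dom C (f \<box> g) k) (pp_dom C f (g \<box> k)) \<and>
       h \<cdot> (pp_in0 C (f \<box> g) k \<cdot> (pp_in0 C f g \<odot> Ide C (Cod C k)))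
         = pp_in0 C f (g \<box> k) \<cdot> Assoc C (Dom C f) (Cod C g) (Cod C k) \<and>
       h \<cdot> (pp_in0 C (f \<box> g) k \<cdot> (pp_in1 C f g \<odot> Ide C (Cod C k)))
         = pp_in1 C f (g \<box> k) \<cdot> (Ide C (Cod C f) \<odot> pp_in0 C g k) \<cdot> Assoc C (Cod C f) (Dom C g) (Cod C k) \<and>
       h \<cdot> pp_in1 C (f \<box> g) k
         = pp_in1 C f (g \<box> k) \<cdot> (Ide C (Cod C f) \<odot> pp_in1 C g k) \<cdot> Assoc C (Cod C f) (Cod C g) (Dom C k)" for h
    proof -
      have "h \<cdot> pp_in0 C (f \<box> g) k = side r False \<cdot> pp_in0 C (f \<box> g) k"
        by (rule is_pushout_unique[OF pushout_tensor_right[OF pp_is_pushout[OF M(1,2)], of "Cod C k"]])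
          (use h * M in auto)
      then show ?thesis
        by (intro is_pushout_unique[OF pp_is_pushout[OF fg M(3)], of h _ "side r False"]) (use h * M in auto)
    qed
  qed
  then show ?thesis
    using r r\<phi> by (simp add: \<phi>_def)
qed

lemma arr_assoc_typing [simp]:
  assumes "f \<in> Mor C" "g \<in> Mor C" "k \<in> Mor C"
  shows "arr_assoc C f g k \<in> Mor (Arr C)" "Dom (Arr C) (arr_assoc C f g k) = f \<box> g \<box> k"
    "Cod (Arr C) (arr_assoc C f g k) = f \<box> (g \<box> k)"
  using arr_assoc_char[OF assms] by auto

text \<open>
  On pieces, the associator of \<open>Arr C\<close> is the one of \<open>C\<close>.  The maps \<open>x\<close>, \<open>y\<close> and \<open>w\<close> in this lemma and
  its variants absorb whatever precedes the piece, so that they apply as rewrite rules inside larger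
  composites.
\<close>

lemma arr_assoc_pair:
  assumes "f \<in> Mor C" "g \<in> Mor C" "k \<in> Mor C" "x \<in> Mor C" "y \<in> Mor C"
    "Cod C x = vertex C f i \<otimes> vertex C g j" "Cod C y = vertex C k l" "n = (i \<and> j)" "m = (i \<and> j \<and> l)"
  shows "side (arr_assoc C f g k) m \<cdot> (pair C (f \<box> g) k n l \<cdot> ((pair C f g i j \<cdot> x) \<odot> y))
    = pair C f (g \<box> k) i (j \<and> l) \<cdot> ((Ide C (vertex C f i) \<odot> pair C g k j l) \<cdot>
        (Assoc C (vertex C f i) (vertex C g j) (vertex C k l) \<cdot> (x \<odot> y)))"
proof -
  have e: "side (arr_assoc C f g k) m \<cdot> (pair C (f \<box> g) k n l \<cdot> (pair C f g i j \<odot> Ide C (vertex C k l)))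
      = pair C f (g \<box> k) i (j \<and> l) \<cdot> ((Ide C (vertex C f i) \<odot> pair C g k j l) \<cdot>
          Assoc C (vertex C f i) (vertex C g j) (vertex C k l))"
    using arr_assoc_char[OF assms(1-3)] assms(8,9) by blast
  show ?thesis
    using Comp_extend[OF e, of "x \<odot> y"] assms by (simp add: merge)
qed

lemma arr_assoc_pair0:
  assumes "f \<in> Mor C" "g \<in> Mor C" "k \<in> Mor C" "y \<in> Mor C"
    "Cod C y = vertex C k l" "n = (i \<and> j)" "m = (i \<and> j \<and> l)"
  shows "side (arr_assoc C f g k) m \<cdot> (pair C (f \<box> g) k n l \<cdot> (pair C f g i j \<odot> y))
    = pair C f (g \<box> k) i (j \<and> l) \<cdot> ((Ide C (vertex C f i) \<odot> pair C g k j l) \<cdot>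
        (Assoc C (vertex C f i) (vertex C g j) (vertex C k l) \<cdot> (Ide C (vertex C f i \<otimes> vertex C g j) \<odot> y)))"
  using arr_assoc_pair[OF assms(1-3) _ assms(4) _ assms(5-7), of "Ide C (vertex C f i \<otimes> vertex C g j)"]
    assms by simp

lemma arr_assoc_nat:
  assumes r: "r \<in> hom (Arr C) f f'" and s: "s \<in> hom (Arr C) g g'" and t: "t \<in> hom (Arr C) k k'"
  shows "arr_assoc C f' g' k' \<cdot>\<^bsub>Arr C\<^esub> arr_tensor C (arr_tensor C r s) t
    = arr_tensor C r (arr_tensor C s t) \<cdot>\<^bsub>Arr C\<^esub> arr_assoc C f g k"
proof -
  have M: "f \<in> Mor C" "g \<in> Mor C" "k \<in> Mor C" "f' \<in> Mor C" "g' \<in> Mor C" "k' \<in> Mor C"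
    using r s t by auto
  show ?thesis
  proof (rule triple_ext[OF M(1-3), of _ "f' \<box> (g' \<box> k')"])
    fix i j l
    show "side (arr_assoc C f' g' k' \<cdot>\<^bsub>Arr C\<^esub> arr_tensor C (arr_tensor C r s) t) (i \<and> j \<and> l) \<cdot>
        (pair C (f \<box> g) k (i \<and> j) l \<cdot> (pair C f g i j \<odot> Ide C (vertex C k l)))
      = side (arr_tensor C r (arr_tensor C s t) \<cdot>\<^bsub>Arr C\<^esub> arr_assoc C f g k) (i \<and> j \<and> l) \<cdot>
        (pair C (f \<box> g) k (i \<and> j) l \<cdot> (pair C f g i j \<odot> Ide C (vertex C k l)))"
      using M r s t by (simp add: arr_tensor_pair arr_tensor_pair' arr_assoc_pair arr_assoc_pair0 merge Assoc_nat)
  qed (use r s t M in auto)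
qed

lemma arr_assoc_pair0':
  assumes "f \<in> Mor C" "g \<in> Mor C" "k \<in> Mor C" "y \<in> Mor C"
    "Cod C y = vertex C k l" "n = (i \<and> j)" "m = (i \<and> j \<and> l)" "w \<in> Mor C"
    "Cod C w = vertex C f i \<otimes> vertex C g j \<otimes> Dom C y"
  shows "side (arr_assoc C f g k) m \<cdot> (pair C (f \<box> g) k n l \<cdot> ((pair C f g i j \<odot> y) \<cdot> w))
    = pair C f (g \<box> k) i (j \<and> l) \<cdot> ((Ide C (vertex C f i) \<odot> pair C g k j l) \<cdot>
        (Assoc C (vertex C f i) (vertex C g j) (vertex C k l) \<cdot> ((Ide C (vertex C f i \<otimes> vertex C g j) \<odot> y) \<cdot> w)))"
  using Comp_extend[OF arr_assoc_pair0[OF assms(1-7)], of w] assms(1-5,8,9) unfolding assms(6,7)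
  by simp

lemma arr_assoc_pair':
  assumes "f \<in> Mor C" "g \<in> Mor C" "k \<in> Mor C" "x \<in> Mor C" "y \<in> Mor C"
    "Cod C x = vertex C f i \<otimes> vertex C g j" "Cod C y = vertex C k l" "n = (i \<and> j)" "m = (i \<and> j \<and> l)"
    "w \<in> Mor C" "Cod C w = Dom C x \<otimes> Dom C y"
  shows "side (arr_assoc C f g k) m \<cdot> (pair C (f \<box> g) k n l \<cdot> (((pair C f g i j \<cdot> x) \<odot> y) \<cdot> w))
    = pair C f (g \<box> k) i (j \<and> l) \<cdot> ((Ide C (vertex C f i) \<odot> pair C g k j l) \<cdot>
        (Assoc C (vertex C f i) (vertex C g j) (vertex C k l) \<cdot> ((x \<odot> y) \<cdot> w)))"
  using Comp_extend[OF arr_assoc_pair[OF assms(1-9)], of w] assms(1-7,10,11) unfolding assms(8,9)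
  by simp

lemmas arr_assoc_pairs = arr_assoc_pair arr_assoc_pair0 arr_assoc_pair' arr_assoc_pair0'
lemmas arr_tensor_pairs = arr_tensor_pair arr_tensor_pair'

text \<open>
  On the piece with indices \<open>i\<close>, \<open>j\<close>, \<open>l\<close>, \<open>n\<close> both sides become a side of the pentagon in \<open>C\<close>, followed by
  the same map into the target.
\<close>

lemma arr_pentagon:
  assumes "w \<in> Mor C" "x \<in> Mor C" "y \<in> Mor C" "z \<in> Mor C"
  shows "arr_tensor C (Ide (Arr C) w) (arr_assoc C x y z) \<cdot>\<^bsub>Arr C\<^esub> (arr_assoc C w (x \<box> y) z \<cdot>\<^bsub>Arr C\<^esub>
        arr_tensor C (arr_assoc C w x y) (Ide (Arr C) z))
    = arr_assoc C w x (y \<box> z) \<cdot>\<^bsub>Arr C\<^esub> arr_assoc C (w \<box> x) y z" (is "?l = ?r")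
proof (rule quadruple_ext[OF assms])
  fix i j l n
  let ?p = "pair C (w \<box> x \<box> y) z (i \<and> j \<and> l) n \<cdot>
    ((pair C (w \<box> x) y (i \<and> j) l \<cdot> (pair C w x i j \<odot> Ide C (vertex C y l))) \<odot> Ide C (vertex C z n))"
  have l: "side ?l (i \<and> j \<and> l \<and> n) \<cdot> ?p = pair C w (x \<box> (y \<box> z)) i (j \<and> l \<and> n) \<cdot>
     ((Ide C (vertex C w i) \<odot> (pair C x (y \<box> z) j (l \<and> n) \<cdot> ((Ide C (vertex C x j) \<odot> pair C y z l n) \<cdot>
        Assoc C (vertex C x j) (vertex C y l) (vertex C z n)))) \<cdot>
      (Assoc C (vertex C w i) (vertex C x j \<otimes> vertex C y l) (vertex C z n) \<cdot>
       (Assoc C (vertex C w i) (vertex C x j) (vertex C y l) \<odot> Ide C (vertex C z n))))"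
    using assms by (simp add: arr_tensor_pairs arr_assoc_pairs merge Assoc_nats)
  have r: "side ?r (i \<and> j \<and> l \<and> n) \<cdot> ?p = pair C w (x \<box> (y \<box> z)) i (j \<and> l \<and> n) \<cdot>
     ((Ide C (vertex C w i) \<odot> (pair C x (y \<box> z) j (l \<and> n) \<cdot> ((Ide C (vertex C x j) \<odot> pair C y z l n) \<cdot>
        Assoc C (vertex C x j) (vertex C y l) (vertex C z n)))) \<cdot>
      (Assoc C (vertex C w i) (vertex C x j \<otimes> vertex C y l) (vertex C z n) \<cdot>
       (Assoc C (vertex C w i) (vertex C x j) (vertex C y l) \<odot> Ide C (vertex C z n))))"
    using assms by (simp add: arr_tensor_pairs arr_assoc_pairs merge Assoc_nats
        pentagon_nested[symmetric])
  show "side ?l (i \<and> j \<and> l \<and> n) \<cdot> ?p = side ?r (i \<and> j \<and> l \<and> n) \<cdot> ?p"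
    unfolding l r ..
qed (use assms in auto)

lemma arr_braid_char:
  assumes M: "f \<in> Mor C" "g \<in> Mor C"
  shows "arr_braid C f g \<in> hom (Arr C) (f \<box> g) (g \<box> f) \<and>
    (\<forall>i j. side (arr_braid C f g) (i \<and> j) \<cdot> pair C f g i j
      = pair C g f j i \<cdot> Braid C (vertex C f i) (vertex C g j))"
proof -
  define \<phi> where "\<phi> i j = pair C g f j i \<cdot> Braid C (vertex C f i) (vertex C g j)" for i j
  have nat: "edge C (g \<box> f) (i \<and> j) (i' \<and> j') \<cdot> \<phi> i j = \<phi> i' j' \<cdot> (edge C f i i' \<odot> edge C g j j')"
    if i: "i \<longrightarrow> i'" "j \<longrightarrow> j'" for i j i' j'
    using M i Comp_extend[OF pair_edge[OF M(2,1) i(2,1)], of "Braid C (vertex C f i) (vertex C g j)"]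
    by (simp add: \<phi>_def Braid_nat conj_commute)
  have \<phi>: "\<phi> i j \<in> hom C (vertex C f i \<otimes> vertex C g j) (vertex C (g \<box> f) (i \<and> j))" for i j
    using M by (simp add: \<phi>_def conj_commute)
  have gf: "g \<box> f \<in> Mor C"
    using M by simp
  obtain r where r: "r \<in> hom (Arr C) (f \<box> g) (g \<box> f)"
    and r\<phi>: "\<forall>i j. side r (i \<and> j) \<cdot> pair C f g i j = \<phi> i j"
    using pushout_product_universal[OF M gf \<phi> nat] by blast
  have "arr_braid C f g = r"
    unfolding arr_braid_def
  proof (rule Sq_the_eq[OF r])
    show "side r True = Braid C (Cod C f) (Cod C g)"
      using r\<phi>[rule_format, of True True] M r by (simp add: \<phi>_def)
    show *: "side r False \<in> hom C (pp_dom C f g) (pp_dom C g f) \<and>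
      side r False \<cdot> pp_in0 C f g = pp_in1 C g f \<cdot> Braid C (Dom C f) (Cod C g) \<and>
      side r False \<cdot> pp_in1 C f g = pp_in0 C g f \<cdot> Braid C (Cod C f) (Dom C g)"
      using r\<phi>[rule_format, of False True] r\<phi>[rule_format, of True False] M r
      by (simp add: \<phi>_def pair_def)
    show "h = side r False" if "h \<in> hom C (pp_dom C f g) (pp_dom C g f) \<and>
      h \<cdot> pp_in0 C f g = pp_in1 C g f \<cdot> Braid C (Dom C f) (Cod C g) \<and>
      h \<cdot> pp_in1 C f g = pp_in0 C g f \<cdot> Braid C (Cod C f) (Dom C g)" for h
      by (rule is_pushout_unique[OF pp_is_pushout[OF M]]) (use that * M in auto)
  qed
  then show ?thesis
    using r r\<phi> by (simp add: \<phi>_def)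
qed

lemma arr_braid_typing [simp]:
  assumes "f \<in> Mor C" "g \<in> Mor C"
  shows "arr_braid C f g \<in> Mor (Arr C)" "Dom (Arr C) (arr_braid C f g) = f \<box> g"
    "Cod (Arr C) (arr_braid C f g) = g \<box> f"
  using arr_braid_char[OF assms] by auto

lemma arr_braid_pair:
  assumes "f \<in> Mor C" "g \<in> Mor C" "m = (i \<and> j)"
  shows "side (arr_braid C f g) m \<cdot> pair C f g i j
    = pair C g f j i \<cdot> Braid C (vertex C f i) (vertex C g j)"
  using arr_braid_char[OF assms(1,2)] assms(3) by blast

lemma arr_braid_pair':
  assumes "f \<in> Mor C" "g \<in> Mor C" "m = (i \<and> j)" "x \<in> Mor C" "Cod C x = vertex C f i \<otimes> vertex C g j"
  shows "side (arr_braid C f g) m \<cdot> (pair C f g i j \<cdot> x)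
    = pair C g f j i \<cdot> (Braid C (vertex C f i) (vertex C g j) \<cdot> x)"
  using Comp_extend[OF arr_braid_pair[OF assms(1-3)], of x] assms(1,2,4,5) unfolding assms(3)
  by (simp add: conj_commute)

lemmas arr_braid_pairs = arr_braid_pair arr_braid_pair'

lemma arr_braid_nat:
  assumes s: "s \<in> hom (Arr C) f f'" and t: "t \<in> hom (Arr C) g g'"
  shows "arr_braid C f' g' \<cdot>\<^bsub>Arr C\<^esub> arr_tensor C s t = arr_tensor C t s \<cdot>\<^bsub>Arr C\<^esub> arr_braid C f g"
proof -
  have M: "f \<in> Mor C" "g \<in> Mor C" "f' \<in> Mor C" "g' \<in> Mor C"
    using s t by auto
  show ?thesis
  proof (rule pushout_product_ext[OF M(1,2), of _ "g' \<box> f'"])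
    show "side (arr_braid C f' g' \<cdot>\<^bsub>Arr C\<^esub> arr_tensor C s t) (i \<and> j) \<cdot> pair C f g i j
      = side (arr_tensor C t s \<cdot>\<^bsub>Arr C\<^esub> arr_braid C f g) (i \<and> j) \<cdot> pair C f g i j" for i j
      using M s t by (simp add: arr_tensor_pairs arr_braid_pairs Braid_nat conj_commute)
  qed (use M s t in auto)
qed

lemma arr_braid_symmetric:
  assumes M: "f \<in> Mor C" "g \<in> Mor C"
  shows "arr_braid C g f \<cdot>\<^bsub>Arr C\<^esub> arr_braid C f g = Ide (Arr C) (f \<box> g)"
proof (rule pushout_product_ext[OF M, of _ "f \<box> g"])
  show "side (arr_braid C g f \<cdot>\<^bsub>Arr C\<^esub> arr_braid C f g) (i \<and> j) \<cdot> pair C f g i j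
    = side (Ide (Arr C) (f \<box> g)) (i \<and> j) \<cdot> pair C f g i j" for i j
    using M by (simp add: arr_braid_pairs conj_commute)
qed (use M in auto)

lemma arr_hexagon:
  assumes M: "f \<in> Mor C" "g \<in> Mor C" "k \<in> Mor C"
  shows "arr_assoc C g k f \<cdot>\<^bsub>Arr C\<^esub> (arr_braid C f (g \<box> k) \<cdot>\<^bsub>Arr C\<^esub> arr_assoc C f g k)
    = arr_tensor C (Ide (Arr C) g) (arr_braid C f k) \<cdot>\<^bsub>Arr C\<^esub>
        (arr_assoc C g f k \<cdot>\<^bsub>Arr C\<^esub> arr_tensor C (arr_braid C f g) (Ide (Arr C) k))" (is "?l = ?r")
proof (rule triple_ext[OF M, of _ "g \<box> (k \<box> f)"])
  fix i j l
  show "side ?l (i \<and> j \<and> l) \<cdot> (pair C (f \<box> g) k (i \<and> j) l \<cdot> (pair C f g i j \<odot> Ide C (vertex C k l)))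
    = side ?r (i \<and> j \<and> l) \<cdot> (pair C (f \<box> g) k (i \<and> j) l \<cdot> (pair C f g i j \<odot> Ide C (vertex C k l)))"
    using M by (simp add: arr_tensor_pairs arr_assoc_pairs arr_braid_pairs merge Assoc_nats Braid_nat
        Braid_nat' hexagon_nested conj_ac)
qed (use M in auto)

lemma arr_assoc_iso:
  assumes M: "f \<in> Mor C" "g \<in> Mor C" "k \<in> Mor C"
  shows "is_iso (Arr C) (arr_assoc C f g k)"
proof -
  \<comment> \<open>Braiding \<open>f\<close> past \<open>g \<box> k\<close> brings the source of the inverse into the form for which maps out of a
    triple product are available.\<close>
  define \<phi> where "\<phi> j l i = pair C (f \<box> g) k (i \<and> j) l \<cdot> ((pair C f g i j \<odot> Ide C (vertex C k l)) \<cdot>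
    (Assoc_inv (vertex C f i) (vertex C g j) (vertex C k l) \<cdot>
      Braid C (vertex C g j \<otimes> vertex C k l) (vertex C f i)))" for j l i
  have fg: "f \<box> g \<in> Mor C" "f \<box> g \<box> k \<in> Mor C"
    using M by simp_all
  have nat: "edge C (f \<box> g \<box> k) (j \<and> l \<and> i) (j' \<and> l' \<and> i') \<cdot> \<phi> j l i
      = \<phi> j' l' i' \<cdot> (edge C g j j' \<odot> edge C k l l' \<odot> edge C f i i')"
    if i: "j \<longrightarrow> j'" "l \<longrightarrow> l'" "i \<longrightarrow> i'" for i j l i' j' l'
  proof -
    have ij: "i \<and> j \<longrightarrow> i' \<and> j'"
      using i by blast
    have c: "(j \<and> l \<and> i) = ((i \<and> j) \<and> l)" "(j' \<and> l' \<and> i') = ((i' \<and> j') \<and> l')"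
      by auto
    have 1: "edge C (f \<box> g \<box> k) ((i \<and> j) \<and> l) ((i' \<and> j') \<and> l') \<cdot> (pair C (f \<box> g) k (i \<and> j) l \<cdot> x)
        = pair C (f \<box> g) k (i' \<and> j') l' \<cdot> ((edge C (f \<box> g) (i \<and> j) (i' \<and> j') \<odot> edge C k l l') \<cdot> x)"
      if "x \<in> Mor C" "Cod C x = vertex C (f \<box> g) (i \<and> j) \<otimes> vertex C k l" for x
      using Comp_extend[OF pair_edge[OF fg(1) M(3) ij i(2)], of x] that i ij M fg by simp
    show ?thesis
      unfolding c \<phi>_def
      by (subst 1) (use i ij M in \<open>simp_all add: merge pair_edge Assoc_inv_nat Braid_nat Comp_extend[OF Assoc_inv_nat]\<close>)
  qed
  have \<phi>: "\<phi> j l i \<in> hom C (vertex C g j \<otimes> vertex C k l \<otimes> vertex C f i) (vertex C (f \<box> g \<box> k) (j \<and> l \<and> i))"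
    for j l i
  proof -
    have "(j \<and> l \<and> i) = ((i \<and> j) \<and> l)"
      by auto
    then show ?thesis
      using M by (simp add: \<phi>_def)
  qed
  obtain c where c: "c \<in> hom (Arr C) (g \<box> k \<box> f) (f \<box> g \<box> k)"
    and c\<phi>: "\<forall>j l i. side c (j \<and> l \<and> i) \<cdot>
      (pair C (g \<box> k) f (j \<and> l) i \<cdot> (pair C g k j l \<odot> Ide C (vertex C f i))) = \<phi> j l i"
    using triple_universal[OF M(2,3,1) fg(2) \<phi> nat] by blast
  let ?a = "arr_assoc C f g k" and ?b = "c \<cdot>\<^bsub>Arr C\<^esub> arr_braid C f (g \<box> k)"
  have b: "side ?b (i \<and> j \<and> l) \<cdot> (pair C f (g \<box> k) i (j \<and> l) \<cdot> ((Ide C (vertex C f i) \<odot> pair C g k j l) \<cdot> x))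
      = pair C (f \<box> g) k (i \<and> j) l \<cdot> ((pair C f g i j \<odot> Ide C (vertex C k l)) \<cdot>
          (Assoc_inv (vertex C f i) (vertex C g j) (vertex C k l) \<cdot> x))"
    if x: "x \<in> Mor C" "Cod C x = vertex C f i \<otimes> (vertex C g j \<otimes> vertex C k l)" for i j l x
  proof -
    have m: "(i \<and> j \<and> l) = (j \<and> l \<and> i)"
      by auto
    have "side ?b (i \<and> j \<and> l) \<cdot> (pair C f (g \<box> k) i (j \<and> l) \<cdot> ((Ide C (vertex C f i) \<odot> pair C g k j l) \<cdot> x))
      = side c (i \<and> j \<and> l) \<cdot> (pair C (g \<box> k) f (j \<and> l) i \<cdot> ((pair C g k j l \<odot> Ide C (vertex C f i)) \<cdot>
          (Braid C (vertex C f i) (vertex C g j \<otimes> vertex C k l) \<cdot> x)))"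
      using M c x by (simp add: arr_braid_pairs Braid_nat' m)
    also have "\<dots> = \<phi> j l i \<cdot> (Braid C (vertex C f i) (vertex C g j \<otimes> vertex C k l) \<cdot> x)"
      unfolding m
      using Comp_extend[OF c\<phi>[rule_format, of j l i], of "Braid C (vertex C f i) (vertex C g j \<otimes> vertex C k l) \<cdot> x"]
        M c x by simp
    also have "\<dots> = pair C (f \<box> g) k (i \<and> j) l \<cdot> ((pair C f g i j \<odot> Ide C (vertex C k l)) \<cdot>
          (Assoc_inv (vertex C f i) (vertex C g j) (vertex C k l) \<cdot> x))"
      using M x by (simp add: \<phi>_def)
    finally show ?thesis .
  qed
  show ?thesis
  proof (rule A.is_isoI[of _ ?b])
    have "?b \<cdot>\<^bsub>Arr C\<^esub> ?a = Ide (Arr C) (f \<box> g \<box> k)"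
    proof (rule triple_ext[OF M, of _ "f \<box> g \<box> k"])
      fix i j l
      show "side (?b \<cdot>\<^bsub>Arr C\<^esub> ?a) (i \<and> j \<and> l) \<cdot> (pair C (f \<box> g) k (i \<and> j) l \<cdot> (pair C f g i j \<odot> Ide C (vertex C k l)))
        = side (Ide (Arr C) (f \<box> g \<box> k)) (i \<and> j \<and> l) \<cdot>
          (pair C (f \<box> g) k (i \<and> j) l \<cdot> (pair C f g i j \<odot> Ide C (vertex C k l)))"
        using M c b[of "Assoc C (vertex C f i) (vertex C g j) (vertex C k l)" i j l]
        by (simp add: arr_assoc_pairs)
    qed (use M c in auto)
    then show "?b \<cdot>\<^bsub>Arr C\<^esub> ?a = Ide (Arr C) (Dom (Arr C) ?a)"
      using M by simp
    have "?a \<cdot>\<^bsub>Arr C\<^esub> ?b = Ide (Arr C) (f \<box> (g \<box> k))"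
    proof (rule triple_ext_right[OF M, of _ "f \<box> (g \<box> k)"])
      fix i j l
      have "side (?a \<cdot>\<^bsub>Arr C\<^esub> ?b) (i \<and> j \<and> l) \<cdot> (pair C f (g \<box> k) i (j \<and> l) \<cdot> (Ide C (vertex C f i) \<odot> pair C g k j l))
        = side ?a (i \<and> j \<and> l) \<cdot> (side ?b (i \<and> j \<and> l) \<cdot>
          (pair C f (g \<box> k) i (j \<and> l) \<cdot> ((Ide C (vertex C f i) \<odot> pair C g k j l) \<cdot>
            Ide C (vertex C f i \<otimes> (vertex C g j \<otimes> vertex C k l)))))"
        using M c by simp
      also have "\<dots> = pair C f (g \<box> k) i (j \<and> l) \<cdot> (Ide C (vertex C f i) \<odot> pair C g k j l)"
        by (subst b) (use M in \<open>simp_all add: arr_assoc_pairs\<close>)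
      finally show "side (?a \<cdot>\<^bsub>Arr C\<^esub> ?b) (i \<and> j \<and> l) \<cdot>
          (pair C f (g \<box> k) i (j \<and> l) \<cdot> (Ide C (vertex C f i) \<odot> pair C g k j l))
        = side (Ide (Arr C) (f \<box> (g \<box> k))) (i \<and> j \<and> l) \<cdot>
          (pair C f (g \<box> k) i (j \<and> l) \<cdot> (Ide C (vertex C f i) \<odot> pair C g k j l))"
        using M by simp
    qed (use M c in auto)
    then show "?a \<cdot>\<^bsub>Arr C\<^esub> ?b = Ide (Arr C) (Cod (Arr C) ?a)"
      using M by simp
  qed (use M c in auto)
qed

text \<open>The unit is the arrow \<open>\<emptyset> \<rightarrow> 1\<close>, so every piece of a product with index \<open>False\<close> at the unit is initial.\<close>

lemma is_initial_initial: "is_initial C (initial C)"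
  unfolding initial_def by (rule someI_ex) (rule initial_exists)

lemma arr_unit_simps [simp]:
  "arr_unit C \<in> Mor C" "Dom C (arr_unit C) = initial C" "Cod C (arr_unit C) = Unit C"
proof -
  have "\<exists>!h. h \<in> hom C (initial C) (Unit C)"
    using is_initial_initial unfolding is_initial_def by simp
  from theI'[OF this]
  show "arr_unit C \<in> Mor C" "Dom C (arr_unit C) = initial C" "Cod C (arr_unit C) = Unit C"
    unfolding arr_unit_def by simp_all
qed

lemma initial_piece:
  assumes "x \<in> Obj C"
  shows "is_initial C (initial C \<otimes> x)" "is_initial C (x \<otimes> initial C)"
  using initial_tensor[OF is_initial_initial assms] .

text \<open>The inverses of the two components automatically form a square.\<close>

lemma iso_Arr:
  assumes s: "s \<in> Mor (Arr C)" and b: "\<And>i. is_iso C (side s i)"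
  shows "is_iso (Arr C) s"
proof -
  let ?f = "Dom (Arr C) s" and ?g = "Cod (Arr C) s"
  have "\<exists>t. t \<in> hom C (vertex C ?g i) (vertex C ?f i) \<and> t \<cdot> side s i = Ide C (vertex C ?f i) \<and>
      side s i \<cdot> t = Ide C (vertex C ?g i)" for i
    using b[of i] s unfolding is_iso_def by auto
  then obtain \<tau> where \<tau>: "\<And>i. \<tau> i \<in> hom C (vertex C ?g i) (vertex C ?f i)"
    and \<tau>s: "\<And>i. \<tau> i \<cdot> side s i = Ide C (vertex C ?f i)" "\<And>i. side s i \<cdot> \<tau> i = Ide C (vertex C ?g i)"
    by metis
  have "?f \<cdot> \<tau> False = (\<tau> True \<cdot> side s True) \<cdot> (?f \<cdot> \<tau> False)"
    unfolding \<tau>s(1) using \<tau>[of False] s by simp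
  also have "\<dots> = \<tau> True \<cdot> ((side s True \<cdot> ?f) \<cdot> \<tau> False)"
    using \<tau>[of False] \<tau>[of True] s by simp
  also have "\<dots> = \<tau> True \<cdot> (?g \<cdot> (side s False \<cdot> \<tau> False))"
    unfolding Arr_square[OF s, symmetric] using \<tau>[of False] \<tau>[of True] s by simp
  also have "\<dots> = \<tau> True \<cdot> ?g"
    unfolding \<tau>s(2) using s by simp
  finally have t: "square ?g ?f \<tau> \<in> hom (Arr C) ?g ?f"
    by (intro square_hom) (use s \<tau> in simp_all)
  show ?thesis
  proof (rule A.is_isoI[of s "square ?g ?f \<tau>"])
    show "square ?g ?f \<tau> \<cdot>\<^bsub>Arr C\<^esub> s = Ide (Arr C) ?f"
      by (rule Arr_ext[of _ C ?f ?f]) (use s t \<tau>s in simp_all)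
    show "s \<cdot>\<^bsub>Arr C\<^esub> square ?g ?f \<tau> = Ide (Arr C) ?g"
      by (rule Arr_ext[of _ C ?g ?g]) (use s t \<tau>s in simp_all)
  qed (use s t in simp_all)
qed

lemma arr_lunit_char:
  assumes f: "f \<in> Mor C"
  shows "arr_lunit C f \<in> hom (Arr C) (arr_unit C \<box> f) f \<and>
    (\<forall>j. side (arr_lunit C f) j \<cdot> pair C (arr_unit C) f True j = LUnit C (vertex C f j))"
proof -
  let ?u = "arr_unit C"
  have "\<exists>h. h \<in> hom C (initial C \<otimes> vertex C f j) (Dom C f)" for j
    by (rule initial_map[OF initial_piece(1)]) (use f in simp_all)
  then obtain b where b: "\<And>j. b j \<in> hom C (initial C \<otimes> vertex C f j) (Dom C f)"
    by metis
  define \<phi> where "\<phi> i j = (if i then LUnit C (vertex C f j) else b j)" for i j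
  have \<phi>: "\<phi> i j \<in> hom C (vertex C ?u i \<otimes> vertex C f j) (vertex C f (i \<and> j))" for i j
    using b[of j] f by (cases i) (simp_all add: \<phi>_def)
  have nat: "edge C f (i \<and> j) (i' \<and> j') \<cdot> \<phi> i j = \<phi> i' j' \<cdot> (edge C ?u i i' \<odot> edge C f j j')"
    if i: "i \<longrightarrow> i'" "j \<longrightarrow> j'" for i j i' j'
  proof (cases i)
    case True
    then show ?thesis
      using i f by (simp add: \<phi>_def LUnit_nat)
  next
    case False
    have ij: "i \<and> j \<longrightarrow> i' \<and> j'"
      using i by blast
    show ?thesis
      by (rule initial_unique[OF initial_piece(1), of "vertex C f j"])
        (use False i ij f \<phi>[of i j] \<phi>[of i' j'] in simp_all)
  qed
  obtain r where r: "r \<in> hom (Arr C) (?u \<box> f) f"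
    and r\<phi>: "\<forall>i j. side r (i \<and> j) \<cdot> pair C ?u f i j = \<phi> i j"
    using pushout_product_universal[OF arr_unit_simps(1) f f \<phi> nat] by blast
  have "arr_lunit C f = r"
    unfolding arr_lunit_def
  proof (rule Sq_the_eq[OF r])
    show "side r True = LUnit C (Cod C f)"
      using r\<phi>[rule_format, of True True] f r by (simp add: \<phi>_def)
    show *: "side r False \<in> hom C (pp_dom C ?u f) (Dom C f) \<and> side r False \<cdot> pp_in1 C ?u f = LUnit C (Dom C f)"
      using r\<phi>[rule_format, of True False] f r by (simp add: \<phi>_def pair_def)
    show "h = side r False" if h: "h \<in> hom C (pp_dom C ?u f) (Dom C f) \<and> h \<cdot> pp_in1 C ?u f = LUnit C (Dom C f)" for h
    proof (rule is_pushout_unique[OF pp_is_pushout[OF arr_unit_simps(1) f]])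
      show "h \<cdot> pp_in0 C ?u f = side r False \<cdot> pp_in0 C ?u f"
        by (rule initial_unique[OF initial_piece(1), of "Cod C f"]) (use h * f in simp_all)
    qed (use h * f in auto)
  qed
  then show ?thesis
    using r r\<phi>[rule_format, of True] by (simp add: \<phi>_def)
qed

lemma arr_runit_char:
  assumes f: "f \<in> Mor C"
  shows "arr_runit C f \<in> hom (Arr C) (f \<box> arr_unit C) f \<and>
    (\<forall>i. side (arr_runit C f) i \<cdot> pair C f (arr_unit C) i True = RUnit C (vertex C f i))"
proof -
  let ?u = "arr_unit C"
  have "\<exists>h. h \<in> hom C (vertex C f j \<otimes> initial C) (Dom C f)" for j
    by (rule initial_map[OF initial_piece(2)]) (use f in simp_all)
  then obtain b where b: "\<And>j. b j \<in> hom C (vertex C f j \<otimes> initial C) (Dom C f)"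
    by metis
  define \<phi> where "\<phi> j i = (if i then RUnit C (vertex C f j) else b j)" for i j
  have \<phi>: "\<phi> i j \<in> hom C (vertex C f i \<otimes> vertex C ?u j) (vertex C f (i \<and> j))" for i j
    using b[of i] f by (cases j) (simp_all add: \<phi>_def)
  have nat: "edge C f (i \<and> j) (i' \<and> j') \<cdot> \<phi> i j = \<phi> i' j' \<cdot> (edge C f i i' \<odot> edge C ?u j j')"
    if i: "i \<longrightarrow> i'" "j \<longrightarrow> j'" for i j i' j'
  proof (cases j)
    case True
    then show ?thesis
      using i f by (simp add: \<phi>_def RUnit_nat)
  next
    case False
    have ij: "i \<and> j \<longrightarrow> i' \<and> j'"
      using i by blast
    show ?thesis
      by (rule initial_unique[OF initial_piece(2), of "vertex C f i"])
        (use False i ij f \<phi>[of i j] \<phi>[of i' j'] in simp_all)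
  qed
  obtain r where r: "r \<in> hom (Arr C) (f \<box> ?u) f"
    and r\<phi>: "\<forall>i j. side r (i \<and> j) \<cdot> pair C f ?u i j = \<phi> i j"
    using pushout_product_universal[OF f arr_unit_simps(1) f \<phi> nat] by blast
  have "arr_runit C f = r"
    unfolding arr_runit_def
  proof (rule Sq_the_eq[OF r])
    show "side r True = RUnit C (Cod C f)"
      using r\<phi>[rule_format, of True True] f r by (simp add: \<phi>_def)
    show *: "side r False \<in> hom C (pp_dom C f ?u) (Dom C f) \<and> side r False \<cdot> pp_in0 C f ?u = RUnit C (Dom C f)"
      using r\<phi>[rule_format, of False True] f r by (simp add: \<phi>_def pair_def)
    show "h = side r False" if h: "h \<in> hom C (pp_dom C f ?u) (Dom C f) \<and> h \<cdot> pp_in0 C f ?u = RUnit C (Dom C f)" for h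
    proof (rule is_pushout_unique[OF pp_is_pushout[OF f arr_unit_simps(1)]])
      show "h \<cdot> pp_in1 C f ?u = side r False \<cdot> pp_in1 C f ?u"
        by (rule initial_unique[OF initial_piece(2), of "Cod C f"]) (use h * f in simp_all)
    qed (use h * f in auto)
  qed
  then show ?thesis
    using r r\<phi>[rule_format, of _ True] by (simp add: \<phi>_def)
qed

lemma arr_unitors_typing [simp]:
  assumes "f \<in> Mor C"
  shows "arr_lunit C f \<in> Mor (Arr C)" "Dom (Arr C) (arr_lunit C f) = arr_unit C \<box> f"
    "Cod (Arr C) (arr_lunit C f) = f"
    "arr_runit C f \<in> Mor (Arr C)" "Dom (Arr C) (arr_runit C f) = f \<box> arr_unit C"
    "Cod (Arr C) (arr_runit C f) = f"
  using arr_lunit_char[OF assms] arr_runit_char[OF assms] by auto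

lemma arr_unitors_pair:
  assumes "f \<in> Mor C"
  shows "side (arr_lunit C f) j \<cdot> pair C (arr_unit C) f True j = LUnit C (vertex C f j)"
    "side (arr_runit C f) j \<cdot> pair C f (arr_unit C) j True = RUnit C (vertex C f j)"
  using arr_lunit_char[OF assms] arr_runit_char[OF assms] by auto

lemma arr_unitors_pair':
  assumes "f \<in> Mor C" "x \<in> Mor C"
  shows "Cod C x = Unit C \<otimes> vertex C f j \<Longrightarrow>
      side (arr_lunit C f) j \<cdot> (pair C (arr_unit C) f True j \<cdot> x) = LUnit C (vertex C f j) \<cdot> x"
    "Cod C x = vertex C f j \<otimes> Unit C \<Longrightarrow>
      side (arr_runit C f) j \<cdot> (pair C f (arr_unit C) j True \<cdot> x) = RUnit C (vertex C f j) \<cdot> x"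
  using Comp_extend[OF arr_unitors_pair(1)[OF assms(1), of j], of x]
    Comp_extend[OF arr_unitors_pair(2)[OF assms(1), of j], of x]
    assms by simp_all

text \<open>Pieces with index \<open>False\<close> at the unit are initial and impose no condition.\<close>

lemma arr_lunit_ext:
  assumes "f \<in> Mor C" "h \<in> hom C (vertex C (arr_unit C \<box> f) j) y" "h' \<in> hom C (vertex C (arr_unit C \<box> f) j) y"
    and eq: "h \<cdot> pair C (arr_unit C) f True j = h' \<cdot> pair C (arr_unit C) f True j"
  shows "h = h'"
proof (rule pair_ext[OF arr_unit_simps(1) assms(1-3)])
  fix i l
  assume il: "(i \<and> l) = j"
  show "h \<cdot> pair C (arr_unit C) f i l = h' \<cdot> pair C (arr_unit C) f i l"
  proof (cases i)
    case True
    then show ?thesis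
      using il eq by simp
  next
    case False
    show ?thesis
      by (rule initial_unique[OF initial_piece(1), of "vertex C f l"])
        (use False il assms(1-3) in auto)
  qed
qed

lemma arr_runit_ext:
  assumes "f \<in> Mor C" "h \<in> hom C (vertex C (f \<box> arr_unit C) j) y" "h' \<in> hom C (vertex C (f \<box> arr_unit C) j) y"
    and eq: "h \<cdot> pair C f (arr_unit C) j True = h' \<cdot> pair C f (arr_unit C) j True"
  shows "h = h'"
proof (rule pair_ext[OF assms(1) arr_unit_simps(1) assms(2,3)])
  fix l i
  assume il: "(l \<and> i) = j"
  show "h \<cdot> pair C f (arr_unit C) l i = h' \<cdot> pair C f (arr_unit C) l i"
  proof (cases i)
    case True
    then show ?thesis
      using il eq by simp
  next
    case False
    show ?thesis
      by (rule initial_unique[OF initial_piece(2), of "vertex C f l"])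
        (use False il assms(1-3) in auto)
  qed
qed

lemma arr_lunit_iso:
  assumes f: "f \<in> Mor C"
  shows "is_iso (Arr C) (arr_lunit C f)"
proof (rule iso_Arr)
  fix j
  let ?l = "LUnit C (vertex C f j)" and ?p = "pair C (arr_unit C) f True j"
  obtain a where a: "a \<in> hom C (vertex C f j) (Unit C \<otimes> vertex C f j)"
    "a \<cdot> ?l = Ide C (Unit C \<otimes> vertex C f j)" "?l \<cdot> a = Ide C (vertex C f j)"
    using LUnit_iso[of "vertex C f j"] f unfolding is_iso_def by auto
  show "is_iso C (side (arr_lunit C f) j)"
  proof (rule is_isoI[of _ "?p \<cdot> a"])
    have "(?p \<cdot> a) \<cdot> side (arr_lunit C f) j = Ide C (vertex C (arr_unit C \<box> f) j)"
      by (rule arr_lunit_ext[OF f, where j = j and y = "vertex C (arr_unit C \<box> f) j"]) (use f a in \<open>simp_all add: arr_unitors_pair\<close>)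
    then show "(?p \<cdot> a) \<cdot> side (arr_lunit C f) j = Ide C (Dom C (side (arr_lunit C f) j))"
      using f by simp
    show "side (arr_lunit C f) j \<cdot> (?p \<cdot> a) = Ide C (Cod C (side (arr_lunit C f) j))"
      using f a by (simp add: arr_unitors_pair')
  qed (use f a in simp_all)
qed (use f in simp)

lemma arr_runit_iso:
  assumes f: "f \<in> Mor C"
  shows "is_iso (Arr C) (arr_runit C f)"
proof (rule iso_Arr)
  fix j
  let ?l = "RUnit C (vertex C f j)" and ?p = "pair C f (arr_unit C) j True"
  obtain a where a: "a \<in> hom C (vertex C f j) (vertex C f j \<otimes> Unit C)"
    "a \<cdot> ?l = Ide C (vertex C f j \<otimes> Unit C)" "?l \<cdot> a = Ide C (vertex C f j)"
    using RUnit_iso[of "vertex C f j"] f unfolding is_iso_def by auto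
  show "is_iso C (side (arr_runit C f) j)"
  proof (rule is_isoI[of _ "?p \<cdot> a"])
    have "(?p \<cdot> a) \<cdot> side (arr_runit C f) j = Ide C (vertex C (f \<box> arr_unit C) j)"
      by (rule arr_runit_ext[OF f, where j = j and y = "vertex C (f \<box> arr_unit C) j"]) (use f a in \<open>simp_all add: arr_unitors_pair\<close>)
    then show "(?p \<cdot> a) \<cdot> side (arr_runit C f) j = Ide C (Dom C (side (arr_runit C f) j))"
      using f by simp
    show "side (arr_runit C f) j \<cdot> (?p \<cdot> a) = Ide C (Cod C (side (arr_runit C f) j))"
      using f a by (simp add: arr_unitors_pair')
  qed (use f a in simp_all)
qed (use f in simp)

lemma arr_lunit_nat:
  assumes s: "s \<in> hom (Arr C) f g"
  shows "arr_lunit C g \<cdot>\<^bsub>Arr C\<^esub> arr_tensor C (Ide (Arr C) (arr_unit C)) s = s \<cdot>\<^bsub>Arr C\<^esub> arr_lunit C f"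
proof -
  have M: "f \<in> Mor C" "g \<in> Mor C"
    using s by auto
  show ?thesis
  proof (rule Arr_ext[of _ C "arr_unit C \<box> f" g])
    fix j
    show "side (arr_lunit C g \<cdot>\<^bsub>Arr C\<^esub> arr_tensor C (Ide (Arr C) (arr_unit C)) s) j = side (s \<cdot>\<^bsub>Arr C\<^esub> arr_lunit C f) j"
      by (rule arr_lunit_ext[OF M(1), where j = j and y = "vertex C g j"])
        (use M s in \<open>simp_all add: arr_tensor_pairs arr_unitors_pair arr_unitors_pair' LUnit_nat\<close>)
  qed (use M s in simp_all)
qed

lemma arr_runit_nat:
  assumes s: "s \<in> hom (Arr C) f g"
  shows "arr_runit C g \<cdot>\<^bsub>Arr C\<^esub> arr_tensor C s (Ide (Arr C) (arr_unit C)) = s \<cdot>\<^bsub>Arr C\<^esub> arr_runit C f"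
proof -
  have M: "f \<in> Mor C" "g \<in> Mor C"
    using s by auto
  show ?thesis
  proof (rule Arr_ext[of _ C "f \<box> arr_unit C" g])
    fix j
    show "side (arr_runit C g \<cdot>\<^bsub>Arr C\<^esub> arr_tensor C s (Ide (Arr C) (arr_unit C))) j = side (s \<cdot>\<^bsub>Arr C\<^esub> arr_runit C f) j"
      by (rule arr_runit_ext[OF M(1), where j = j and y = "vertex C g j"])
        (use M s in \<open>simp_all add: arr_tensor_pairs arr_unitors_pair arr_unitors_pair' RUnit_nat\<close>)
  qed (use M s in simp_all)
qed

lemma arr_triangle:
  assumes M: "f \<in> Mor C" "g \<in> Mor C"
  shows "arr_tensor C (Ide (Arr C) f) (arr_lunit C g) \<cdot>\<^bsub>Arr C\<^esub> arr_assoc C f (arr_unit C) g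
    = arr_tensor C (arr_runit C f) (Ide (Arr C) g)" (is "?l = ?r")
proof (rule triple_ext[OF M(1) arr_unit_simps(1) M(2), of _ "f \<box> g"])
  fix i j l
  let ?u = "arr_unit C"
  let ?p = "pair C (f \<box> ?u) g (i \<and> j) l \<cdot> (pair C f ?u i j \<odot> Ide C (vertex C g l))"
  show "side ?l (i \<and> j \<and> l) \<cdot> ?p = side ?r (i \<and> j \<and> l) \<cdot> ?p"
  proof (cases j)
    case True
    then show ?thesis
      using M by (simp add: arr_tensor_pairs arr_assoc_pairs merge arr_unitors_pair arr_unitors_pair' triangle)
  next
    case False
    show ?thesis
      by (rule initial_unique[OF initial_tensor(1)[OF initial_piece(2), of "vertex C f i" "vertex C g l"]])
        (use False M in simp_all)
  qed
qed (use M in simp_all)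

subsection \<open>Closedness\<close>

text \<open>
  A natural family \<open>f\<^sub>i \<otimes> g\<^sub>j \<rightarrow> z\<^bsub>i \<and> j\<^esub>\<close> consists, for \<open>i = False\<close>, of a map \<open>f\<^sub>0 \<otimes> g\<^sub>1 \<rightarrow> z\<^sub>0\<close>, and for \<open>i = True\<close>
  of a square from \<open>f\<^sub>1 \<otimes> g\<close> to \<open>z\<close>.  Currying both gives the internal hom.
\<close>

lemma arr_closed:
  assumes g: "g \<in> Mor C" and z: "z \<in> Mor C"
  shows "\<exists>h \<in> Mor C. \<exists>e \<in> hom (Arr C) (h \<box> g) z. \<forall>f \<in> Mor C. \<forall>t \<in> hom (Arr C) (f \<box> g) z.
    \<exists>!s. s \<in> hom (Arr C) f h \<and> e \<cdot>\<^bsub>Arr C\<^esub> arr_tensor C s (Ide (Arr C) g) = t"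
proof -
  have O: "Cod C g \<in> Obj C" "Dom C z \<in> Obj C"
    using g z by auto
  obtain h0 e where h0: "h0 \<in> Obj C" "e \<in> Mor C" "Dom C e = h0 \<otimes> Cod C g" "Cod C e = Dom C z"
    and ex: "\<And>x f. x \<in> Obj C \<Longrightarrow> f \<in> hom C (x \<otimes> Cod C g) (Dom C z)
      \<Longrightarrow> \<exists>s. s \<in> hom C x h0 \<and> e \<cdot> (s \<odot> Ide C (Cod C g)) = f"
    and un: "\<And>x s s'. s \<in> hom C x h0 \<Longrightarrow> s' \<in> hom C x h0
      \<Longrightarrow> e \<cdot> (s \<odot> Ide C (Cod C g)) = e \<cdot> (s' \<odot> Ide C (Cod C g)) \<Longrightarrow> s = s'"
    using currying[OF O] by blast
  obtain h1 e0 e1 where h1: "h1 \<in> Obj C" "e0 \<in> hom C (h1 \<otimes> Dom C g) (Dom C z)"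
      "e1 \<in> hom C (h1 \<otimes> Cod C g) (Cod C z)" "z \<cdot> e0 = e1 \<cdot> (Ide C h1 \<odot> g)"
    and ex1: "\<And>x u v. x \<in> Obj C \<Longrightarrow> u \<in> hom C (x \<otimes> Dom C g) (Dom C z) \<Longrightarrow> v \<in> hom C (x \<otimes> Cod C g) (Cod C z)
      \<Longrightarrow> z \<cdot> u = v \<cdot> (Ide C x \<odot> g)
      \<Longrightarrow> \<exists>s. s \<in> hom C x h1 \<and> e0 \<cdot> (s \<odot> Ide C (Dom C g)) = u \<and> e1 \<cdot> (s \<odot> Ide C (Cod C g)) = v"
    and un1: "\<And>x s s'. s \<in> hom C x h1 \<Longrightarrow> s' \<in> hom C x h1
      \<Longrightarrow> e0 \<cdot> (s \<odot> Ide C (Dom C g)) = e0 \<cdot> (s' \<odot> Ide C (Dom C g))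
      \<Longrightarrow> e1 \<cdot> (s \<odot> Ide C (Cod C g)) = e1 \<cdot> (s' \<odot> Ide C (Cod C g)) \<Longrightarrow> s = s'"
    using currying_arrow[OF g z] by blast
  have "\<exists>s. s \<in> hom C h0 h1 \<and> e0 \<cdot> (s \<odot> Ide C (Dom C g)) = e \<cdot> (Ide C h0 \<odot> g) \<and>
      e1 \<cdot> (s \<odot> Ide C (Cod C g)) = z \<cdot> e"
    by (rule ex1) (use h0 g z in simp_all)
  then obtain h where h: "h \<in> hom C h0 h1" "e0 \<cdot> (h \<odot> Ide C (Dom C g)) = e \<cdot> (Ide C h0 \<odot> g)"
      "e1 \<cdot> (h \<odot> Ide C (Cod C g)) = z \<cdot> e"
    by blast
  have hM: "h \<in> Mor C" "Dom C h = h0" "Cod C h = h1"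
    using h(1) by auto
  define \<phi> where "\<phi> i j = (if i then (if j then e1 else e0) else if j then e else e \<cdot> (Ide C h0 \<odot> g))" for i j
  have \<phi>: "\<phi> i j \<in> hom C (vertex C h i \<otimes> vertex C g j) (vertex C z (i \<and> j))" for i j
    using h0 h1 hM g by (cases i; cases j) (simp_all add: \<phi>_def)
  have nat: "edge C z (i \<and> j) (i' \<and> j') \<cdot> \<phi> i j = \<phi> i' j' \<cdot> (edge C h i i' \<odot> edge C g j j')"
    if i: "i \<longrightarrow> i'" "j \<longrightarrow> j'" for i j i' j'
  proof -
    have split: "h \<odot> g = (h \<odot> Ide C (Cod C g)) \<cdot> (Ide C h0 \<odot> g)"
      using hM g h0 h1 by (simp add: interchange)
    have "e1 \<cdot> (h \<odot> g) = z \<cdot> (e \<cdot> (Ide C h0 \<odot> g))"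
      using Comp_extend[OF h(3), of "Ide C h0 \<odot> g"] hM g h0 h1 z unfolding split by simp
    then show ?thesis
      using i h0 h1 h(2,3) hM g z
      by (cases i; cases j; cases i'; cases j') (simp_all add: \<phi>_def)
  qed
  obtain ev where ev: "ev \<in> hom (Arr C) (h \<box> g) z"
    and ev\<phi>: "\<forall>i j. side ev (i \<and> j) \<cdot> pair C h g i j = \<phi> i j"
    using pushout_product_universal[OF hM(1) g z \<phi> nat] by blast
  have ev_tensor: "side (ev \<cdot>\<^bsub>Arr C\<^esub> arr_tensor C s (Ide (Arr C) g)) (i \<and> j) \<cdot> pair C f g i j
      = \<phi> i j \<cdot> (side s i \<odot> Ide C (vertex C g j))"
    if "f \<in> Mor C" "s \<in> hom (Arr C) f h" for f s i j
    using that ev hM g Comp_extend[OF ev\<phi>[rule_format, of i j], of "side s i \<odot> Ide C (vertex C g j)"]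
    by (simp add: arr_tensor_pairs)
  have "\<exists>!s. s \<in> hom (Arr C) f h \<and> ev \<cdot>\<^bsub>Arr C\<^esub> arr_tensor C s (Ide (Arr C) g) = t"
    if f: "f \<in> Mor C" and t: "t \<in> hom (Arr C) (f \<box> g) z" for f t
  proof -
    define \<tau> where "\<tau> = (\<lambda>i j. side t (i \<and> j) \<cdot> pair C f g i j)"
    note \<tau> = pair_family[OF f g t \<tau>_def]
    have \<tau>T: "\<tau> False True \<in> hom C (Dom C f \<otimes> Cod C g) (Dom C z)" "\<tau> True False \<in> hom C (Cod C f \<otimes> Dom C g) (Dom C z)"
      "\<tau> True True \<in> hom C (Cod C f \<otimes> Cod C g) (Cod C z)"
      using \<tau>(1)[of False True] \<tau>(1)[of True False] \<tau>(1)[of True True] by simp_all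
    have fO: "Dom C f \<in> Obj C" "Cod C f \<in> Obj C"
      using f by auto
    obtain s0 where s0: "s0 \<in> hom C (Dom C f) h0" "e \<cdot> (s0 \<odot> Ide C (Cod C g)) = \<tau> False True"
      using ex[OF fO(1) \<tau>T(1)] by blast
    obtain s1 where s1: "s1 \<in> hom C (Cod C f) h1" "e0 \<cdot> (s1 \<odot> Ide C (Dom C g)) = \<tau> True False"
      "e1 \<cdot> (s1 \<odot> Ide C (Cod C g)) = \<tau> True True"
      using ex1[OF fO(2) \<tau>T(2,3) \<tau>(5)] by blast
    have "h \<cdot> s0 = s1 \<cdot> f"
    proof (rule un1[of _ "Dom C f"])
      have "e0 \<cdot> ((h \<cdot> s0) \<odot> Ide C (Dom C g)) = (e0 \<cdot> (h \<odot> Ide C (Dom C g))) \<cdot> (s0 \<odot> Ide C (Dom C g))"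
        using h1 hM s0(1) g by (simp add: interchange)
      also have "\<dots> = (e \<cdot> (s0 \<odot> Ide C (Cod C g))) \<cdot> (Ide C (Dom C f) \<odot> g)"
        unfolding h(2) using h0 s0(1) g f by (simp add: interchange)
      also have "\<dots> = (e0 \<cdot> (s1 \<odot> Ide C (Dom C g))) \<cdot> (f \<odot> Ide C (Dom C g))"
        unfolding s0(2) s1(2) using \<tau>(2,3) by simp
      also have "\<dots> = e0 \<cdot> ((s1 \<cdot> f) \<odot> Ide C (Dom C g))"
        using h1 s1(1) g f by (simp add: interchange)
      finally show "e0 \<cdot> ((h \<cdot> s0) \<odot> Ide C (Dom C g)) = e0 \<cdot> ((s1 \<cdot> f) \<odot> Ide C (Dom C g))" .
      have "e1 \<cdot> ((h \<cdot> s0) \<odot> Ide C (Cod C g)) = (e1 \<cdot> (h \<odot> Ide C (Cod C g))) \<cdot> (s0 \<odot> Ide C (Cod C g))"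
        using h1 hM s0(1) g by (simp add: interchange)
      also have "\<dots> = z \<cdot> (e \<cdot> (s0 \<odot> Ide C (Cod C g)))"
        unfolding h(3) using h0 s0(1) g z by simp
      also have "\<dots> = (e1 \<cdot> (s1 \<odot> Ide C (Cod C g))) \<cdot> (f \<odot> Ide C (Cod C g))"
        unfolding s0(2) s1(3) by (rule \<tau>(4))
      also have "\<dots> = e1 \<cdot> ((s1 \<cdot> f) \<odot> Ide C (Cod C g))"
        using h1 s1(1) g f by (simp add: interchange)
      finally show "e1 \<cdot> ((h \<cdot> s0) \<odot> Ide C (Cod C g)) = e1 \<cdot> ((s1 \<cdot> f) \<odot> Ide C (Cod C g))" .
    qed (use hM s0 s1 f in simp_all)
    then have s: "square f h (\<lambda>i. if i then s1 else s0) \<in> hom (Arr C) f h" (is "?s \<in> _")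
      by (intro square_hom) (use s0 s1 f hM in simp_all)
    have ss: "side ?s True = s1" "side ?s False = s0"
      by simp_all
    have "ev \<cdot>\<^bsub>Arr C\<^esub> arr_tensor C ?s (Ide (Arr C) g) = t"
    proof (rule pushout_product_ext[OF f g, of _ z])
      fix i j
      have "\<phi> i j \<cdot> (side ?s i \<odot> Ide C (vertex C g j)) = \<tau> i j"
      proof (cases "i \<or> j")
        case True
        then show ?thesis
          using s0 s1 by (cases i; cases j) (simp_all add: \<phi>_def)
      next
        case False
        have "e \<cdot> (Ide C h0 \<odot> g) \<cdot> (s0 \<odot> Ide C (Dom C g)) = (e \<cdot> (s0 \<odot> Ide C (Cod C g))) \<cdot> (Ide C (Dom C f) \<odot> g)"
          using h0 s0(1) g f by (simp add: interchange)
        then show ?thesis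
          using False s0(2) \<tau>(2) by (simp add: \<phi>_def)
      qed
      then show "side (ev \<cdot>\<^bsub>Arr C\<^esub> arr_tensor C ?s (Ide (Arr C) g)) (i \<and> j) \<cdot> pair C f g i j = side t (i \<and> j) \<cdot> pair C f g i j"
        unfolding ev_tensor[OF f s] \<tau>_def .
    qed (use ev s t f g hM in auto)
    moreover have "s = s'"
      if s: "s \<in> hom (Arr C) f h" "s' \<in> hom (Arr C) f h"
        and eq: "ev \<cdot>\<^bsub>Arr C\<^esub> arr_tensor C s (Ide (Arr C) g) = ev \<cdot>\<^bsub>Arr C\<^esub> arr_tensor C s' (Ide (Arr C) g)" for s s'
    proof -
      have \<phi>s: "\<phi> i j \<cdot> (side s i \<odot> Ide C (vertex C g j)) = \<phi> i j \<cdot> (side s' i \<odot> Ide C (vertex C g j))" for i j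
        unfolding ev_tensor[OF f s(1), symmetric] ev_tensor[OF f s(2), symmetric] eq ..
      have "side s False = side s' False"
        by (rule un[of _ "Dom C f"]) (use \<phi>s[of False True] s hM in \<open>simp_all add: \<phi>_def\<close>)
      moreover have "side s True = side s' True"
        by (rule un1[of _ "Cod C f"]) (use \<phi>s[of True True] \<phi>s[of True False] s hM in \<open>simp_all add: \<phi>_def\<close>)
      ultimately have "side s i = side s' i" for i
        by (cases i) simp_all
      then show ?thesis
        by (rule Arr_ext[OF s])
    qed
    ultimately show ?thesis
      using s by metis
  qed
  then show ?thesis
    using hM(1) ev by blast
qed

lemma symmetric_monoidal_closed_Arr: "symmetric_monoidal_closed_category (Arr C)"
proof (unfold_locales, unfold Arr_fields Arr_Obj)
  fix f g
  assume M: "f \<in> Mor C" "g \<in> Mor C"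
  show "arr_tensor C (Ide (Arr C) f) (Ide (Arr C) g) = Ide (Arr C) (f \<box> g)"
    by (rule pushout_product_ext[OF M, of _ "f \<box> g"]) (use M in \<open>simp_all add: arr_tensor_pairs\<close>)
  show "\<exists>h\<in>Mor C. \<exists>e\<in>hom (Arr C) (h \<box> f) g. \<forall>x\<in>Mor C. \<forall>fa\<in>hom (Arr C) (x \<box> f) g.
      \<exists>!ga. ga \<in> hom (Arr C) x h \<and> e \<cdot>\<^bsub>Arr C\<^esub> arr_tensor C ga (Ide (Arr C) f) = fa"
    using arr_closed[OF M] .
next
  fix f x x' f' x'' g y y' g' y''
  assume h: "f \<in> hom (Arr C) x x'" "f' \<in> hom (Arr C) x' x''" "g \<in> hom (Arr C) y y'" "g' \<in> hom (Arr C) y' y''"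
  have M: "x \<in> Mor C" "y \<in> Mor C" "x' \<in> Mor C" "y' \<in> Mor C"
    using h by auto
  show "arr_tensor C (f' \<cdot>\<^bsub>Arr C\<^esub> f) (g' \<cdot>\<^bsub>Arr C\<^esub> g) = arr_tensor C f' g' \<cdot>\<^bsub>Arr C\<^esub> arr_tensor C f g"
    by (rule pushout_product_ext[OF M(1,2), of _ "x'' \<box> y''"])
      (use h M in \<open>simp_all add: arr_tensor_pairs merge\<close>)
next
  fix w x y z
  assume M: "w \<in> Mor C" "x \<in> Mor C" "y \<in> Mor C" "z \<in> Mor C"
  show "arr_tensor C (Ide (Arr C) w) (arr_assoc C x y z) \<cdot>\<^bsub>Arr C\<^esub> arr_assoc C w (x \<box> y) z \<cdot>\<^bsub>Arr C\<^esub>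
      arr_tensor C (arr_assoc C w x y) (Ide (Arr C) z)
    = arr_assoc C w x (y \<box> z) \<cdot>\<^bsub>Arr C\<^esub> arr_assoc C (w \<box> x) y z"
    using arr_pentagon[OF M] M by simp
next
  fix x y z
  assume M: "x \<in> Mor C" "y \<in> Mor C" "z \<in> Mor C"
  show "arr_assoc C y z x \<cdot>\<^bsub>Arr C\<^esub> arr_braid C x (y \<box> z) \<cdot>\<^bsub>Arr C\<^esub> arr_assoc C x y z
    = arr_tensor C (Ide (Arr C) y) (arr_braid C x z) \<cdot>\<^bsub>Arr C\<^esub> arr_assoc C y x z \<cdot>\<^bsub>Arr C\<^esub>
        arr_tensor C (arr_braid C x y) (Ide (Arr C) z)"
    using arr_hexagon[OF M] M by simp
qed (auto intro: arr_assoc_nat arr_assoc_iso arr_braid_nat arr_braid_symmetric arr_lunit_nat arr_runit_nat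
    arr_lunit_iso arr_runit_iso arr_triangle)

subsection \<open>Limits and colimits\<close>

text \<open>Both are computed at the two vertices.\<close>

lemma side_functor:
  assumes "is_functor J (Arr C) Fo Fm"
  shows "is_functor J C (\<lambda>j. vertex C (Fo j) i) (\<lambda>u. side (Fm u) i)"
  using assms unfolding is_functor_def by simp

lemma limit_Arr:
  assumes J: "category J" and F: "is_functor J (Arr C) Fo Fm"
    and lim: "\<And>i. \<exists>x p. is_limit J C (\<lambda>j. vertex C (Fo j) i) (\<lambda>u. side (Fm u) i) x p"
  shows "\<exists>x p. is_limit J (Arr C) Fo Fm x p"
proof -
  interpret J: category J by (rule J)
  obtain X P where L: "\<And>i. is_limit J C (\<lambda>j. vertex C (Fo j) i) (\<lambda>u. side (Fm u) i) (X i) (P i)"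
    using lim by metis
  have X: "X i \<in> Obj C" and P: "j \<in> Obj J \<Longrightarrow> P i j \<in> hom C (X i) (vertex C (Fo j) i)"
    and PF: "u \<in> Mor J \<Longrightarrow> side (Fm u) i \<cdot> P i (Dom J u) = P i (Cod J u)" for i j u
    using L[of i] unfolding is_limit_def is_cone_def by auto
  have univ: "is_cone J C (\<lambda>j. vertex C (Fo j) i) (\<lambda>u. side (Fm u) i) y q
      \<Longrightarrow> \<exists>!h. h \<in> hom C y (X i) \<and> (\<forall>j \<in> Obj J. P i j \<cdot> h = q j)" for i y q
    using L[of i] unfolding is_limit_def by blast
  have Fo: "j \<in> Obj J \<Longrightarrow> Fo j \<in> Mor C" and Fm: "u \<in> Mor J \<Longrightarrow> Fm u \<in> hom (Arr C) (Fo (Dom J u)) (Fo (Cod J u))" for j u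
    using F unfolding is_functor_def by auto
  have "is_cone J C (\<lambda>j. vertex C (Fo j) True) (\<lambda>u. side (Fm u) True) (X False) (\<lambda>j. Fo j \<cdot> P False j)"
    unfolding is_cone_def
  proof (intro conjI ballI)
    fix u
    assume u: "u \<in> Mor J"
    have "side (Fm u) True \<cdot> (Fo (Dom J u) \<cdot> P False (Dom J u))
      = (Fo (Cod J u) \<cdot> side (Fm u) False) \<cdot> P False (Dom J u)"
      using Arr_square[of "Fm u" C] Fm[OF u] Fo P[of "Dom J u" False] u by simp
    then show "side (Fm u) True \<cdot> (Fo (Dom J u) \<cdot> P False (Dom J u)) = Fo (Cod J u) \<cdot> P False (Cod J u)"
      using PF[OF u, of False] Fm[OF u] Fo P[of "Dom J u" False] u by simp
  qed (use X P[of _ False] Fo in simp_all)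
  from univ[OF this] obtain x where x: "x \<in> hom C (X False) (X True)"
    and xP: "\<And>j. j \<in> Obj J \<Longrightarrow> P True j \<cdot> x = Fo j \<cdot> P False j"
    by blast
  have vx: "vertex C x i = X i" for i
    using x by (cases i) simp_all
  define p where "p j = square x (Fo j) (\<lambda>i. P i j)" for j
  have p: "p j \<in> hom (Arr C) x (Fo j)" if "j \<in> Obj J" for j
    unfolding p_def by (rule square_hom) (use x Fo P vx xP that in simp_all)
  have "is_limit J (Arr C) Fo Fm x p"
    unfolding is_limit_def
  proof (intro conjI allI impI)
    show "is_cone J (Arr C) Fo Fm x p"
      unfolding is_cone_def
    proof (intro conjI ballI)
      show "Fm u \<cdot>\<^bsub>Arr C\<^esub> p (Dom J u) = p (Cod J u)" if "u \<in> Mor J" for u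
        by (rule Arr_ext[of _ C x "Fo (Cod J u)"])
          (use that p[of "Dom J u"] p[of "Cod J u"] Fm[OF that] PF[OF that] in \<open>simp_all add: p_def\<close>)
    qed (use x p in simp_all)
    fix y q
    assume "is_cone J (Arr C) Fo Fm y q"
    then have y: "y \<in> Mor C" and q: "\<And>j. j \<in> Obj J \<Longrightarrow> q j \<in> hom (Arr C) y (Fo j)"
      and qF: "\<And>u. u \<in> Mor J \<Longrightarrow> Fm u \<cdot>\<^bsub>Arr C\<^esub> q (Dom J u) = q (Cod J u)"
      unfolding is_cone_def by auto
    have cone: "is_cone J C (\<lambda>j. vertex C (Fo j) i) (\<lambda>u. side (Fm u) i) (vertex C y i) (\<lambda>j. side (q j) i)" for i
      unfolding is_cone_def using y q arg_cong[OF qF, of _ "\<lambda>s. side s i"] by simp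
    have "\<exists>h. h \<in> hom C (vertex C y i) (X i) \<and> (\<forall>j \<in> Obj J. P i j \<cdot> h = side (q j) i)" for i
      by (rule ex1_implies_ex[OF univ[OF cone]])
    then obtain \<sigma> where \<sigma>: "\<And>i. \<sigma> i \<in> hom C (vertex C y i) (X i)"
      and \<sigma>q: "\<And>i j. j \<in> Obj J \<Longrightarrow> P i j \<cdot> \<sigma> i = side (q j) i"
      by metis
    have "is_cone J C (\<lambda>j. vertex C (Fo j) True) (\<lambda>u. side (Fm u) True) (Dom C y) (\<lambda>j. side (q j) True \<cdot> y)"
      unfolding is_cone_def
    proof (intro conjI ballI)
      show "side (Fm u) True \<cdot> (side (q (Dom J u)) True \<cdot> y) = side (q (Cod J u)) True \<cdot> y" if "u \<in> Mor J" for u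
        using arg_cong[OF qF[OF that], of "\<lambda>s. side s True"] q[of "Dom J u"] Fm[OF that] y that
          Comp_assoc_simp[of y "side (q (Dom J u)) True" "side (Fm u) True"] by simp
    qed (use y q in simp_all)
    note u = univ[OF this]
    have "x \<cdot> \<sigma> False = \<sigma> True \<cdot> y"
    proof -
      have 1: "P True j \<cdot> (x \<cdot> \<sigma> False) = side (q j) True \<cdot> y" if j: "j \<in> Obj J" for j
      proof -
        have "P True j \<cdot> (x \<cdot> \<sigma> False) = Fo j \<cdot> (P False j \<cdot> \<sigma> False)"
          using Comp_extend[OF xP[OF j], of "\<sigma> False"] x \<sigma>[of False] P[OF j, of True] P[OF j, of False] Fo[OF j] by simp
        then show ?thesis
          using \<sigma>q[OF j, of False] Arr_square[of "q j" C] q[OF j] by simp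
      qed
      have 2: "P True j \<cdot> (\<sigma> True \<cdot> y) = side (q j) True \<cdot> y" if j: "j \<in> Obj J" for j
        using Comp_extend[OF \<sigma>q[OF j, of True], of y] \<sigma>[of True] P[OF j, of True] y by simp
      have "x \<cdot> \<sigma> False \<in> hom C (Dom C y) (X True)" "\<sigma> True \<cdot> y \<in> hom C (Dom C y) (X True)"
        using x \<sigma>[of True] \<sigma>[of False] y by simp_all
      then show ?thesis
        using u 1 2 by blast
    qed
    then have s: "square y x \<sigma> \<in> hom (Arr C) y x"
      by (intro square_hom) (use x y \<sigma> vx in simp_all)
    show "\<exists>!h. h \<in> hom (Arr C) y x \<and> (\<forall>j\<in>Obj J. p j \<cdot>\<^bsub>Arr C\<^esub> h = q j)"
    proof (rule ex1I)
      have "p j \<cdot>\<^bsub>Arr C\<^esub> square y x \<sigma> = q j" if "j \<in> Obj J" for j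
        by (rule Arr_ext[of _ C y "Fo j"]) (use that p q s \<sigma>q in \<open>simp_all add: p_def\<close>)
      then show "square y x \<sigma> \<in> hom (Arr C) y x \<and> (\<forall>j\<in>Obj J. p j \<cdot>\<^bsub>Arr C\<^esub> square y x \<sigma> = q j)"
        using s by blast
      fix h
      assume h: "h \<in> hom (Arr C) y x \<and> (\<forall>j\<in>Obj J. p j \<cdot>\<^bsub>Arr C\<^esub> h = q j)"
      show "h = square y x \<sigma>"
      proof (rule Arr_ext[OF _ s])
        fix i
        have "P i j \<cdot> side h i = side (q j) i" if j: "j \<in> Obj J" for j
        proof -
          have "side (p j \<cdot>\<^bsub>Arr C\<^esub> h) i = side (q j) i"
            using h j by metis
          then show ?thesis
            by (simp add: p_def)
        qed
        moreover have "side h i \<in> hom C (vertex C y i) (X i)"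
          using h vx by auto
        ultimately show "side h i = side (square y x \<sigma>) i"
          using univ[OF cone, of i] \<sigma> \<sigma>q by (metis side_square)
      qed (use h in blast)
    qed
  qed
  then show ?thesis
    by blast
qed

lemma colimit_Arr:
  assumes J: "category J" and F: "is_functor J (Arr C) Fo Fm"
    and lim: "\<And>i. \<exists>x p. is_colimit J C (\<lambda>j. vertex C (Fo j) i) (\<lambda>u. side (Fm u) i) x p"
  shows "\<exists>x p. is_colimit J (Arr C) Fo Fm x p"
proof -
  interpret J: category J by (rule J)
  obtain X P where L: "\<And>i. is_colimit J C (\<lambda>j. vertex C (Fo j) i) (\<lambda>u. side (Fm u) i) (X i) (P i)"
    using lim by metis
  have X: "X i \<in> Obj C" and P: "j \<in> Obj J \<Longrightarrow> P i j \<in> hom C (vertex C (Fo j) i) (X i)"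
    and PF: "u \<in> Mor J \<Longrightarrow> P i (Cod J u) \<cdot> side (Fm u) i = P i (Dom J u)" for i j u
    using L[of i] unfolding is_colimit_def is_cocone_def by auto
  have univ: "is_cocone J C (\<lambda>j. vertex C (Fo j) i) (\<lambda>u. side (Fm u) i) y q
      \<Longrightarrow> \<exists>!h. h \<in> hom C (X i) y \<and> (\<forall>j \<in> Obj J. h \<cdot> P i j = q j)" for i y q
    using L[of i] unfolding is_colimit_def by blast
  have Fo: "j \<in> Obj J \<Longrightarrow> Fo j \<in> Mor C" and Fm: "u \<in> Mor J \<Longrightarrow> Fm u \<in> hom (Arr C) (Fo (Dom J u)) (Fo (Cod J u))" for j u
    using F unfolding is_functor_def by auto
  have "is_cocone J C (\<lambda>j. vertex C (Fo j) False) (\<lambda>u. side (Fm u) False) (X True) (\<lambda>j. P True j \<cdot> Fo j)"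
    unfolding is_cocone_def
  proof (intro conjI ballI)
    fix u
    assume u: "u \<in> Mor J"
    have "(P True (Cod J u) \<cdot> Fo (Cod J u)) \<cdot> side (Fm u) False
      = (P True (Cod J u) \<cdot> side (Fm u) True) \<cdot> Fo (Dom J u)"
      using Arr_square[of "Fm u" C] Fm[OF u] Fo P[of "Cod J u" True] u by simp
    then show "(P True (Cod J u) \<cdot> Fo (Cod J u)) \<cdot> side (Fm u) False = P True (Dom J u) \<cdot> Fo (Dom J u)"
      unfolding PF[OF u] .
  qed (use X P[of _ True] Fo in simp_all)
  from univ[OF this] obtain x where x: "x \<in> hom C (X False) (X True)"
    and xP: "\<And>j. j \<in> Obj J \<Longrightarrow> x \<cdot> P False j = P True j \<cdot> Fo j"
    by blast
  have vx: "vertex C x i = X i" for i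
    using x by (cases i) simp_all
  define p where "p j = square (Fo j) x (\<lambda>i. P i j)" for j
  have p: "p j \<in> hom (Arr C) (Fo j) x" if "j \<in> Obj J" for j
    unfolding p_def by (rule square_hom) (use x Fo P vx xP that in simp_all)
  have "is_colimit J (Arr C) Fo Fm x p"
    unfolding is_colimit_def
  proof (intro conjI allI impI)
    show "is_cocone J (Arr C) Fo Fm x p"
      unfolding is_cocone_def
    proof (intro conjI ballI)
      show "p (Cod J u) \<cdot>\<^bsub>Arr C\<^esub> Fm u = p (Dom J u)" if "u \<in> Mor J" for u
        by (rule Arr_ext[of _ C "Fo (Dom J u)" x])
          (use that p[of "Dom J u"] p[of "Cod J u"] Fm[OF that] PF[OF that] in \<open>simp_all add: p_def\<close>)
    qed (use x p in simp_all)
    fix y q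
    assume "is_cocone J (Arr C) Fo Fm y q"
    then have y: "y \<in> Mor C" and q: "\<And>j. j \<in> Obj J \<Longrightarrow> q j \<in> hom (Arr C) (Fo j) y"
      and qF: "\<And>u. u \<in> Mor J \<Longrightarrow> q (Cod J u) \<cdot>\<^bsub>Arr C\<^esub> Fm u = q (Dom J u)"
      unfolding is_cocone_def by auto
    have cocone: "is_cocone J C (\<lambda>j. vertex C (Fo j) i) (\<lambda>u. side (Fm u) i) (vertex C y i) (\<lambda>j. side (q j) i)" for i
      unfolding is_cocone_def using y q arg_cong[OF qF, of _ "\<lambda>s. side s i"] by simp
    have "\<exists>h. h \<in> hom C (X i) (vertex C y i) \<and> (\<forall>j \<in> Obj J. h \<cdot> P i j = side (q j) i)" for i
      by (rule ex1_implies_ex[OF univ[OF cocone]])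
    then obtain \<sigma> where \<sigma>: "\<And>i. \<sigma> i \<in> hom C (X i) (vertex C y i)"
      and \<sigma>q: "\<And>i j. j \<in> Obj J \<Longrightarrow> \<sigma> i \<cdot> P i j = side (q j) i"
      by metis
    have "is_cocone J C (\<lambda>j. vertex C (Fo j) False) (\<lambda>u. side (Fm u) False) (Cod C y) (\<lambda>j. y \<cdot> side (q j) False)"
      unfolding is_cocone_def
    proof (intro conjI ballI)
      show "(y \<cdot> side (q (Cod J u)) False) \<cdot> side (Fm u) False = y \<cdot> side (q (Dom J u)) False" if "u \<in> Mor J" for u
        using arg_cong[OF qF[OF that], of "\<lambda>s. side s False"] q[of "Cod J u"] Fm[OF that] y that by simp
    qed (use y q in simp_all)
    note u = univ[OF this]
    have "y \<cdot> \<sigma> False = \<sigma> True \<cdot> x"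
    proof -
      have 1: "(\<sigma> True \<cdot> x) \<cdot> P False j = y \<cdot> side (q j) False" if j: "j \<in> Obj J" for j
      proof -
        have "(\<sigma> True \<cdot> x) \<cdot> P False j = (\<sigma> True \<cdot> P True j) \<cdot> Fo j"
          using xP[OF j] x \<sigma>[of True] P[OF j, of True] P[OF j, of False] Fo[OF j] by simp
        then show ?thesis
          using \<sigma>q[OF j, of True] Arr_square[of "q j" C] q[OF j] by simp
      qed
      have 2: "(y \<cdot> \<sigma> False) \<cdot> P False j = y \<cdot> side (q j) False" if j: "j \<in> Obj J" for j
        using \<sigma>q[OF j, of False] \<sigma>[of False] P[OF j, of False] y by simp
      have "y \<cdot> \<sigma> False \<in> hom C (X False) (Cod C y)" "\<sigma> True \<cdot> x \<in> hom C (X False) (Cod C y)"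
        using x \<sigma>[of True] \<sigma>[of False] y by simp_all
      then show ?thesis
        using u 1 2 by blast
    qed
    then have s: "square x y \<sigma> \<in> hom (Arr C) x y"
      by (intro square_hom) (use x y \<sigma> vx in simp_all)
    show "\<exists>!h. h \<in> hom (Arr C) x y \<and> (\<forall>j\<in>Obj J. h \<cdot>\<^bsub>Arr C\<^esub> p j = q j)"
    proof (rule ex1I)
      have "square x y \<sigma> \<cdot>\<^bsub>Arr C\<^esub> p j = q j" if "j \<in> Obj J" for j
        by (rule Arr_ext[of _ C "Fo j" y]) (use that p q s \<sigma>q in \<open>simp_all add: p_def\<close>)
      then show "square x y \<sigma> \<in> hom (Arr C) x y \<and> (\<forall>j\<in>Obj J. square x y \<sigma> \<cdot>\<^bsub>Arr C\<^esub> p j = q j)"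
        using s by blast
      fix h
      assume h: "h \<in> hom (Arr C) x y \<and> (\<forall>j\<in>Obj J. h \<cdot>\<^bsub>Arr C\<^esub> p j = q j)"
      show "h = square x y \<sigma>"
      proof (rule Arr_ext[OF _ s])
        fix i
        have "side h i \<cdot> P i j = side (q j) i" if j: "j \<in> Obj J" for j
        proof -
          have "side (h \<cdot>\<^bsub>Arr C\<^esub> p j) i = side (q j) i"
            using h j by metis
          then show ?thesis
            by (simp add: p_def)
        qed
        moreover have "side h i \<in> hom C (X i) (vertex C y i)"
          using h vx by auto
        ultimately show "side h i = side (square x y \<sigma>) i"
          using univ[OF cocone, of i] \<sigma> \<sigma>q by (metis side_square)
      qed (use h in blast)
    qed
  qed
  then show ?thesis
    by blast
qed

lemma bicomplete_Arr:
  fixes \<kappa> :: "'s rel"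
  assumes "bicomplete \<kappa> C"
  shows "bicomplete \<kappa> (Arr C)"
  unfolding bicomplete_def
proof (intro allI impI)
  fix J :: "('s, 's) cat" and Fo Fm
  assume J: "category J \<and> |Mor J| <o \<kappa> \<and> is_functor J (Arr C) Fo Fm"
  then have "(\<exists>x p. is_limit J C (\<lambda>j. vertex C (Fo j) i) (\<lambda>u. side (Fm u) i) x p) \<and>
      (\<exists>x p. is_colimit J C (\<lambda>j. vertex C (Fo j) i) (\<lambda>u. side (Fm u) i) x p)" for i
    using side_functor[of J Fo Fm i]
    by (intro assms[unfolded bicomplete_def, rule_format, of J "\<lambda>j. vertex C (Fo j) i" "\<lambda>u. side (Fm u) i"]) blast
  then show "(\<exists>x p. is_limit J (Arr C) Fo Fm x p) \<and> (\<exists>x p. is_colimit J (Arr C) Fo Fm x p)"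
    using J limit_Arr[of J Fo Fm] colimit_Arr[of J Fo Fm] by blast
qed

section \<open>The projective model structure on arrows\<close>

text \<open>
  Let \<open>s\<close> be a square from \<open>f\<close> to \<open>f'\<close> with components \<open>s\<^sub>0\<close> and \<open>s\<^sub>1\<close>.  Then \<open>i\<close> and \<open>j\<close> are coprojections
  of a pushout of \<open>f\<close> and \<open>s\<^sub>0\<close>, and the corner map \<open>c\<close> compares this pushout with the codomain of \<open>f'\<close>.
\<close>

definition corner :: "('o, 'm) cell \<Rightarrow> ('o, 'm) cell \<Rightarrow> ('o, 'm) cell \<Rightarrow> ('o, 'm) cell \<Rightarrow> bool" where
  "corner s i j c \<longleftrightarrow> is_pushout C (Dom (Arr C) s) (side s False) i j \<and>
     c \<in> hom C (Cod C j) (Cod C (Cod (Arr C) s)) \<and> c \<cdot> i = side s True \<and> c \<cdot> j = Cod (Arr C) s"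

lemma corner_exists:
  assumes s: "s \<in> Mor (Arr C)"
  shows "\<exists>i j c. corner s i j c"
proof -
  obtain i j where ij: "is_pushout C (Dom (Arr C) s) (side s False) i j"
    using pushout_exists[of "Dom (Arr C) s" "side s False"] s by auto
  obtain c where "c \<in> hom C (Cod C j) (Cod C (Cod (Arr C) s))" "c \<cdot> i = side s True" "c \<cdot> j = Cod (Arr C) s"
    by (rule is_pushout_exists[OF ij, of "side s True" "Cod C (Cod (Arr C) s)" "Cod (Arr C) s"])
      (use s Arr_square[OF s] in simp_all)
  then show ?thesis
    unfolding corner_def using ij by blast
qed

text \<open>
  A lift \<open>x\<close> on domains prescribes the lift on codomains along the whole domain of the corner map;
  a lift of the corner map then completes it.
\<close>

lemma lifts_if_corner_lifts:
  assumes s: "s \<in> Mor (Arr C)" and p: "p \<in> Mor (Arr C)" and c: "corner s i j c"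
    and l0: "lifts C (side s False) (side p False)" and l1: "lifts C c (side p True)"
  shows "lifts (Arr C) s p"
  unfolding lifts_def
proof (intro ballI impI)
  fix u v
  assume u: "u \<in> hom (Arr C) (Dom (Arr C) s) (Dom (Arr C) p)"
    and v: "v \<in> hom (Arr C) (Cod (Arr C) s) (Cod (Arr C) p)"
    and e: "p \<cdot>\<^bsub>Arr C\<^esub> u = v \<cdot>\<^bsub>Arr C\<^esub> s"
  let ?f = "Dom (Arr C) s" and ?f' = "Cod (Arr C) s" and ?z = "Dom (Arr C) p" and ?w = "Cod (Arr C) p"
  have ei: "side p i \<cdot> side u i = side v i \<cdot> side s i" for i
    using arg_cong[OF e, of "\<lambda>s. side s i"] by simp
  have po: "is_pushout C ?f (side s False) i j"
    and cc: "c \<in> hom C (Cod C j) (Cod C ?f')" "c \<cdot> i = side s True" "c \<cdot> j = ?f'"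
    using c unfolding corner_def by auto
  note t = is_pushout_typing[OF po]
  obtain x where x: "x \<in> hom C (Dom C ?f') (Dom C ?z)" "x \<cdot> side s False = side u False"
    "side p False \<cdot> x = side v False"
    by (rule liftsE[OF l0 _ _ ei]) (use u v s p in simp_all)
  have "side u True \<cdot> ?f = (?z \<cdot> x) \<cdot> side s False"
    using Arr_square[of u C] u s p x by simp
  then obtain d where d: "d \<in> hom C (Cod C j) (Cod C ?z)" "d \<cdot> i = side u True" "d \<cdot> j = ?z \<cdot> x"
    by (rule is_pushout_exists[OF po, rotated 2]) (use u s p x in simp_all)
  have "side p True \<cdot> d = side v True \<cdot> c"
  proof (rule is_pushout_unique[OF po, of _ "Cod C ?w"])
    show "(side p True \<cdot> d) \<cdot> i = (side v True \<cdot> c) \<cdot> i"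
      using d cc t p v ei[of True] by simp
    have "(side p True \<cdot> d) \<cdot> j = (side p True \<cdot> ?z) \<cdot> x"
      using d t p x by simp
    also have "\<dots> = ?w \<cdot> side v False"
      unfolding Arr_square[OF p, symmetric] using p x by simp
    also have "\<dots> = (side v True \<cdot> c) \<cdot> j"
      using Arr_square[of v C] v cc t by simp
    finally show "(side p True \<cdot> d) \<cdot> j = (side v True \<cdot> c) \<cdot> j" .
  qed (use d cc t p v in simp_all)
  then obtain y where y: "y \<in> hom C (Cod C ?f') (Cod C ?z)" "y \<cdot> c = d" "side p True \<cdot> y = side v True"
    by (rule liftsE[OF l1, rotated 2]) (use d cc p v in simp_all)
  have "y \<cdot> ?f' = y \<cdot> (c \<cdot> j)"
    unfolding cc(3) ..
  also have "\<dots> = ?z \<cdot> x"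
    using Comp_extend[OF y(2), of j] y(1) cc t d by simp
  finally have l: "square ?f' ?z (\<lambda>i. if i then y else x) \<in> hom (Arr C) ?f' ?z" (is "?l \<in> _")
    by (intro square_hom) (use x y s p in simp_all)
  have ys: "y \<cdot> side s True = side u True"
    unfolding cc(2)[symmetric] using Comp_extend[OF y(2), of i] y(1) cc(1) t d by simp
  have "?l \<cdot>\<^bsub>Arr C\<^esub> s = u"
  proof (rule Arr_ext[of _ C ?f ?z])
    show "side (?l \<cdot>\<^bsub>Arr C\<^esub> s) k = side u k" for k
      using x(2) ys by (cases k) simp_all
  qed (use l s u in simp_all)
  moreover have "p \<cdot>\<^bsub>Arr C\<^esub> ?l = v"
  proof (rule Arr_ext[of _ C ?f' ?w])
    show "side (p \<cdot>\<^bsub>Arr C\<^esub> ?l) k = side v k" for k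
      using x(3) y(3) by (cases k) simp_all
  qed (use l p v in simp_all)
  ultimately show "\<exists>l\<in>hom (Arr C) ?f' ?z. l \<cdot>\<^bsub>Arr C\<^esub> s = u \<and> p \<cdot>\<^bsub>Arr C\<^esub> l = v"
    using l by blast
qed

text \<open>
  The converse tests \<open>s\<close> against the values at \<open>p\<close> of two right adjoints: the square with components
  \<open>p\<close> and the identity of a terminal object, for the component of \<open>s\<close> on domains, and the square
  from \<open>id\<close> to \<open>p\<close> with components \<open>id\<close> and \<open>p\<close>, for the corner map.
\<close>

lemma side_lifts:
  assumes s: "s \<in> Mor (Arr C)" and p: "p \<in> Mor C"
    and l: "\<And>q. q \<in> Mor (Arr C) \<Longrightarrow> side q False = p \<Longrightarrow> (\<exists>t \<in> Obj C. side q True = Ide C t) \<Longrightarrow> lifts (Arr C) s q"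
  shows "lifts C (side s False) p"
  unfolding lifts_def
proof (intro ballI impI)
  let ?f = "Dom (Arr C) s" and ?f' = "Cod (Arr C) s"
  fix u v
  assume u: "u \<in> hom C (Dom C (side s False)) (Dom C p)" and v: "v \<in> hom C (Cod C (side s False)) (Cod C p)"
    and e: "p \<cdot> u = v \<cdot> side s False"
  obtain t where t: "t \<in> Obj C" "\<And>x. x \<in> Obj C \<Longrightarrow> \<exists>!h. h \<in> hom C x t"
    using terminal_exists by blast
  have ext: "h = h'" if "h \<in> Mor C" "h' \<in> Mor C" "Dom C h = Dom C h'" "Cod C h = t" "Cod C h' = t" for h h'
    using t(2)[of "Dom C h"] that by (metis Dom_Cod_Obj(1) hom_iff)
  have "\<exists>b. b \<in> hom C x t" if "x \<in> Obj C" for x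
    using t(2)[OF that] by blast
  then obtain b where b: "\<And>x. x \<in> Obj C \<Longrightarrow> b x \<in> hom C x t"
    by metis
  let ?z = "b (Dom C p)" and ?w = "b (Cod C p)"
  have z: "?z \<in> hom C (Dom C p) t" and w: "?w \<in> hom C (Cod C p) t"
    using b p by simp_all
  have q: "square ?z ?w (\<lambda>i. if i then Ide C t else p) \<in> hom (Arr C) ?z ?w" (is "?q \<in> _")
    by (rule square_hom) (use z w p t(1) in \<open>auto intro: ext\<close>)
  have U: "square ?f ?z (\<lambda>i. if i then b (Cod C ?f) else u) \<in> hom (Arr C) ?f ?z" (is "?u \<in> _")
    by (rule square_hom) (use z u s b[of "Cod C ?f"] in \<open>auto intro: ext\<close>)
  have V: "square ?f' ?w (\<lambda>i. if i then b (Cod C ?f') else v) \<in> hom (Arr C) ?f' ?w" (is "?v \<in> _")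
    by (rule square_hom) (use w v s b[of "Cod C ?f'"] in \<open>auto intro: ext\<close>)
  have sq: "?q \<cdot>\<^bsub>Arr C\<^esub> ?u = ?v \<cdot>\<^bsub>Arr C\<^esub> s"
  proof (rule Arr_ext[of _ C ?f ?w])
    show "side (?q \<cdot>\<^bsub>Arr C\<^esub> ?u) i = side (?v \<cdot>\<^bsub>Arr C\<^esub> s) i" for i
      using e s b[of "Cod C ?f"] b[of "Cod C ?f'"] t(1) by (cases i) (auto intro: ext)
  qed (use q U V s in simp_all)
  have "lifts (Arr C) s ?q"
    by (rule l) (use q t(1) in auto)
  then obtain k where k: "k \<in> hom (Arr C) ?f' ?z" "k \<cdot>\<^bsub>Arr C\<^esub> s = ?u" "?q \<cdot>\<^bsub>Arr C\<^esub> k = ?v"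
    using A.liftsE[OF _ _ _ sq] q U V by auto
  have "side k False \<cdot> side s False = u" "p \<cdot> side k False = v"
    using arg_cong[OF k(2), of "\<lambda>s. side s False"] arg_cong[OF k(3), of "\<lambda>s. side s False"] by simp_all
  then show "\<exists>l\<in>hom C (Cod C (side s False)) (Dom C p). l \<cdot> side s False = u \<and> p \<cdot> l = v"
    using k(1) z s by (intro bexI[of _ "side k False"]) auto
qed

lemma corner_lifts:
  assumes s: "s \<in> Mor (Arr C)" and p: "p \<in> Mor C" and c: "corner s i j c"
    and l: "\<And>q. q \<in> Mor (Arr C) \<Longrightarrow> side q True = p \<Longrightarrow> side q False = Ide C (Dom C p) \<Longrightarrow> lifts (Arr C) s q"
  shows "lifts C c p"
  unfolding lifts_def
proof (intro ballI impI)
  let ?f = "Dom (Arr C) s" and ?f' = "Cod (Arr C) s" and ?I = "Ide C (Dom C p)"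
  have po: "is_pushout C ?f (side s False) i j"
    and cc: "c \<in> hom C (Cod C j) (Cod C ?f')" "c \<cdot> i = side s True" "c \<cdot> j = ?f'"
    using c unfolding corner_def by auto
  note t = is_pushout_typing[OF po]
  fix u v
  assume u: "u \<in> hom C (Dom C c) (Dom C p)" and v: "v \<in> hom C (Cod C c) (Cod C p)" and e: "p \<cdot> u = v \<cdot> c"
  have pi: "p \<cdot> (u \<cdot> i) = v \<cdot> side s True" and pj: "p \<cdot> (u \<cdot> j) = v \<cdot> ?f'"
    unfolding cc(2,3)[symmetric] using Comp_extend[OF e, of i] Comp_extend[OF e, of j] u v p cc(1) t by simp_all
  have q: "square ?I p (\<lambda>i. if i then p else ?I) \<in> hom (Arr C) ?I p" (is "?q \<in> _")
    by (rule square_hom) (use p in \<open>auto split: if_splits\<close>)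
  have U: "square ?f ?I (\<lambda>k. if k then u \<cdot> i else u \<cdot> i \<cdot> ?f) \<in> hom (Arr C) ?f ?I" (is "?u \<in> _")
    by (rule square_hom) (use u s t cc(1) p in auto)
  have V: "square ?f' p (\<lambda>k. if k then v else u \<cdot> j) \<in> hom (Arr C) ?f' p" (is "?v \<in> _")
    by (rule square_hom) (use u v s t cc(1) p pj in auto)
  have sq: "?q \<cdot>\<^bsub>Arr C\<^esub> ?u = ?v \<cdot>\<^bsub>Arr C\<^esub> s"
  proof (rule Arr_ext[of _ C ?f p])
    show "side (?q \<cdot>\<^bsub>Arr C\<^esub> ?u) k = side (?v \<cdot>\<^bsub>Arr C\<^esub> s) k" for k
      using pi u s t cc(1) p by (cases k) auto
  qed (use q U V s in simp_all)
  have "lifts (Arr C) s ?q"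
    by (rule l) (use q in auto)
  then obtain k where k: "k \<in> hom (Arr C) ?f' ?I" "k \<cdot>\<^bsub>Arr C\<^esub> s = ?u" "?q \<cdot>\<^bsub>Arr C\<^esub> k = ?v"
    using A.liftsE[OF _ _ _ sq] q U V by auto
  have kT: "side k True \<in> hom C (Cod C ?f') (Dom C p)"
    using k(1) p by auto
  have k1: "side k True \<cdot> side s True = u \<cdot> i" "p \<cdot> side k True = v"
    using arg_cong[OF k(2), of "\<lambda>s. side s True"] arg_cong[OF k(3), of "\<lambda>s. side s True"] by simp_all
  have k0: "side k True \<cdot> ?f' = u \<cdot> j"
    using arg_cong[OF k(3), of "\<lambda>s. side s False"] Arr_square[of k C] k(1) p u cc(1) t by simp
  have "side k True \<cdot> c = u"
    by (rule is_pushout_unique[OF po, of _ "Dom C p"]) (use kT k1 k0 cc t u in simp_all)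
  then show "\<exists>l\<in>hom C (Cod C c) (Dom C p). l \<cdot> c = u \<and> p \<cdot> l = v"
    using kT k1 cc(1) by (intro bexI[of _ "side k True"]) auto
qed

text \<open>
  Factoring the component on domains leaves a corner map; factoring that one gives the component on
  codomains, and makes the corner map of the left factor a member of \<open>L\<close>.
\<close>

lemma factor_Arr:
  assumes fac: "\<And>f. f \<in> Mor C \<Longrightarrow> \<exists>i \<in> L. \<exists>p \<in> R. Cod C i = Dom C p \<and> f = p \<cdot> i"
    and LR: "L \<subseteq> Mor C" "R \<subseteq> Mor C" and s: "s \<in> Mor (Arr C)"
  shows "\<exists>t q. t \<in> Mor (Arr C) \<and> q \<in> Mor (Arr C) \<and> Cod (Arr C) t = Dom (Arr C) q \<and> s = q \<cdot>\<^bsub>Arr C\<^esub> t \<and>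
    (\<forall>k. side q k \<in> R) \<and> side t False \<in> L \<and> (\<exists>i j c. corner t i j c \<and> c \<in> L)"
proof -
  let ?f = "Dom (Arr C) s" and ?f' = "Cod (Arr C) s"
  obtain i0 p0 where i0: "i0 \<in> L" "p0 \<in> R" "Cod C i0 = Dom C p0" "side s False = p0 \<cdot> i0"
    using fac[of "side s False"] s by auto
  have M0: "i0 \<in> Mor C" "p0 \<in> Mor C"
    using i0 LR by auto
  have d0: "Dom C i0 = Dom C ?f" "Cod C p0 = Dom C ?f'"
    using Arr_typing(4,5)[OF s, of False] i0(3) M0 unfolding i0(4) by simp_all
  obtain i j where po: "is_pushout C ?f i0 i j"
    using pushout_exists[of ?f i0] s M0 d0 by auto
  note t = is_pushout_typing[OF po]
  have "side s True \<cdot> ?f = (?f' \<cdot> p0) \<cdot> i0"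
    using Arr_square[OF s] i0(3) M0 d0 s unfolding i0(4) by simp
  then obtain k where k: "k \<in> hom C (Cod C j) (Cod C ?f')" "k \<cdot> i = side s True" "k \<cdot> j = ?f' \<cdot> p0"
    by (rule is_pushout_exists[OF po, rotated 2]) (use s M0 i0(3) d0 in simp_all)
  obtain c p1 where c: "c \<in> L" "p1 \<in> R" "Cod C c = Dom C p1" "k = p1 \<cdot> c"
    using fac[of k] k by auto
  have M1: "c \<in> Mor C" "p1 \<in> Mor C"
    using c LR by auto
  have d1: "Dom C c = Cod C j" "Cod C p1 = Cod C ?f'"
    using k(1) c(3) M1 unfolding c(4) by simp_all
  have k': "p1 \<cdot> (c \<cdot> i) = side s True" "p1 \<cdot> (c \<cdot> j) = ?f' \<cdot> p0"
    using k(2,3) c(3) M1 d1 t unfolding c(4) by simp_all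
  let ?z = "c \<cdot> j"
  have T: "square ?f ?z (\<lambda>k. if k then c \<cdot> i else i0) \<in> hom (Arr C) ?f ?z" (is "?t \<in> _")
    by (rule square_hom) (use t s M0 M1 d0 d1 in auto)
  have Q: "square ?z ?f' (\<lambda>k. if k then p1 else p0) \<in> hom (Arr C) ?z ?f'" (is "?q \<in> _")
    by (rule square_hom) (use t s M0 M1 d0 d1 i0(3) c(3) k' in auto)
  have "s = ?q \<cdot>\<^bsub>Arr C\<^esub> ?t"
  proof (rule Arr_ext[of _ C ?f ?f'])
    show "side s k = side (?q \<cdot>\<^bsub>Arr C\<^esub> ?t) k" for k
      using i0(4) k'(1) by (cases k) simp_all
  qed (use T Q s in simp_all)
  moreover have "corner ?t i j c"
    unfolding corner_def using T po t M1 d1 by simp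
  ultimately show ?thesis
    using T Q i0 c by (intro exI[of _ ?t] exI[of _ ?q]) auto
qed

lemma retract_side:
  assumes r: "is_retract (Arr C) f g" and "f \<in> Mor (Arr C)" "g \<in> Mor (Arr C)"
  shows "is_retract C (side f i) (side g i)"
proof -
  obtain s r s' r' where s: "s \<in> hom (Arr C) (Dom (Arr C) f) (Dom (Arr C) g)" "r \<in> hom (Arr C) (Dom (Arr C) g) (Dom (Arr C) f)"
    "s' \<in> hom (Arr C) (Cod (Arr C) f) (Cod (Arr C) g)" "r' \<in> hom (Arr C) (Cod (Arr C) g) (Cod (Arr C) f)"
    and e: "r \<cdot>\<^bsub>Arr C\<^esub> s = Ide (Arr C) (Dom (Arr C) f)" "r' \<cdot>\<^bsub>Arr C\<^esub> s' = Ide (Arr C) (Cod (Arr C) f)"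
      "g \<cdot>\<^bsub>Arr C\<^esub> s = s' \<cdot>\<^bsub>Arr C\<^esub> f" "f \<cdot>\<^bsub>Arr C\<^esub> r = r' \<cdot>\<^bsub>Arr C\<^esub> g"
    using r unfolding is_retract_def by blast
  note ei = e[THEN arg_cong[where f = "\<lambda>s. side s i"]]
  show ?thesis
    unfolding is_retract_def
    by (rule bexI[of _ "side s i"], rule bexI[of _ "side r i"], rule bexI[of _ "side s' i"],
        rule bexI[of _ "side r' i"]) (use s ei assms(2,3) in simp_all)
qed

end

definition arr_model :: "('o, 'm) cell_smcat \<Rightarrow> ('o, 'm) cell model_structure \<Rightarrow> ('o, 'm) cell model_structure" where
  "arr_model C S =
     (let W = {s \<in> Mor (Arr C). \<forall>i. side s i \<in> Weq S}; F = {s \<in> Mor (Arr C). \<forall>i. side s i \<in> Fib S}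
      in \<lparr>Weq = W, Cofib = {s \<in> Mor (Arr C). \<forall>p \<in> F \<inter> W. lifts (Arr C) s p}, Fib = F\<rparr>)"

lemma arr_model_sel:
  "s \<in> Weq (arr_model C S) \<longleftrightarrow> s \<in> Mor (Arr C) \<and> (\<forall>i. side s i \<in> Weq S)"
  "s \<in> Fib (arr_model C S) \<longleftrightarrow> s \<in> Mor (Arr C) \<and> (\<forall>i. side s i \<in> Fib S)"
  "s \<in> Cofib (arr_model C S) \<longleftrightarrow>
    s \<in> Mor (Arr C) \<and> (\<forall>p \<in> Fib (arr_model C S) \<inter> Weq (arr_model C S). lifts (Arr C) s p)"
  by (auto simp: arr_model_def Let_def)

locale cell_model = cell_smcc C + model_category \<kappa> C S
  for \<kappa> :: "'s rel" and C :: "('o, 'm) cell_smcat" (structure) and S :: "('o, 'm) cell model_structure"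
begin

interpretation A: category "Arr C"
  by (rule category_Arr)

text \<open>
  The squares used as tests by \<open>side_lifts\<close> and \<open>corner_lifts\<close> have identities besides \<open>p\<close>, hence are
  trivial fibrations when \<open>p\<close> is.
\<close>

lemma arr_cofib_iff:
  assumes s: "s \<in> Mor (Arr C)" and c: "corner s i j c"
  shows "s \<in> Cofib (arr_model C S) \<longleftrightarrow> side s False \<in> Cofib S \<and> c \<in> Cofib S"
proof
  assume s': "s \<in> Cofib (arr_model C S)"
  have c': "c \<in> Mor C"
    using c unfolding corner_def by auto
  have l: "lifts (Arr C) s q"
    if "q \<in> Mor (Arr C)" "side q False \<in> Fib S \<inter> Weq S" "side q True \<in> Fib S \<inter> Weq S" for q
  proof -
    have "side q i \<in> Fib S \<inter> Weq S" for i
      using that(2,3) by (cases i) auto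
    then show ?thesis
      using s' that(1) unfolding arr_model_sel(3) by (simp add: arr_model_sel)
  qed
  have "lifts C (side s False) p \<and> lifts C c p" if p: "p \<in> Fib S \<inter> Weq S" for p
  proof
    show "lifts C (side s False) p"
      by (rule side_lifts[OF s]) (use p l Ide_Fib Ide_Weq in auto)
    show "lifts C c p"
      by (rule corner_lifts[OF s _ c]) (use p l Ide_Fib Ide_Weq in auto)
  qed
  then show "side s False \<in> Cofib S \<and> c \<in> Cofib S"
    using s c' by (simp add: Cofib_iff_lifts)
next
  assume "side s False \<in> Cofib S \<and> c \<in> Cofib S"
  then have "lifts (Arr C) s p" if "p \<in> Fib (arr_model C S) \<inter> Weq (arr_model C S)" for p
    using that by (intro lifts_if_corner_lifts[OF s _ c] lift_cofib) (auto simp: arr_model_sel)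
  then show "s \<in> Cofib (arr_model C S)"
    using s unfolding arr_model_sel(3) by blast
qed

text \<open>\<open>i\<close> is the cobase change of \<open>side s False\<close> along the domain of \<open>s\<close>.\<close>

lemma corner_trivial_cofib:
  assumes s: "s \<in> Mor (Arr C)" and c: "corner s i j c"
    and t: "side s False \<in> Cofib S \<inter> Weq S"
  shows "i \<in> Cofib S \<inter> Weq S"
proof -
  have po: "is_pushout C (side s False) (Dom (Arr C) s) j i"
    using c is_pushout_sym unfolding corner_def by blast
  have "i \<in> Mor C"
    using is_pushout_typing[OF po] by simp
  moreover have "lifts C i p" if "p \<in> Fib S" for p
    by (rule lifts_pushout[OF po]) (use t that lift_fib in auto)
  ultimately show ?thesis
    using trivial_Cofib_iff_lifts by blast
qed

text \<open>\<open>side s True\<close> is the corner map after the cobase change \<open>i\<close> of \<open>side s False\<close>.\<close>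

lemma corner_cofib:
  assumes s: "s \<in> Mor (Arr C)" and c: "corner s i j c"
    and t: "side s False \<in> Cofib S" "c \<in> Cofib S"
  shows "side s True \<in> Cofib S"
proof -
  have po: "is_pushout C (side s False) (Dom (Arr C) s) j i"
    using c is_pushout_sym unfolding corner_def by blast
  note T = is_pushout_typing[OF po]
  have e: "c \<cdot> i = side s True" "Dom C c = Cod C i"
    using c T unfolding corner_def by auto
  have "lifts C (c \<cdot> i) p" if "p \<in> Fib S \<inter> Weq S" for p
    by (rule lifts_Comp[OF _ _ _ _ lifts_pushout[OF po]]) (use t that lift_cofib T e in auto)
  then show ?thesis
    using s unfolding Cofib_iff_lifts e by simp
qed

text \<open>
  Given the previous characterisation, this is two-out-of-three for \<open>side s True = c \<cdot> i\<close>, where \<open>i\<close> is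
  a trivial cofibration.
\<close>

lemma arr_trivial_cofib_iff:
  assumes s: "s \<in> Mor (Arr C)" and c: "corner s i j c"
  shows "s \<in> Cofib (arr_model C S) \<inter> Weq (arr_model C S) \<longleftrightarrow>
    side s False \<in> Cofib S \<inter> Weq S \<and> c \<in> Cofib S \<inter> Weq S"
proof -
  have po: "is_pushout C (side s False) (Dom (Arr C) s) j i"
    using c is_pushout_sym unfolding corner_def by blast
  note T = is_pushout_typing[OF po]
  have e: "c \<cdot> i = side s True" "i \<in> hom C (Dom C i) (Cod C i)" "c \<in> hom C (Cod C i) (Cod C c)"
    using c T unfolding corner_def by auto
  have "(\<forall>k. side s k \<in> Weq S) \<longleftrightarrow> c \<in> Weq S" if "side s False \<in> Cofib S \<inter> Weq S"
  proof -
    have "i \<in> Weq S"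
      using corner_trivial_cofib[OF s c that] by blast
    then have "side s True \<in> Weq S \<longleftrightarrow> c \<in> Weq S"
      using two_of_three[OF e(2,3)] unfolding e(1) by blast
    then show ?thesis
      using that by (metis (full_types) IntE)
  qed
  then show ?thesis
    using arr_cofib_iff[OF s c] s by (auto simp: arr_model_sel)
qed

lemma model_category_Arr: "model_category \<kappa> (Arr C) (arr_model C S)"
proof unfold_locales
  show "bicomplete \<kappa> (Arr C)"
    by (rule bicomplete_Arr[OF bicomplete])
  show "Weq (arr_model C S) \<subseteq> Mor (Arr C)" "Cofib (arr_model C S) \<subseteq> Mor (Arr C)" "Fib (arr_model C S) \<subseteq> Mor (Arr C)"
    by (auto simp: arr_model_sel)
next
  fix f g x y z
  assume f: "f \<in> hom (Arr C) x y" and g: "g \<in> hom (Arr C) y z"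
  have "side f i \<in> hom C (vertex C x i) (vertex C y i)" "side g i \<in> hom C (vertex C y i) (vertex C z i)" for i
    using f g by auto
  note t = two_of_three[OF this]
  show "(f \<in> Weq (arr_model C S) \<and> g \<in> Weq (arr_model C S) \<longrightarrow> g \<cdot>\<^bsub>Arr C\<^esub> f \<in> Weq (arr_model C S)) \<and>
    (f \<in> Weq (arr_model C S) \<and> g \<cdot>\<^bsub>Arr C\<^esub> f \<in> Weq (arr_model C S) \<longrightarrow> g \<in> Weq (arr_model C S)) \<and>
    (g \<in> Weq (arr_model C S) \<and> g \<cdot>\<^bsub>Arr C\<^esub> f \<in> Weq (arr_model C S) \<longrightarrow> f \<in> Weq (arr_model C S))"
    using t f g A.Comp_hom[OF f g] unfolding arr_model_sel side_Comp hom_iff by blast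
next
  show "retract_closed (Arr C) (Weq (arr_model C S))"
    unfolding retract_closed_def
  proof (intro ballI impI)
    fix g f
    assume g: "g \<in> Weq (arr_model C S)" and f: "f \<in> Mor (Arr C)" and r: "is_retract (Arr C) f g"
    have "g \<in> Mor (Arr C)"
      using g arr_model_sel(1) by blast
    from retract_side[OF r f this] have "side f i \<in> Weq S" for i
      using retracts(1) Arr_typing(3)[OF f] g unfolding retract_closed_def arr_model_sel(1) by blast
    then show "f \<in> Weq (arr_model C S)"
      using f arr_model_sel(1) by blast
  qed
  show "retract_closed (Arr C) (Fib (arr_model C S))"
    unfolding retract_closed_def
  proof (intro ballI impI)
    fix g f
    assume g: "g \<in> Fib (arr_model C S)" and f: "f \<in> Mor (Arr C)" and r: "is_retract (Arr C) f g"
    have "g \<in> Mor (Arr C)"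
      using g arr_model_sel(2) by blast
    from retract_side[OF r f this] have "side f i \<in> Fib S" for i
      using retracts(3) Arr_typing(3)[OF f] g unfolding retract_closed_def arr_model_sel(2) by blast
    then show "f \<in> Fib (arr_model C S)"
      using f arr_model_sel(2) by blast
  qed
  have eq: "Cofib (arr_model C S)
    = {s \<in> Mor (Arr C). \<forall>p \<in> Fib (arr_model C S) \<inter> Weq (arr_model C S). lifts (Arr C) s p}"
    using arr_model_sel(3) by blast
  have "Fib (arr_model C S) \<inter> Weq (arr_model C S) \<subseteq> Mor (Arr C)"
    using arr_model_sel(2) by blast
  then show "retract_closed (Arr C) (Cofib (arr_model C S))"
    unfolding eq by (rule A.retract_closed_lifts)
next
  fix i p
  show "lifts (Arr C) i p" if "i \<in> Cofib (arr_model C S)" "p \<in> Fib (arr_model C S) \<inter> Weq (arr_model C S)"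
    using that unfolding arr_model_sel(3) by blast
  assume i: "i \<in> Cofib (arr_model C S) \<inter> Weq (arr_model C S)" and p: "p \<in> Fib (arr_model C S)"
  then have iM: "i \<in> Mor (Arr C)" and pM: "p \<in> Mor (Arr C)"
    by (auto simp: arr_model_sel)
  obtain a b c where c: "corner i a b c"
    using corner_exists[OF iM] by blast
  have t: "side i False \<in> Cofib S \<inter> Weq S \<and> c \<in> Cofib S \<inter> Weq S"
    using i arr_trivial_cofib_iff[OF iM c] by blast
  show "lifts (Arr C) i p"
    by (rule lifts_if_corner_lifts[OF iM pM c]; rule lift_fib) (use t p in \<open>auto simp: arr_model_sel\<close>)
next
  fix f
  assume f: "f \<in> Mor (Arr C)"
  obtain t q where t: "t \<in> Mor (Arr C)" and q: "q \<in> Mor (Arr C)" "Cod (Arr C) t = Dom (Arr C) q" "f = q \<cdot>\<^bsub>Arr C\<^esub> t"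
    "\<forall>k. side q k \<in> Fib S \<inter> Weq S" and c: "side t False \<in> Cofib S" "\<exists>i j c. corner t i j c \<and> c \<in> Cofib S"
    using factor_Arr[of "Cofib S" "Fib S \<inter> Weq S" f] factor_cofib Cofib_Mor Fib_Mor f by blast
  then show "\<exists>i\<in>Cofib (arr_model C S). \<exists>p\<in>Fib (arr_model C S) \<inter> Weq (arr_model C S).
      Cod (Arr C) i = Dom (Arr C) p \<and> f = p \<cdot>\<^bsub>Arr C\<^esub> i"
    using arr_cofib_iff[OF t] by (intro bexI[of _ t] bexI[of _ q]) (auto simp: arr_model_sel(1,2))
next
  fix f
  assume f: "f \<in> Mor (Arr C)"
  obtain t q where t: "t \<in> Mor (Arr C)" and q: "q \<in> Mor (Arr C)" "Cod (Arr C) t = Dom (Arr C) q" "f = q \<cdot>\<^bsub>Arr C\<^esub> t"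
    "\<forall>k. side q k \<in> Fib S" and c: "side t False \<in> Cofib S \<inter> Weq S" "\<exists>i j c. corner t i j c \<and> c \<in> Cofib S \<inter> Weq S"
    using factor_Arr[of "Cofib S \<inter> Weq S" "Fib S" f] factor_fib Cofib_Mor Fib_Mor f by blast
  then have "t \<in> Cofib (arr_model C S) \<inter> Weq (arr_model C S)"
    using arr_trivial_cofib_iff[OF t] by blast
  moreover have "q \<in> Fib (arr_model C S)"
    using q by (simp add: arr_model_sel)
  ultimately show "\<exists>i\<in>Cofib (arr_model C S) \<inter> Weq (arr_model C S). \<exists>p\<in>Fib (arr_model C S).
      Cod (Arr C) i = Dom (Arr C) p \<and> f = p \<cdot>\<^bsub>Arr C\<^esub> i"
    using q by blast
qed

end

section \<open>The pushout product axiom for arrows\<close>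

context cell_smcc
begin

interpretation A: category "Arr C"
  by (rule category_Arr)

lemma pp_liftsE:
  assumes "pp_lifts C f g p" "u \<in> hom C (Dom C f \<otimes> Cod C g) (Dom C p)" "v \<in> hom C (Cod C f \<otimes> Dom C g) (Dom C p)"
    "w \<in> hom C (Cod C f \<otimes> Cod C g) (Cod C p)" "u \<cdot> (Ide C (Dom C f) \<odot> g) = v \<cdot> (f \<odot> Ide C (Dom C g))"
    "p \<cdot> u = w \<cdot> (f \<odot> Ide C (Cod C g))" "p \<cdot> v = w \<cdot> (Ide C (Cod C f) \<odot> g)"
  obtains l where "l \<in> hom C (Cod C f \<otimes> Cod C g) (Dom C p)" "l \<cdot> (f \<odot> Ide C (Cod C g)) = u"
    "l \<cdot> (Ide C (Cod C f) \<odot> g) = v" "p \<cdot> l = w"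
  using assms unfolding pp_lifts_def by blast

text \<open>
  Let \<open>s\<close> go from \<open>f\<close> to \<open>f'\<close> and \<open>t\<close> from \<open>g\<close> to \<open>g'\<close>.  A lift for the pushout product of \<open>s\<close> and
  \<open>t\<close> is built one vertex pair at a time: first on \<open>f'\<^sub>1 \<otimes> g'\<^sub>0\<close>, then on
  \<open>f'\<^sub>0 \<otimes> g'\<^sub>1\<close>, where it must also agree with the first piece and hence is prescribed on the corner
  of \<open>t\<close>, and last on \<open>f'\<^sub>1 \<otimes> g'\<^sub>1\<close>, where it is prescribed on both corners.
\<close>

lemma pp_lifts_Arr:
  assumes s: "s \<in> Mor (Arr C)" and t: "t \<in> Mor (Arr C)" and p: "p \<in> Mor (Arr C)"
    and cs: "corner s si sj c" and ct: "corner t ti tj d"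
    and l10: "pp_lifts C (side s True) (side t False) (side p False)"
    and l01: "pp_lifts C (side s False) d (side p False)"
    and l11: "pp_lifts C c d (side p True)"
  shows "pp_lifts (Arr C) s t p"
  unfolding pp_lifts_def Arr_fields
proof (intro ballI impI)
  define f f' g g' z y where "f = Dom (Arr C) s" and "f' = Cod (Arr C) s" and "g = Dom (Arr C) t"
    and "g' = Cod (Arr C) t" and "z = Dom (Arr C) p" and "y = Cod (Arr C) p"
  note ds = f_def[symmetric] f'_def[symmetric] g_def[symmetric] g'_def[symmetric] z_def[symmetric] y_def[symmetric]
  have M: "f \<in> Mor C" "f' \<in> Mor C" "g \<in> Mor C" "g' \<in> Mor C" "z \<in> Mor C" "y \<in> Mor C"
    using s t p by (auto simp: f_def f'_def g_def g'_def z_def y_def)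
  define s0 s1 t0 t1 p0 p1 where "s0 = side s False" and "s1 = side s True" and "t0 = side t False"
    and "t1 = side t True" and "p0 = side p False" and "p1 = side p True"
  note sds = s0_def[symmetric] s1_def[symmetric] t0_def[symmetric] t1_def[symmetric] p0_def[symmetric] p1_def[symmetric]
  have S: "s0 \<in> hom C (Dom C f) (Dom C f')" "s1 \<in> hom C (Cod C f) (Cod C f')"
    "t0 \<in> hom C (Dom C g) (Dom C g')" "t1 \<in> hom C (Cod C g) (Cod C g')"
    "p0 \<in> hom C (Dom C z) (Dom C y)" "p1 \<in> hom C (Cod C z) (Cod C y)"
    using s t p by (auto simp: f_def f'_def g_def g'_def z_def y_def s0_def s1_def t0_def t1_def p0_def p1_def)
  have sq: "f' \<cdot> s0 = s1 \<cdot> f" "g' \<cdot> t0 = t1 \<cdot> g" "y \<cdot> p0 = p1 \<cdot> z"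
    using Arr_square[OF s] Arr_square[OF t] Arr_square[OF p] unfolding ds sds .
  have pos: "is_pushout C f s0 si sj" and pot: "is_pushout C g t0 ti tj"
    and cc: "c \<in> hom C (Cod C sj) (Cod C f')" "c \<cdot> si = s1" "c \<cdot> sj = f'"
    and dd: "d \<in> hom C (Cod C tj) (Cod C g')" "d \<cdot> ti = t1" "d \<cdot> tj = g'"
    using cs ct unfolding corner_def ds sds by auto
  have J: "si \<in> hom C (Cod C f) (Cod C sj)" "sj \<in> hom C (Dom C f') (Cod C sj)"
    "ti \<in> hom C (Cod C g) (Cod C tj)" "tj \<in> hom C (Dom C g') (Cod C tj)"
    using is_pushout_typing[OF pos] is_pushout_typing[OF pot] S by auto
  fix u v w
  assume u: "u \<in> hom (Arr C) (Dom (Arr C) s \<box> Cod (Arr C) t) (Dom (Arr C) p)"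
    and v: "v \<in> hom (Arr C) (Cod (Arr C) s \<box> Dom (Arr C) t) (Dom (Arr C) p)"
    and w: "w \<in> hom (Arr C) (Cod (Arr C) s \<box> Cod (Arr C) t) (Cod (Arr C) p)"
    and uv: "u \<cdot>\<^bsub>Arr C\<^esub> arr_tensor C (Ide (Arr C) (Dom (Arr C) s)) t
      = v \<cdot>\<^bsub>Arr C\<^esub> arr_tensor C s (Ide (Arr C) (Dom (Arr C) t))"
    and pu: "p \<cdot>\<^bsub>Arr C\<^esub> u = w \<cdot>\<^bsub>Arr C\<^esub> arr_tensor C s (Ide (Arr C) (Cod (Arr C) t))"
    and pv: "p \<cdot>\<^bsub>Arr C\<^esub> v = w \<cdot>\<^bsub>Arr C\<^esub> arr_tensor C (Ide (Arr C) (Cod (Arr C) s)) t"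
  note u = u[unfolded ds] and v = v[unfolded ds] and w = w[unfolded ds]
    and uv = uv[unfolded ds] and pu = pu[unfolded ds] and pv = pv[unfolded ds]
  define U V W where "U = (\<lambda>i j. side u (i \<and> j) \<cdot> pair C f g' i j)"
    and "V = (\<lambda>i j. side v (i \<and> j) \<cdot> pair C f' g i j)" and "W = (\<lambda>i j. side w (i \<and> j) \<cdot> pair C f' g' i j)"
  note Un = pair_family[OF M(1,4) u U_def] and Vn = pair_family[OF M(2,3) v V_def]
    and Wn = pair_family[OF M(2,4) w W_def]
  have UT: "U False True \<in> hom C (Dom C f \<otimes> Cod C g') (Dom C z)" "U True False \<in> hom C (Cod C f \<otimes> Dom C g') (Dom C z)"
    "U True True \<in> hom C (Cod C f \<otimes> Cod C g') (Cod C z)"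
    using Un(1)[of False True] Un(1)[of True False] Un(1)[of True True] by simp_all
  have VT: "V False True \<in> hom C (Dom C f' \<otimes> Cod C g) (Dom C z)" "V True False \<in> hom C (Cod C f' \<otimes> Dom C g) (Dom C z)"
    "V True True \<in> hom C (Cod C f' \<otimes> Cod C g) (Cod C z)"
    using Vn(1)[of False True] Vn(1)[of True False] Vn(1)[of True True] by simp_all
  have WT: "W False True \<in> hom C (Dom C f' \<otimes> Cod C g') (Dom C y)" "W True False \<in> hom C (Cod C f' \<otimes> Dom C g') (Dom C y)"
    "W True True \<in> hom C (Cod C f' \<otimes> Cod C g') (Cod C y)"
    using Wn(1)[of False True] Wn(1)[of True False] Wn(1)[of True True] by simp_all
  have UV: "U i j \<cdot> (Ide C (vertex C f i) \<odot> side t j) = V i j \<cdot> (side s i \<odot> Ide C (vertex C g j))" for i j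
  proof -
    have "side (u \<cdot>\<^bsub>Arr C\<^esub> arr_tensor C (Ide (Arr C) f) t) (i \<and> j) \<cdot> pair C f g i j
      = side (v \<cdot>\<^bsub>Arr C\<^esub> arr_tensor C s (Ide (Arr C) g)) (i \<and> j) \<cdot> pair C f g i j"
      unfolding uv ..
    then show ?thesis
      using M s t u v by (simp add: arr_tensor_pairs ds U_def V_def)
  qed
  have PU: "side p (i \<and> j) \<cdot> U i j = W i j \<cdot> (side s i \<odot> Ide C (vertex C g' j))" for i j
  proof -
    have "side (p \<cdot>\<^bsub>Arr C\<^esub> u) (i \<and> j) \<cdot> pair C f g' i j
      = side (w \<cdot>\<^bsub>Arr C\<^esub> arr_tensor C s (Ide (Arr C) g')) (i \<and> j) \<cdot> pair C f g' i j"
      unfolding pu ..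
    then show ?thesis
      using M s t p u w by (simp add: arr_tensor_pairs ds U_def W_def)
  qed
  have PV: "side p (i \<and> j) \<cdot> V i j = W i j \<cdot> (Ide C (vertex C f' i) \<odot> side t j)" for i j
  proof -
    have "side (p \<cdot>\<^bsub>Arr C\<^esub> v) (i \<and> j) \<cdot> pair C f' g i j
      = side (w \<cdot>\<^bsub>Arr C\<^esub> arr_tensor C (Ide (Arr C) f') t) (i \<and> j) \<cdot> pair C f' g i j"
      unfolding pv ..
    then show ?thesis
      using M s t p v w by (simp add: arr_tensor_pairs ds V_def W_def)
  qed
  note UV' = UV[of False True, simplified, unfolded sds] UV[of True False, simplified, unfolded sds]
    UV[of True True, simplified, unfolded sds]
  note PU' = PU[of False True, simplified, unfolded sds] PU[of True False, simplified, unfolded sds]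
    PU[of True True, simplified, unfolded sds]
  note PV' = PV[of False True, simplified, unfolded sds] PV[of True False, simplified, unfolded sds]
    PV[of True True, simplified, unfolded sds]
  have T: "f \<in> Mor C" "f' \<in> Mor C" "g \<in> Mor C" "g' \<in> Mor C" "z \<in> Mor C" "y \<in> Mor C"
    "s0 \<in> hom C (Dom C f) (Dom C f')" "s1 \<in> hom C (Cod C f) (Cod C f')"
    "t0 \<in> hom C (Dom C g) (Dom C g')" "t1 \<in> hom C (Cod C g) (Cod C g')"
    "p0 \<in> hom C (Dom C z) (Dom C y)" "p1 \<in> hom C (Cod C z) (Cod C y)"
    by (fact M S)+
  \<comment> \<open>The piece on \<open>f'\<^sub>1 \<otimes> g'\<^sub>0\<close>.\<close>
  obtain x10 where x10: "x10 \<in> hom C (Cod C f' \<otimes> Dom C g') (Dom C z)"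
    and x10u: "x10 \<cdot> (s1 \<odot> Ide C (Dom C g')) = U True False"
    and x10v: "x10 \<cdot> (Ide C (Cod C f') \<odot> t0) = V True False" and x10w: "p0 \<cdot> x10 = W True False"
    by (rule pp_liftsE[OF l10[unfolded sds], of "U True False" "V True False" "W True False"])
      (use UT VT WT UV'(2) PU'(2) PV'(2) T in simp_all)
  \<comment> \<open>The piece on \<open>f'\<^sub>0 \<otimes> g'\<^sub>1\<close>.\<close>
  have "V False True \<cdot> (Ide C (Dom C f') \<odot> g) = V True False \<cdot> (f' \<odot> Ide C (Dom C g))"
    using Vn(2,3) by simp
  also have "\<dots> = x10 \<cdot> (f' \<odot> Ide C (Dom C g')) \<cdot> (Ide C (Dom C f') \<odot> t0)"
    unfolding x10v[symmetric] using x10 T by (simp add: interchange)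
  finally obtain e where e: "e \<in> hom C (Dom C f' \<otimes> Cod C tj) (Dom C z)"
    "e \<cdot> (Ide C (Dom C f') \<odot> ti) = V False True" "e \<cdot> (Ide C (Dom C f') \<odot> tj) = x10 \<cdot> (f' \<odot> Ide C (Dom C g'))"
    by (rule is_pushout_exists[OF pushout_tensor_left[OF pot, of "Dom C f'"], rotated 3])
      (use VT x10 T J in simp_all)
  have eU: "U False True \<cdot> (Ide C (Dom C f) \<odot> d) = e \<cdot> (s0 \<odot> Ide C (Cod C tj))"
  proof (rule is_pushout_unique[OF pushout_tensor_left[OF pot, of "Dom C f"], of _ "Dom C z"])
    have "(e \<cdot> (s0 \<odot> Ide C (Cod C tj))) \<cdot> (Ide C (Dom C f) \<odot> ti)
      = (e \<cdot> (Ide C (Dom C f') \<odot> ti)) \<cdot> (s0 \<odot> Ide C (Cod C g))"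
      using e(1) T J by (simp add: interchange)
    then show "(U False True \<cdot> (Ide C (Dom C f) \<odot> d)) \<cdot> (Ide C (Dom C f) \<odot> ti)
      = (e \<cdot> (s0 \<odot> Ide C (Cod C tj))) \<cdot> (Ide C (Dom C f) \<odot> ti)"
      unfolding e(2) using UT UV'(1) T J dd by (simp add: interchange)
    have "(e \<cdot> (s0 \<odot> Ide C (Cod C tj))) \<cdot> (Ide C (Dom C f) \<odot> tj)
      = (e \<cdot> (Ide C (Dom C f') \<odot> tj)) \<cdot> (s0 \<odot> Ide C (Dom C g'))"
      using e(1) T J by (simp add: interchange)
    also have "\<dots> = (x10 \<cdot> (s1 \<odot> Ide C (Dom C g'))) \<cdot> (f \<odot> Ide C (Dom C g'))"
      unfolding e(3) using x10 T sq(1) by (simp add: interchange)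
    also have "\<dots> = U False True \<cdot> (Ide C (Dom C f) \<odot> g')"
      unfolding x10u using Un(2,3) by simp
    finally show "(U False True \<cdot> (Ide C (Dom C f) \<odot> d)) \<cdot> (Ide C (Dom C f) \<odot> tj)
      = (e \<cdot> (s0 \<odot> Ide C (Cod C tj))) \<cdot> (Ide C (Dom C f) \<odot> tj)"
      using UT T J dd by (simp add: interchange)
  qed (use UT e T J dd in simp_all)
  have eW: "p0 \<cdot> e = W False True \<cdot> (Ide C (Dom C f') \<odot> d)"
  proof (rule is_pushout_unique[OF pushout_tensor_left[OF pot, of "Dom C f'"], of _ "Dom C y"])
    show "(p0 \<cdot> e) \<cdot> (Ide C (Dom C f') \<odot> ti) = (W False True \<cdot> (Ide C (Dom C f') \<odot> d)) \<cdot> (Ide C (Dom C f') \<odot> ti)"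
      using e WT PV'(1) T J dd by (simp add: interchange)
    have "(p0 \<cdot> e) \<cdot> (Ide C (Dom C f') \<odot> tj) = (p0 \<cdot> x10) \<cdot> (f' \<odot> Ide C (Dom C g'))"
      using e x10 T J by simp
    also have "\<dots> = W False True \<cdot> (Ide C (Dom C f') \<odot> g')"
      unfolding x10w using Wn(2,3) by simp
    finally show "(p0 \<cdot> e) \<cdot> (Ide C (Dom C f') \<odot> tj) = (W False True \<cdot> (Ide C (Dom C f') \<odot> d)) \<cdot> (Ide C (Dom C f') \<odot> tj)"
      using WT T J dd by (simp add: interchange)
  qed (use WT e T J dd in simp_all)
  obtain x01 where x01: "x01 \<in> hom C (Dom C f' \<otimes> Cod C g') (Dom C z)"
    and x01u: "x01 \<cdot> (s0 \<odot> Ide C (Cod C g')) = U False True"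
    and x01e: "x01 \<cdot> (Ide C (Dom C f') \<odot> d) = e" and x01w: "p0 \<cdot> x01 = W False True"
    by (rule pp_liftsE[OF l01[unfolded sds], of "U False True" e "W False True"])
      (use UT e(1) WT eU eW PU'(1) T J dd(1) in simp_all)
  have x01v: "x01 \<cdot> (Ide C (Dom C f') \<odot> t1) = V False True"
    using Comp_extend[OF x01e, of "Ide C (Dom C f') \<odot> ti"] x01 e T J dd by (simp add: interchange)
  have x01x10: "x01 \<cdot> (Ide C (Dom C f') \<odot> g') = x10 \<cdot> (f' \<odot> Ide C (Dom C g'))"
    using Comp_extend[OF x01e, of "Ide C (Dom C f') \<odot> tj"] x01 e T J dd by (simp add: interchange)
  \<comment> \<open>The piece on \<open>f'\<^sub>1 \<otimes> g'\<^sub>1\<close>.\<close>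
  have "U True True \<cdot> (f \<odot> Ide C (Cod C g')) = (z \<cdot> x01) \<cdot> (s0 \<odot> Ide C (Cod C g'))"
    unfolding Un(4)[symmetric] x01u[symmetric] using x01 T by simp
  then obtain a where a: "a \<in> hom C (Cod C sj \<otimes> Cod C g') (Cod C z)"
    "a \<cdot> (si \<odot> Ide C (Cod C g')) = U True True" "a \<cdot> (sj \<odot> Ide C (Cod C g')) = z \<cdot> x01"
    by (rule is_pushout_exists[OF pushout_tensor_right[OF pos, of "Cod C g'"], rotated 3])
      (use UT x01 T J in simp_all)
  have "V True True \<cdot> (Ide C (Cod C f') \<odot> g) = (z \<cdot> x10) \<cdot> (Ide C (Cod C f') \<odot> t0)"
    unfolding Vn(5)[symmetric] x10v[symmetric] using x10 T by simp
  then obtain b where b: "b \<in> hom C (Cod C f' \<otimes> Cod C tj) (Cod C z)"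
    "b \<cdot> (Ide C (Cod C f') \<odot> ti) = V True True" "b \<cdot> (Ide C (Cod C f') \<odot> tj) = z \<cdot> x10"
    by (rule is_pushout_exists[OF pushout_tensor_left[OF pot, of "Cod C f'"], rotated 3])
      (use VT x10 T J in simp_all)
  have ab: "a \<cdot> (Ide C (Cod C sj) \<odot> d) = b \<cdot> (c \<odot> Ide C (Cod C tj))"
  proof (rule is_pushout_unique[OF pushout_tensor_right[OF pos, of "Cod C tj"], of _ "Cod C z"])
    have 1: "(a \<cdot> (Ide C (Cod C sj) \<odot> d)) \<cdot> (k \<odot> Ide C (Cod C tj)) \<cdot> (Ide C (Dom C k) \<odot> m)
        = (a \<cdot> (k \<odot> Ide C (Cod C g'))) \<cdot> (Ide C (Dom C k) \<odot> (d \<cdot> m))"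
      and 2: "(b \<cdot> (c \<odot> Ide C (Cod C tj))) \<cdot> (k \<odot> Ide C (Cod C tj)) \<cdot> (Ide C (Dom C k) \<odot> m)
        = (b \<cdot> (Ide C (Cod C f') \<odot> m)) \<cdot> ((c \<cdot> k) \<odot> Ide C (Dom C m))"
      if "k \<in> Mor C" "Cod C k = Cod C sj" "m \<in> Mor C" "Cod C m = Cod C tj" for k m
      using that a(1) b(1) T cc(1) dd(1) J by (simp_all add: merge)
    show "(a \<cdot> (Ide C (Cod C sj) \<odot> d)) \<cdot> (si \<odot> Ide C (Cod C tj)) = (b \<cdot> (c \<odot> Ide C (Cod C tj))) \<cdot> (si \<odot> Ide C (Cod C tj))"
    proof (rule is_pushout_unique[OF pushout_tensor_left[OF pot, of "Cod C f"], of _ "Cod C z"])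
      show "((a \<cdot> (Ide C (Cod C sj) \<odot> d)) \<cdot> (si \<odot> Ide C (Cod C tj))) \<cdot> (Ide C (Cod C f) \<odot> ti)
        = ((b \<cdot> (c \<odot> Ide C (Cod C tj))) \<cdot> (si \<odot> Ide C (Cod C tj))) \<cdot> (Ide C (Cod C f) \<odot> ti)"
        using 1[of si ti] 2[of si ti] J a(2) b(2) cc(2) dd(2) UV'(3) by simp
      have "U True True \<cdot> (Ide C (Cod C f) \<odot> g') = (z \<cdot> x10) \<cdot> (s1 \<odot> Ide C (Dom C g'))"
        unfolding Un(5)[symmetric] x10u[symmetric] using x10 T by simp
      then show "((a \<cdot> (Ide C (Cod C sj) \<odot> d)) \<cdot> (si \<odot> Ide C (Cod C tj))) \<cdot> (Ide C (Cod C f) \<odot> tj)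
        = ((b \<cdot> (c \<odot> Ide C (Cod C tj))) \<cdot> (si \<odot> Ide C (Cod C tj))) \<cdot> (Ide C (Cod C f) \<odot> tj)"
        using 1[of si tj] 2[of si tj] J a(2) b(3) cc(2) dd(3) by simp
    qed (use a b cc dd T J in simp_all)
    show "(a \<cdot> (Ide C (Cod C sj) \<odot> d)) \<cdot> (sj \<odot> Ide C (Cod C tj)) = (b \<cdot> (c \<odot> Ide C (Cod C tj))) \<cdot> (sj \<odot> Ide C (Cod C tj))"
    proof (rule is_pushout_unique[OF pushout_tensor_left[OF pot, of "Dom C f'"], of _ "Cod C z"])
      have "(z \<cdot> x01) \<cdot> (Ide C (Dom C f') \<odot> t1) = V True True \<cdot> (f' \<odot> Ide C (Cod C g))"
        using Vn(4) x01v x01 T by simp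
      then show "((a \<cdot> (Ide C (Cod C sj) \<odot> d)) \<cdot> (sj \<odot> Ide C (Cod C tj))) \<cdot> (Ide C (Dom C f') \<odot> ti)
        = ((b \<cdot> (c \<odot> Ide C (Cod C tj))) \<cdot> (sj \<odot> Ide C (Cod C tj))) \<cdot> (Ide C (Dom C f') \<odot> ti)"
        using 1[of sj ti] 2[of sj ti] J a(3) b(2) cc(3) dd(2) by simp
      have "(z \<cdot> x01) \<cdot> (Ide C (Dom C f') \<odot> g') = (z \<cdot> x10) \<cdot> (f' \<odot> Ide C (Dom C g'))"
        using x01x10 x01 x10 T by simp
      then show "((a \<cdot> (Ide C (Cod C sj) \<odot> d)) \<cdot> (sj \<odot> Ide C (Cod C tj))) \<cdot> (Ide C (Dom C f') \<odot> tj)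
        = ((b \<cdot> (c \<odot> Ide C (Cod C tj))) \<cdot> (sj \<odot> Ide C (Cod C tj))) \<cdot> (Ide C (Dom C f') \<odot> tj)"
        using 1[of sj tj] 2[of sj tj] J a(3) b(3) cc(3) dd(3) by simp
    qed (use a b cc dd T J in simp_all)
  qed (use a b cc dd T J in simp_all)
  have aW: "p1 \<cdot> a = W True True \<cdot> (c \<odot> Ide C (Cod C g'))"
  proof (rule is_pushout_unique[OF pushout_tensor_right[OF pos, of "Cod C g'"], of _ "Cod C y"])
    show "(p1 \<cdot> a) \<cdot> (si \<odot> Ide C (Cod C g')) = (W True True \<cdot> (c \<odot> Ide C (Cod C g'))) \<cdot> (si \<odot> Ide C (Cod C g'))"
      using a WT PU'(3) T J cc by (simp add: interchange)
    have "(p1 \<cdot> a) \<cdot> (sj \<odot> Ide C (Cod C g')) = (p1 \<cdot> z) \<cdot> x01"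
      using a x01 T J by simp
    also have "\<dots> = y \<cdot> W False True"
      unfolding sq(3)[symmetric] x01w[symmetric] using x01 T by simp
    finally show "(p1 \<cdot> a) \<cdot> (sj \<odot> Ide C (Cod C g')) = (W True True \<cdot> (c \<odot> Ide C (Cod C g'))) \<cdot> (sj \<odot> Ide C (Cod C g'))"
      using Wn(4) WT T J cc by (simp add: interchange)
  qed (use WT a T J cc in simp_all)
  have bW: "p1 \<cdot> b = W True True \<cdot> (Ide C (Cod C f') \<odot> d)"
  proof (rule is_pushout_unique[OF pushout_tensor_left[OF pot, of "Cod C f'"], of _ "Cod C y"])
    show "(p1 \<cdot> b) \<cdot> (Ide C (Cod C f') \<odot> ti) = (W True True \<cdot> (Ide C (Cod C f') \<odot> d)) \<cdot> (Ide C (Cod C f') \<odot> ti)"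
      using b WT PV'(3) T J dd by (simp add: interchange)
    have "(p1 \<cdot> b) \<cdot> (Ide C (Cod C f') \<odot> tj) = (p1 \<cdot> z) \<cdot> x10"
      using b x10 T J by simp
    also have "\<dots> = y \<cdot> W True False"
      unfolding sq(3)[symmetric] x10w[symmetric] using x10 T by simp
    finally show "(p1 \<cdot> b) \<cdot> (Ide C (Cod C f') \<odot> tj) = (W True True \<cdot> (Ide C (Cod C f') \<odot> d)) \<cdot> (Ide C (Cod C f') \<odot> tj)"
      using Wn(5) WT T J dd by (simp add: interchange)
  qed (use WT b T J dd in simp_all)
  obtain x11 where x11: "x11 \<in> hom C (Cod C f' \<otimes> Cod C g') (Cod C z)"
    and x11a: "x11 \<cdot> (c \<odot> Ide C (Cod C g')) = a" and x11b: "x11 \<cdot> (Ide C (Cod C f') \<odot> d) = b"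
    and x11w: "p1 \<cdot> x11 = W True True"
    by (rule pp_liftsE[OF l11[unfolded sds], of a b "W True True"])
      (use a(1) b(1) WT ab aW bW T J cc(1) dd(1) in simp_all)
  have x11u: "x11 \<cdot> (s1 \<odot> Ide C (Cod C g')) = U True True" and x11x01: "x11 \<cdot> (f' \<odot> Ide C (Cod C g')) = z \<cdot> x01"
    using Comp_extend[OF x11a, of "si \<odot> Ide C (Cod C g')"] Comp_extend[OF x11a, of "sj \<odot> Ide C (Cod C g')"]
      x11 a T J cc by (simp_all add: interchange)
  have x11v: "x11 \<cdot> (Ide C (Cod C f') \<odot> t1) = V True True" and x11x10: "x11 \<cdot> (Ide C (Cod C f') \<odot> g') = z \<cdot> x10"
    using Comp_extend[OF x11b, of "Ide C (Cod C f') \<odot> ti"] Comp_extend[OF x11b, of "Ide C (Cod C f') \<odot> tj"]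
      x11 b T J dd by (simp_all add: interchange)
  \<comment> \<open>The pieces assemble to a map of arrows.\<close>
  define \<chi> where "\<chi> i j = (if i then (if j then x11 else x10) else if j then x01 else x10 \<cdot> (f' \<odot> Ide C (Dom C g')))" for i j
  have \<chi>: "\<chi> i j \<in> hom C (vertex C f' i \<otimes> vertex C g' j) (vertex C z (i \<and> j))" for i j
    using x11 x10 x01 T by (cases i; cases j) (simp_all add: \<chi>_def)
  have x00: "x11 \<cdot> (f' \<odot> g') = z \<cdot> (x10 \<cdot> (f' \<odot> Ide C (Dom C g')))"
    using Comp_extend[OF x11x10, of "f' \<odot> Ide C (Dom C g')"] x11 x10 T by (simp add: interchange)
  have nat: "edge C z (i \<and> j) (i' \<and> j') \<cdot> \<chi> i j = \<chi> i' j' \<cdot> (edge C f' i i' \<odot> edge C g' j j')"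
    if "i \<longrightarrow> i'" "j \<longrightarrow> j'" for i j i' j'
    using that x11 x10 x01 x11x01 x11x10 x01x10 x00 T
    by (cases i; cases j; cases i'; cases j') (simp_all add: \<chi>_def)
  obtain l where l: "l \<in> hom (Arr C) (f' \<box> g') z" and l\<chi>: "\<forall>i j. side l (i \<and> j) \<cdot> pair C f' g' i j = \<chi> i j"
    using pushout_product_universal[OF M(2,4,5) \<chi> nat] by blast
  have tensor: "side (l \<cdot>\<^bsub>Arr C\<^esub> arr_tensor C q r) (i \<and> j) \<cdot> pair C a b i j = \<chi> i j \<cdot> (side q i \<odot> side r j)"
    if "q \<in> hom (Arr C) a f'" "r \<in> hom (Arr C) b g'" for q r a b i j
  proof -
    have "a \<in> Mor C" "b \<in> Mor C"
      using that by auto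
    then show ?thesis
      using that l M Comp_extend[OF l\<chi>[rule_format, of i j], of "side q i \<odot> side r j"]
      by (simp add: arr_tensor_pairs)
  qed
  have s': "s \<in> hom (Arr C) f f'" and t': "t \<in> hom (Arr C) g g'"
    using s t by (auto simp: ds)
  have If: "Ide (Arr C) f' \<in> hom (Arr C) f' f'" "Ide (Arr C) g' \<in> hom (Arr C) g' g'"
    using M by simp_all
  have "l \<cdot>\<^bsub>Arr C\<^esub> arr_tensor C s (Ide (Arr C) g') = u"
  proof (rule pushout_product_ext[OF M(1,4) _ u])
    fix i j
    have "\<chi> i j \<cdot> (side s i \<odot> Ide C (vertex C g' j)) = U i j"
    proof (cases "i \<or> j")
      case True
      then show ?thesis
        using x11u x10u x01u by (cases i; cases j) (simp_all add: \<chi>_def sds)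
    next
      case False
      have "(x10 \<cdot> (f' \<odot> Ide C (Dom C g'))) \<cdot> (s0 \<odot> Ide C (Dom C g'))
        = (x10 \<cdot> (s1 \<odot> Ide C (Dom C g'))) \<cdot> (f \<odot> Ide C (Dom C g'))"
        using x10 T sq(1) by (simp add: interchange)
      then show ?thesis
        using False x10u Un(3) by (simp add: \<chi>_def sds)
    qed
    then show "side (l \<cdot>\<^bsub>Arr C\<^esub> arr_tensor C s (Ide (Arr C) g')) (i \<and> j) \<cdot> pair C f g' i j = side u (i \<and> j) \<cdot> pair C f g' i j"
      unfolding tensor[OF s' If(2)] U_def by simp
  qed (use l s' M in simp)
  moreover have "l \<cdot>\<^bsub>Arr C\<^esub> arr_tensor C (Ide (Arr C) f') t = v"
  proof (rule pushout_product_ext[OF M(2,3) _ v])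
    fix i j
    have "\<chi> i j \<cdot> (Ide C (vertex C f' i) \<odot> side t j) = V i j"
    proof (cases "i \<or> j")
      case True
      then show ?thesis
        using x11v x10v x01v by (cases i; cases j) (simp_all add: \<chi>_def sds)
    next
      case False
      have "(x10 \<cdot> (f' \<odot> Ide C (Dom C g'))) \<cdot> (Ide C (Dom C f') \<odot> t0)
        = (x10 \<cdot> (Ide C (Cod C f') \<odot> t0)) \<cdot> (f' \<odot> Ide C (Dom C g))"
        using x10 T by (simp add: interchange)
      then show ?thesis
        using False x10v Vn(3) by (simp add: \<chi>_def sds)
    qed
    then show "side (l \<cdot>\<^bsub>Arr C\<^esub> arr_tensor C (Ide (Arr C) f') t) (i \<and> j) \<cdot> pair C f' g i j = side v (i \<and> j) \<cdot> pair C f' g i j"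
      unfolding tensor[OF If(1) t'] V_def by simp
  qed (use l t' M in simp)
  moreover have "p \<cdot>\<^bsub>Arr C\<^esub> l = w"
  proof (rule pushout_product_ext[OF M(2,4) _ w])
    fix i j
    have "side p (i \<and> j) \<cdot> \<chi> i j = W i j"
    proof (cases "i \<or> j")
      case True
      then show ?thesis
        using x11w x10w x01w by (cases i; cases j) (simp_all add: \<chi>_def sds)
    next
      case False
      have "p0 \<cdot> (x10 \<cdot> (f' \<odot> Ide C (Dom C g'))) = (p0 \<cdot> x10) \<cdot> (f' \<odot> Ide C (Dom C g'))"
        using x10 T by simp
      then show ?thesis
        using False x10w Wn(3) by (simp add: \<chi>_def sds)
    qed
    then show "side (p \<cdot>\<^bsub>Arr C\<^esub> l) (i \<and> j) \<cdot> pair C f' g' i j = side w (i \<and> j) \<cdot> pair C f' g' i j"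
      using l\<chi>[rule_format, of i j] l p M by (simp add: W_def ds)
  qed (use l p in \<open>simp add: ds\<close>)
  ultimately show "\<exists>l\<in>hom (Arr C) (Cod (Arr C) s \<box> Cod (Arr C) t) (Dom (Arr C) p).
      l \<cdot>\<^bsub>Arr C\<^esub> arr_tensor C s (Ide (Arr C) (Cod (Arr C) t)) = u \<and>
      l \<cdot>\<^bsub>Arr C\<^esub> arr_tensor C (Ide (Arr C) (Cod (Arr C) s)) t = v \<and> p \<cdot>\<^bsub>Arr C\<^esub> l = w"
    unfolding ds using l by blast
qed

end

text \<open>
  The corner maps and components of (trivial) cofibrations of arrows are (trivial) cofibrations in
  \<open>C\<close>, so the pushout product axiom in \<open>C\<close> supplies the three lifts.
\<close>

lemma monoidal_model_category_Arr:
  fixes \<kappa> :: "'s rel" and C :: "('o, 'm) cell_smcat"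
  assumes \<kappa>: "Cinfinite \<kappa>" and C: "monoidal_model_category \<kappa> C S"
  shows "monoidal_model_category \<kappa> (Arr C) (arr_model C S)"
proof -
  interpret M: monoidal_model_category \<kappa> C S by (rule C)
  interpret F: finitely_bicomplete_category C
    by (rule finitely_bicomplete_if_bicomplete[OF \<kappa> M.category_axioms M.bicomplete])
  interpret cell_model \<kappa> C S
    by unfold_locales
  interpret A: symmetric_monoidal_closed_category "Arr C"
    by (rule symmetric_monoidal_closed_Arr)
  interpret A: model_category \<kappa> "Arr C" "arr_model C S"
    by (rule model_category_Arr)
  interpret AF: finitely_bicomplete_category "Arr C"
    by (rule finitely_bicomplete_if_bicomplete[OF \<kappa> A.category_axioms A.bicomplete])
  interpret A: finitely_bicomplete_smcc "Arr C"
    by unfold_locales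
  \<comment> \<open>One argument for both halves of the axiom: \<open>triv\<close> says which of \<open>s\<close>, \<open>t\<close>, \<open>p\<close> is a weak equivalence, and
    \<open>L\<close> may rely on the corresponding fact in \<open>C\<close>.\<close>
  have pp: "lifts (Arr C) (pushout_product (Arr C) s t) p"
    if s: "s \<in> Cofib (arr_model C S)" and t: "t \<in> Cofib (arr_model C S)" and p: "p \<in> Mor (Arr C)"
      and L: "\<And>a b k. a \<in> Cofib S \<Longrightarrow> b \<in> Cofib S
        \<Longrightarrow> s \<in> Weq (arr_model C S) \<and> a \<in> Weq S \<or> t \<in> Weq (arr_model C S) \<and> b \<in> Weq S \<or>
            p \<in> Weq (arr_model C S)
        \<Longrightarrow> lifts C (pushout_product C a b) (side p k)"
      and triv: "s \<in> Weq (arr_model C S) \<or> t \<in> Weq (arr_model C S) \<or> p \<in> Weq (arr_model C S)"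
    for s t p
  proof -
    have M: "s \<in> Mor (Arr C)" "t \<in> Mor (Arr C)"
      using s t by auto
    obtain si sj c where c: "corner s si sj c"
      using corner_exists[OF M(1)] by blast
    obtain ti tj d where d: "corner t ti tj d"
      using corner_exists[OF M(2)] by blast
    have s': "side s False \<in> Cofib S" "c \<in> Cofib S" "side s True \<in> Cofib S"
      using arr_cofib_iff[OF M(1) c] s corner_cofib[OF M(1) c] by auto
    have t': "side t False \<in> Cofib S" "d \<in> Cofib S"
      using arr_cofib_iff[OF M(2) d] t by auto
    have sW: "side s False \<in> Weq S" "c \<in> Weq S" "side s True \<in> Weq S" if "s \<in> Weq (arr_model C S)"
      using that s arr_trivial_cofib_iff[OF M(1) c] arr_model_sel(1)[of s C S] by auto
    have tW: "side t False \<in> Weq S" "d \<in> Weq S" if "t \<in> Weq (arr_model C S)"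
      using that t arr_trivial_cofib_iff[OF M(2) d] by auto
    have pk: "side p k \<in> Mor C" for k
      using p by simp
    have "pp_lifts C (side s True) (side t False) (side p False)" "pp_lifts C (side s False) d (side p False)"
      "pp_lifts C c d (side p True)"
      using L[OF s'(3) t'(1), of False] L[OF s'(1) t'(2), of False] L[OF s'(2) t'(2), of True] triv sW tW
        lifts_pushout_product_iff[OF _ _ pk] s' t' by auto
    from pp_lifts_Arr[OF M p c d this] show ?thesis
      using A.lifts_pushout_product_iff[OF M p] by blast
  qed
  have side_Fib: "side p k \<in> Fib S" if "p \<in> Fib (arr_model C S)" for p k
    using that unfolding arr_model_sel(2) by blast
  have side_Weq: "side p k \<in> Weq S" if "p \<in> Weq (arr_model C S)" for p k
    using that unfolding arr_model_sel(1) by blast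
  show ?thesis
  proof unfold_locales
    fix f g
    assume f: "f \<in> Cofib (arr_model C S)" and g: "g \<in> Cofib (arr_model C S)"
    have M: "pushout_product (Arr C) f g \<in> Mor (Arr C)"
      using f g by simp
    show "pushout_product (Arr C) f g \<in> Cofib (arr_model C S)"
      unfolding A.Cofib_iff_lifts
    proof (intro conjI ballI M)
      fix p
      assume p: "p \<in> Fib (arr_model C S) \<inter> Weq (arr_model C S)"
      show "lifts (Arr C) (pushout_product (Arr C) f g) p"
      proof (rule pp[OF f g])
        show "lifts C (pushout_product C a b) (side p k)" if "a \<in> Cofib S" "b \<in> Cofib S" for a b k
          using M.pushout_product_cofib[OF that] side_Fib[of p k] side_Weq[of p k] p by (intro M.lift_cofib) auto
      qed (use p in auto)
    qed
    assume triv: "f \<in> Weq (arr_model C S) \<or> g \<in> Weq (arr_model C S)"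
    have "lifts (Arr C) (pushout_product (Arr C) f g) p" if p: "p \<in> Fib (arr_model C S)" for p
    proof (rule pp[OF f g])
      show "lifts C (pushout_product C a b) (side p k)"
        if ab: "a \<in> Cofib S" "b \<in> Cofib S"
          and w: "f \<in> Weq (arr_model C S) \<and> a \<in> Weq S \<or> g \<in> Weq (arr_model C S) \<and> b \<in> Weq S \<or> p \<in> Weq (arr_model C S)"
        for a b k
      proof (cases "p \<in> Weq (arr_model C S)")
        case True
        then show ?thesis
          using M.pushout_product_cofib[OF ab] side_Fib[of p k] side_Weq[of p k] p by (intro M.lift_cofib) auto
      next
        case False
        then show ?thesis
          using M.pushout_product_trivial[OF ab] w side_Fib[OF p, of k] by (intro M.lift_fib) auto
      qed
    qed (use p triv in auto)
    then show "pushout_product (Arr C) f g \<in> Cofib (arr_model C S) \<inter> Weq (arr_model C S)"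
      using M A.trivial_Cofib_iff_lifts by blast
  qed
qed

section \<open>Iteration\<close>

lemma projective_Suc: "projective (Suc n) M S = arr_model (cubes n M) (projective n M S)"
proof -
  let ?C = "cubes n M"
  have all: "(\<forall>i. Q i) \<longleftrightarrow> Q False \<and> Q True" for Q
    by (metis (full_types))
  have "{u \<in> Mor (Arr ?C). components u \<subseteq> X} = {s \<in> Mor (Arr ?C). \<forall>i. side s i \<in> {u \<in> Mor ?C. components u \<subseteq> X}}" for X
    by (auto simp: all) (auto simp: side_def Arr_def)
  then show ?thesis
    by (simp add: projective_def arr_model_def Let_def)
qed

subsection \<open>The given category as a category of cells\<close>

lemma cells_sel [simp]:
  "Obj (cells M) = Ob ` Obj M" "Mor (cells M) = Mo ` Mor M"
  "Dom (cells M) (Mo f) = Ob (Dom M f)" "Cod (cells M) (Mo f) = Ob (Cod M f)"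
  "Ide (cells M) (Ob x) = Mo (Ide M x)" "Mo g \<cdot>\<^bsub>cells M\<^esub> Mo f = Mo (g \<cdot>\<^bsub>M\<^esub> f)"
  "Ob x \<otimes>\<^bsub>cells M\<^esub> Ob y = Ob (x \<otimes>\<^bsub>M\<^esub> y)" "Mo f \<odot>\<^bsub>cells M\<^esub> Mo g = Mo (f \<odot>\<^bsub>M\<^esub> g)"
  "Unit (cells M) = Ob (Unit M)" "Assoc (cells M) (Ob x) (Ob y) (Ob z) = Mo (Assoc M x y z)"
  "LUnit (cells M) (Ob x) = Mo (LUnit M x)" "RUnit (cells M) (Ob x) = Mo (RUnit M x)"
  "Braid (cells M) (Ob x) (Ob y) = Mo (Braid M x y)"
  by (simp_all add: cells_def)

lemma hom_cells: "f \<in> hom (cells M) x y \<longleftrightarrow> (\<exists>a b h. f = Mo h \<and> x = Ob a \<and> y = Ob b \<and> h \<in> hom M a b)"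
  by auto

lemma hom_cells_Ob [simp]: "hom (cells M) (Ob x) (Ob y) = Mo ` hom M x y"
  by (auto simp: set_eq_iff)

lemma lifts_cells: "lifts (cells M) (Mo i) (Mo p) \<longleftrightarrow> lifts M i p"
  unfolding lifts_def by (simp del: hom_iff)

lemma pp_lifts_cells: "pp_lifts (cells M) (Mo f) (Mo g) (Mo p) \<longleftrightarrow> pp_lifts M f g p"
  unfolding pp_lifts_def by (simp del: hom_iff)

lemma is_retract_cells: "is_retract (cells M) (Mo f) (Mo g) \<longleftrightarrow> is_retract M f g"
  unfolding is_retract_def by (simp del: hom_iff)

lemma is_iso_cells: "is_iso (cells M) (Mo f) \<longleftrightarrow> is_iso M f"
  unfolding is_iso_def by (auto simp del: hom_iff)

lemma ex1_cells: "(\<exists>!h. h \<in> Mo ` X \<and> Q h) \<longleftrightarrow> (\<exists>!h. h \<in> X \<and> Q (Mo h))"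
  by (auto simp: Ex1_def)

lemma symmetric_monoidal_closed_cells:
  assumes "symmetric_monoidal_closed_category M"
  shows "symmetric_monoidal_closed_category (cells M)"
proof -
  interpret M: symmetric_monoidal_closed_category M by (rule assms)
  show ?thesis
  proof unfold_locales
    fix y z
    assume "y \<in> Obj (cells M)" "z \<in> Obj (cells M)"
    then obtain y' z' where y': "y = Ob y'" "y' \<in> Obj M" and z': "z = Ob z'" "z' \<in> Obj M"
      by auto
    obtain h e where "h \<in> Obj M" "e \<in> hom M (h \<otimes>\<^bsub>M\<^esub> y') z'"
      "\<forall>x \<in> Obj M. \<forall>f \<in> hom M (x \<otimes>\<^bsub>M\<^esub> y') z'. \<exists>!g. g \<in> hom M x h \<and> e \<cdot>\<^bsub>M\<^esub> (g \<odot>\<^bsub>M\<^esub> Ide M y') = f"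
      using M.closed[OF y'(2) z'(2)] by blast
    then show "\<exists>h\<in>Obj (cells M). \<exists>e\<in>hom (cells M) (h \<otimes>\<^bsub>cells M\<^esub> y) z.
        \<forall>x\<in>Obj (cells M). \<forall>f\<in>hom (cells M) (x \<otimes>\<^bsub>cells M\<^esub> y) z.
          \<exists>!g. g \<in> hom (cells M) x h \<and> e \<cdot>\<^bsub>cells M\<^esub> (g \<odot>\<^bsub>cells M\<^esub> Ide (cells M) y) = f"
      unfolding y'(1) z'(1)
      by (intro bexI[of _ "Ob h"] bexI[of _ "Mo e"]) (auto simp: ex1_cells simp del: hom_iff)
  qed (auto simp: is_iso_cells M.interchange M.Assoc_iso M.LUnit_iso M.RUnit_iso M.Assoc_nat M.Braid_nat
      M.LUnit_nat M.RUnit_nat M.pentagon_nested M.triangle M.hexagon_nested)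
qed

lemma limit_cells:
  assumes J: "category J" and F: "is_functor J (cells M) Fo Fm"
    and L: "is_limit J M (\<lambda>j. un_Ob (Fo j)) (\<lambda>u. un_Mo (Fm u)) x p"
  shows "is_limit J (cells M) Fo Fm (Ob x) (\<lambda>j. Mo (p j))"
proof -
  interpret J: category J by (rule J)
  have Fo: "Fo j = Ob (un_Ob (Fo j))" if "j \<in> Obj J" for j
    using F that unfolding is_functor_def by auto
  have Fm: "Fm u = Mo (un_Mo (Fm u))" if "u \<in> Mor J" for u
    using F that unfolding is_functor_def by auto
  have cone: "is_cone J (cells M) Fo Fm (Ob y) (\<lambda>j. Mo (q j))
      \<longleftrightarrow> is_cone J M (\<lambda>j. un_Ob (Fo j)) (\<lambda>u. un_Mo (Fm u)) y q" for y q
  proof -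
    have "Mo (q j) \<in> hom (cells M) (Ob y) (Fo j) \<longleftrightarrow> q j \<in> hom M y (un_Ob (Fo j))" if "j \<in> Obj J" for j
      by (subst Fo[OF that]) (auto simp del: hom_iff)
    moreover have "Fm u \<cdot>\<^bsub>cells M\<^esub> Mo (q (Dom J u)) = Mo (q (Cod J u))
        \<longleftrightarrow> un_Mo (Fm u) \<cdot>\<^bsub>M\<^esub> q (Dom J u) = q (Cod J u)" if "u \<in> Mor J" for u
      by (subst Fm[OF that]) simp
    ultimately show ?thesis
      unfolding is_cone_def by (auto simp del: hom_iff)
  qed
  show ?thesis
    unfolding is_limit_def
  proof (intro conjI allI impI)
    show "is_cone J (cells M) Fo Fm (Ob x) (\<lambda>j. Mo (p j))"
      unfolding cone using L unfolding is_limit_def by blast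
    fix y q
    assume c: "is_cone J (cells M) Fo Fm y q"
    then obtain y' where y': "y = Ob y'"
      unfolding is_cone_def by auto
    define q' where "q' j = un_Mo (q j)" for j
    have q: "q j = Mo (q' j)" if "j \<in> Obj J" for j
      using c that unfolding is_cone_def q'_def by auto
    have "is_cone J (cells M) Fo Fm (Ob y') (\<lambda>j. Mo (q' j))"
      using c q unfolding is_cone_def y' by simp
    then have "\<exists>!h. h \<in> hom M y' x \<and> (\<forall>j \<in> Obj J. p j \<cdot>\<^bsub>M\<^esub> h = q' j)"
      using L unfolding is_limit_def cone by blast
    then show "\<exists>!h. h \<in> hom (cells M) y (Ob x) \<and> (\<forall>j\<in>Obj J. Mo (p j) \<cdot>\<^bsub>cells M\<^esub> h = q j)"
      unfolding y' hom_cells_Ob ex1_cells by (simp add: q del: hom_iff)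
  qed
qed

lemma colimit_cells:
  assumes J: "category J" and F: "is_functor J (cells M) Fo Fm"
    and L: "is_colimit J M (\<lambda>j. un_Ob (Fo j)) (\<lambda>u. un_Mo (Fm u)) x p"
  shows "is_colimit J (cells M) Fo Fm (Ob x) (\<lambda>j. Mo (p j))"
proof -
  interpret J: category J by (rule J)
  have Fo: "Fo j = Ob (un_Ob (Fo j))" if "j \<in> Obj J" for j
    using F that unfolding is_functor_def by auto
  have Fm: "Fm u = Mo (un_Mo (Fm u))" if "u \<in> Mor J" for u
    using F that unfolding is_functor_def by auto
  have cocone: "is_cocone J (cells M) Fo Fm (Ob y) (\<lambda>j. Mo (q j))
      \<longleftrightarrow> is_cocone J M (\<lambda>j. un_Ob (Fo j)) (\<lambda>u. un_Mo (Fm u)) y q" for y q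
  proof -
    have "Mo (q j) \<in> hom (cells M) (Fo j) (Ob y) \<longleftrightarrow> q j \<in> hom M (un_Ob (Fo j)) y" if "j \<in> Obj J" for j
      by (subst Fo[OF that]) (auto simp del: hom_iff)
    moreover have "Mo (q (Cod J u)) \<cdot>\<^bsub>cells M\<^esub> Fm u = Mo (q (Dom J u))
        \<longleftrightarrow> q (Cod J u) \<cdot>\<^bsub>M\<^esub> un_Mo (Fm u) = q (Dom J u)" if "u \<in> Mor J" for u
      by (subst Fm[OF that]) simp
    ultimately show ?thesis
      unfolding is_cocone_def by (auto simp del: hom_iff)
  qed
  show ?thesis
    unfolding is_colimit_def
  proof (intro conjI allI impI)
    show "is_cocone J (cells M) Fo Fm (Ob x) (\<lambda>j. Mo (p j))"
      unfolding cocone using L unfolding is_colimit_def by blast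
    fix y q
    assume c: "is_cocone J (cells M) Fo Fm y q"
    then obtain y' where y': "y = Ob y'"
      unfolding is_cocone_def by auto
    define q' where "q' j = un_Mo (q j)" for j
    have q: "q j = Mo (q' j)" if "j \<in> Obj J" for j
      using c that unfolding is_cocone_def q'_def by auto
    have "is_cocone J (cells M) Fo Fm (Ob y') (\<lambda>j. Mo (q' j))"
      using c q unfolding is_cocone_def y' by simp
    then have "\<exists>!h. h \<in> hom M x y' \<and> (\<forall>j \<in> Obj J. h \<cdot>\<^bsub>M\<^esub> p j = q' j)"
      using L unfolding is_colimit_def cocone by blast
    then show "\<exists>!h. h \<in> hom (cells M) (Ob x) y \<and> (\<forall>j\<in>Obj J. h \<cdot>\<^bsub>cells M\<^esub> Mo (p j) = q j)"
      unfolding y' hom_cells_Ob ex1_cells by (simp add: q del: hom_iff)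
  qed
qed

lemma bicomplete_cells:
  fixes \<kappa> :: "'s rel"
  assumes "bicomplete \<kappa> M"
  shows "bicomplete \<kappa> (cells M)"
  unfolding bicomplete_def
proof (intro allI impI)
  fix J :: "('s, 's) cat" and Fo Fm
  assume J: "category J \<and> |Mor J| <o \<kappa> \<and> is_functor J (cells M) Fo Fm"
  have F: "is_functor J (cells M) Fo Fm" and cat: "category J"
    using J by auto
  interpret J: category J by (rule cat)
  have Fo: "Fo j = Ob (un_Ob (Fo j))" if "j \<in> Obj J" for j
    using F that unfolding is_functor_def by auto
  have Fm: "Fm u = Mo (un_Mo (Fm u))" if "u \<in> Mor J" for u
    using F that unfolding is_functor_def by auto
  have "is_functor J M (\<lambda>j. un_Ob (Fo j)) (\<lambda>u. un_Mo (Fm u))"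
    unfolding is_functor_def
  proof (intro conjI ballI impI)
    fix j
    assume j: "j \<in> Obj J"
    show "un_Ob (Fo j) \<in> Obj M"
      using F j unfolding is_functor_def by auto
    have "Fm (Ide J j) = Ide (cells M) (Fo j)"
      using F j unfolding is_functor_def by blast
    then show "un_Mo (Fm (Ide J j)) = Ide M (un_Ob (Fo j))"
      by (simp add: cells_def)
  next
    fix u
    assume u: "u \<in> Mor J"
    have "Fm u \<in> hom (cells M) (Fo (Dom J u)) (Fo (Cod J u))"
      using F u unfolding is_functor_def by blast
    then show "un_Mo (Fm u) \<in> hom M (un_Ob (Fo (Dom J u))) (un_Ob (Fo (Cod J u)))"
      unfolding hom_cells by auto
    fix v
    assume v: "v \<in> Mor J" "Dom J v = Cod J u"
    have "Fm (v \<cdot>\<^bsub>J\<^esub> u) = Fm v \<cdot>\<^bsub>cells M\<^esub> Fm u"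
      using F u v unfolding is_functor_def by blast
    then show "un_Mo (Fm (v \<cdot>\<^bsub>J\<^esub> u)) = un_Mo (Fm v) \<cdot>\<^bsub>M\<^esub> un_Mo (Fm u)"
      by (simp add: cells_def)
  qed
  then have "(\<exists>x p. is_limit J M (\<lambda>j. un_Ob (Fo j)) (\<lambda>u. un_Mo (Fm u)) x p) \<and>
      (\<exists>x p. is_colimit J M (\<lambda>j. un_Ob (Fo j)) (\<lambda>u. un_Mo (Fm u)) x p)"
    using J by (intro assms[unfolded bicomplete_def, rule_format]) blast
  then show "(\<exists>x p. is_limit J (cells M) Fo Fm x p) \<and> (\<exists>x p. is_colimit J (cells M) Fo Fm x p)"
    using limit_cells[OF cat F] colimit_cells[OF cat F] by blast
qed

lemma Mo_Int: "Mo ` A \<inter> Mo ` B = Mo ` (A \<inter> B)"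
  by auto

lemma Mo_image_iff: "Mo f \<in> Mo ` A \<longleftrightarrow> f \<in> A"
  by auto

lemma projective_0:
  assumes "model_category \<kappa> M S"
  shows "projective 0 M S = \<lparr>Weq = Mo ` Weq S, Cofib = Mo ` Cofib S, Fib = Mo ` Fib S\<rparr>"
proof -
  interpret M: model_category \<kappa> M S by (rule assms)
  have X: "{u \<in> Mor (cells M). components u \<subseteq> X} = Mo ` X" if "X \<subseteq> Mor M" for X
    using that by auto
  have "(\<forall>p \<in> Mo ` Fib S \<inter> Mo ` Weq S. lifts (cells M) (Mo i) p) \<longleftrightarrow> (\<forall>p \<in> Fib S \<inter> Weq S. lifts M i p)" for i
    by (simp add: Mo_Int lifts_cells)
  then have "{i \<in> Mor (cells M). \<forall>p \<in> Mo ` Fib S \<inter> Mo ` Weq S. lifts (cells M) i p} = Mo ` Cofib S"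
    using M.Cofib_iff_lifts by auto
  then show ?thesis
    by (simp add: projective_def Let_def X[OF M.Weq_Mor] X[OF M.Fib_Mor] del: cells_sel)
qed

text \<open>
  The chosen pushouts in \<open>cells M\<close> need not be the images of those in \<open>M\<close>; the pushout product
  axiom is compared through lifting problems, which do not mention them.
\<close>

lemma monoidal_model_category_cells:
  fixes \<kappa> :: "'s rel"
  assumes \<kappa>: "Cinfinite \<kappa>" and M: "monoidal_model_category \<kappa> M S"
  shows "monoidal_model_category \<kappa> (cells M) (projective 0 M S)"
proof -
  interpret M: monoidal_model_category \<kappa> M S by (rule M)
  interpret MF: finitely_bicomplete_category M
    by (rule finitely_bicomplete_if_bicomplete[OF \<kappa> M.category_axioms M.bicomplete])
  interpret MF: finitely_bicomplete_smcc M
    by unfold_locales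
  interpret C: symmetric_monoidal_closed_category "cells M"
    by (rule symmetric_monoidal_closed_cells) unfold_locales
  define P where "P = projective 0 M S"
  have P: "Weq P = Mo ` Weq S" "Cofib P = Mo ` Cofib S" "Fib P = Mo ` Fib S"
    unfolding P_def projective_0[OF M.model_category_axioms] by simp_all
  interpret C: model_category \<kappa> "cells M" P
  proof unfold_locales
    show "bicomplete \<kappa> (cells M)"
      by (rule bicomplete_cells[OF M.bicomplete])
  next
    fix f g x y z
    assume "f \<in> hom (cells M) x y" "g \<in> hom (cells M) y z"
    then obtain f' g' x' y' z' where f': "f = Mo f'" "g = Mo g'" "f' \<in> hom M x' y'" "g' \<in> hom M y' z'"
      unfolding hom_cells by blast
    show "(f \<in> Weq P \<and> g \<in> Weq P \<longrightarrow> g \<cdot>\<^bsub>cells M\<^esub> f \<in> Weq P) \<and>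
       (f \<in> Weq P \<and> g \<cdot>\<^bsub>cells M\<^esub> f \<in> Weq P \<longrightarrow> g \<in> Weq P) \<and>
       (g \<in> Weq P \<and> g \<cdot>\<^bsub>cells M\<^esub> f \<in> Weq P \<longrightarrow> f \<in> Weq P)"
      unfolding f'(1,2) cells_sel P Mo_image_iff by (rule M.two_of_three[OF f'(3,4)])
  next
    have r: "retract_closed (cells M) (Mo ` X)" if "retract_closed M X" for X
      using that unfolding retract_closed_def by (auto simp: is_retract_cells)
    show "retract_closed (cells M) (Weq P)" "retract_closed (cells M) (Cofib P)" "retract_closed (cells M) (Fib P)"
      unfolding P by (intro r M.retracts)+
  next
    show "lifts (cells M) i p" if "i \<in> Cofib P" "p \<in> Fib P \<inter> Weq P" for i p
      using that M.lift_cofib by (auto simp: P lifts_cells)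
    show "lifts (cells M) i p" if "i \<in> Cofib P \<inter> Weq P" "p \<in> Fib P" for i p
      using that M.lift_fib by (auto simp: P lifts_cells)
  next
    fix f
    assume "f \<in> Mor (cells M)"
    then obtain f' where f': "f = Mo f'" "f' \<in> Mor M"
      by auto
    obtain i p where ip: "i \<in> Cofib S" "p \<in> Fib S \<inter> Weq S" "Cod M i = Dom M p" "f' = p \<cdot>\<^bsub>M\<^esub> i"
      using M.factor_cofib[OF f'(2)] by blast
    show "\<exists>i\<in>Cofib P. \<exists>p\<in>Fib P \<inter> Weq P. Cod (cells M) i = Dom (cells M) p \<and> f = p \<cdot>\<^bsub>cells M\<^esub> i"
    proof (rule bexI[of _ "Mo i"], rule bexI[of _ "Mo p"], rule conjI)
      show "Cod (cells M) (Mo i) = Dom (cells M) (Mo p)" "f = Mo p \<cdot>\<^bsub>cells M\<^esub> Mo i"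
        unfolding f'(1) ip(4) by (simp_all only: cells_sel ip(3))
    qed (use ip(1,2) in \<open>simp_all add: P image_iff\<close>)
    obtain i p where ip: "i \<in> Cofib S \<inter> Weq S" "p \<in> Fib S" "Cod M i = Dom M p" "f' = p \<cdot>\<^bsub>M\<^esub> i"
      using M.factor_fib[OF f'(2)] by blast
    show "\<exists>i\<in>Cofib P \<inter> Weq P. \<exists>p\<in>Fib P. Cod (cells M) i = Dom (cells M) p \<and> f = p \<cdot>\<^bsub>cells M\<^esub> i"
    proof (rule bexI[of _ "Mo i"], rule bexI[of _ "Mo p"], rule conjI)
      show "Cod (cells M) (Mo i) = Dom (cells M) (Mo p)" "f = Mo p \<cdot>\<^bsub>cells M\<^esub> Mo i"
        unfolding f'(1) ip(4) by (simp_all only: cells_sel ip(3))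
    qed (use ip(1,2) in \<open>simp_all add: P image_iff\<close>)
  qed (auto simp: P)
  interpret CF: finitely_bicomplete_category "cells M"
    by (rule finitely_bicomplete_if_bicomplete[OF \<kappa> C.category_axioms C.bicomplete])
  interpret CF: finitely_bicomplete_smcc "cells M"
    by unfold_locales
  have pp: "lifts (cells M) (pushout_product (cells M) (Mo f) (Mo g)) (Mo p)
      \<longleftrightarrow> lifts M (pushout_product M f g) p"
    if "f \<in> Mor M" "g \<in> Mor M" "p \<in> Mor M" for f g p
    using CF.lifts_pushout_product_iff[of "Mo f" "Mo g" "Mo p"] MF.lifts_pushout_product_iff[of f g p] that
    by (simp add: pp_lifts_cells)
  show ?thesis
    unfolding P_def[symmetric]
  proof unfold_locales
    fix f g
    assume "f \<in> Cofib P" "g \<in> Cofib P"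
    then obtain f' g' where f': "f = Mo f'" "f' \<in> Cofib S" and g': "g = Mo g'" "g' \<in> Cofib S"
      by (auto simp: P)
    have m: "pushout_product (cells M) f g \<in> Mor (cells M)"
      by (rule CF.pushout_product_simps(1)) (use f' g' in auto)
    have "lifts (cells M) (pushout_product (cells M) f g) p" if "p \<in> Fib P \<inter> Weq P" for p
      using that f' g' pp M.lift_cofib[OF M.pushout_product_cofib[OF f'(2) g'(2)]] by (auto simp: P)
    then show "pushout_product (cells M) f g \<in> Cofib P"
      using m C.Cofib_iff_lifts by blast
    assume "f \<in> Weq P \<or> g \<in> Weq P"
    then have "f' \<in> Weq S \<or> g' \<in> Weq S"
      using f' g' by (auto simp: P)
    note t = M.pushout_product_trivial[OF f'(2) g'(2) this]
    have "lifts (cells M) (pushout_product (cells M) f g) p" if "p \<in> Fib P" for p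
      using that f' g' pp M.lift_fib[OF t] by (auto simp: P)
    then show "pushout_product (cells M) f g \<in> Cofib P \<inter> Weq P"
      using m C.trivial_Cofib_iff_lifts by blast
  qed
qed

theorem corollary2:
  fixes \<kappa> :: "'s rel"
    and M :: "('o, 'm) smcat"
    and S :: "'m model_structure"
    and n :: nat
  assumes "Cinfinite \<kappa>"
    and "monoidal_model_category \<kappa> M S"
    and "n \<ge> 1"
  shows "monoidal_model_category \<kappa> (cubes n M) (projective n M S)"
proof (induction n)
  case 0
  show ?case
    using monoidal_model_category_cells[OF assms(1,2)] by simp
next
  case (Suc n)
  then show ?case
    using monoidal_model_category_Arr[OF assms(1)] by (simp add: projective_Suc)
qed

end
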